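(* Let $S\subseteq\mathbb R^d$ ($d\ge1$) be a non-empty set which is a Polish space in the subspace topology, with Borel $\sigma$-algebra $\mathcal S$, let $R$ be a Markov kernel on $(S,\mathcal S)$ and $U_0$ a probability measure on $(S,\mathcal S)$. Let $(U_n)_{n\ge0}$ be the urn model with colors indexed by $S$, replacement kernel $R$ and initial configuration $U_0$, with drawn colors $(Z_n)_{n\ge0}$. Suppose there exist a (non-random) probability measure $\Lambda$ on $(\mathbb R^d,\mathcal B_{\mathbb R^d})$, a vector $\mathbf v\in\mathbb R^d$ and functions $a:\mathbb R_+\to\mathbb R$, $b:\mathbb R_+\to\mathbb R_+$ such that, for the Markov chain $(X_n)_{n\ge0}$ with transition kernel $R$ started from any initial distribution on $S$, $$\frac{X_n-a(n)\mathbf v}{b(n)}\Rightarrow\Lambda .$$ Let $\mathcal F_n:=\sigma(Z_0,\dots,Z_{n-1})$, let $P_n$ be the regular conditional distribution of $Z_n$ given $\mathcal F_n$ (so $P_n=\frac{U_n}{n+1}$ almost surely), and let $P_n^{cs}$ be the conditional distribution of $\frac{Z_n-a(\log n)\mathbf v}{b(\log n)}$ given $\mathcal F_n$. Then, as $n\to\infty$: (a) If $a\equiv0$ and $b\equiv1$, then $P_n^{cs}=P_n\stackrel{p}{\longrightarrow}\Lambda$ in $\mathcal P(S)$. (b) If $a\equiv0$ and $b$ is regularly varying, then $P_n^{cs}\stackrel{p}{\longrightarrow}\Lambda$ in $\mathcal P(\mathbb R^d)$. (c) If $a$ is differentiable with $\lim_{x\to\infty}a'(x)=\tilde a<\infty$,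 and $b$ is regularly varying with $\lim_{x\to\infty}\frac{\sqrt x}{b(x)}=\tilde b<\infty$, then $P_n^{cs}\stackrel{p}{\longrightarrow}\Xi$ in $\mathcal P(\mathbb R^d)$, where $\Xi=\Lambda$ if $\tilde a=0$ or $\tilde b=0$, and otherwise $\Xi$ is the convolution of $\Lambda$ and $\mathrm{Normal}(0,\tilde a^2\tilde b^2)\,\mathbf v$.
   Context: A Markov kernel $R$ on $(S,\mathcal S)$ is a map $R:S\times\mathcal S\to[0,1]$ such that $R(s,\cdot)$ is a probability measure for every $s$ and $s\mapsto R(s,A)$ is measurable for every $A\in\mathcal S$. Urn model: given the probability measure $U_0$ (non-random), the random finite measures $U_n$ on $(S,\mathcal S)$ and random colors $Z_n\in S$ are defined recursively for $n\ge0$ by: conditionally on the past (the previous draws $Z_0,\dots,Z_{n-1}$, hence $U_0,\dots,U_n$), $Z_n$ has distribution $U_n/(n+1)$; and $U_{n+1}(A)=U_n(A)+R(Z_n,A)$ for $A\in\mathcal S$. $\mathcal P(S)$ and $\mathcal P(\mathbb R^d)$ are the spaces of Borel probability measures with the topology of weak convergence; $\stackrel{p}{\to}$ is convergence in probability of random elements of these (metrizable) spaces. $\Rightarrow$ is convergence in distribution. Regular variation is at infinity. $\mathrm{Normal}(0,\sigma^2)\mathbf v$ denotes the law of $N\mathbf v$ with $N\sim\mathrm{Normal}(0,\sigma^2)$ a real random variable; $\tilde a,\tilde b$ are finite real numbers.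
   Formalization: In (a), convergence in P(S) is stated when Λ(S)=1, with Λ restricted to S; without this Λ need not lie in P(S) (S=(0,1), R(s,·)=δ_{s/2}, Λ=δ_0). Convergence in P(R^d) is still covered by (b). The aside that P_n=U_n/(n+1) a.s. is not restated. *)

theory Defs
  imports "HOL-Probability.Probability"
begin

definition polish_topology :: "'a topology \<Rightarrow> bool" where
  "polish_topology X \<longleftrightarrow> completely_metrizable_space X \<and> separable_space X"

abbreviation borel_on :: "'a::topological_space set \<Rightarrow> 'a measure" where
  "borel_on S \<equiv> restrict_space borel S"

definition prob_on :: "'a measure \<Rightarrow> 'a measure \<Rightarrow> bool" where
  "prob_on N \<mu> \<longleftrightarrow> prob_space \<mu> \<and> sets \<mu> = sets N"

text \<open>A Markov kernel on \<open>N\<close> in the usual sense is the case of equal source and target.\<close>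

definition markov_kernel :: "'w measure \<Rightarrow> 'a measure \<Rightarrow> ('w \<Rightarrow> 'a measure) \<Rightarrow> bool" where
  "markov_kernel F N K \<longleftrightarrow>
     (\<forall>\<omega>\<in>space F. prob_on N (K \<omega>)) \<and>
     (\<forall>A\<in>sets N. (\<lambda>\<omega>. measure (K \<omega>) A) \<in> borel_measurable F)"

definition past :: "'w measure \<Rightarrow> 'a measure \<Rightarrow> (nat \<Rightarrow> 'w \<Rightarrow> 'a) \<Rightarrow> nat \<Rightarrow> 'w measure" where
  "past M N Z n = sigma (space M) (\<Union>i<n. {Z i -` A \<inter> space M |A. A \<in> sets N})"

text \<open>\<open>K\<close> is a version of the regular conditional distribution of the \<open>N\<close>-valued random
  variable \<open>Y\<close> given the sub-\<open>\<sigma>\<close>-algebra \<open>F\<close>.\<close>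

definition regular_cond_distr ::
    "'w measure \<Rightarrow> 'w measure \<Rightarrow> 'a measure \<Rightarrow> ('w \<Rightarrow> 'a) \<Rightarrow> ('w \<Rightarrow> 'a measure) \<Rightarrow> bool" where
  "regular_cond_distr M F N Y K \<longleftrightarrow>
     markov_kernel F N K \<and>
     (\<forall>A\<in>sets N. AE \<omega> in M.
        real_cond_exp M F (indicat_real (Y -` A \<inter> space M)) \<omega> = measure (K \<omega>) A)"

definition markov_chain ::
    "'w measure \<Rightarrow> 'a measure \<Rightarrow> ('a \<Rightarrow> 'a measure) \<Rightarrow> 'a measure \<Rightarrow> (nat \<Rightarrow> 'w \<Rightarrow> 'a) \<Rightarrow> bool" where
  "markov_chain M N R \<mu> X \<longleftrightarrow>
     prob_space M \<and>
     (\<forall>n. X n \<in> M \<rightarrow>\<^sub>M N) \<and>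
     distr M N (X 0) = \<mu> \<and>
     (\<forall>n. regular_cond_distr M (past M N X (Suc n)) N (X (Suc n)) (\<lambda>\<omega>. R (X n \<omega>)))"

definition urn_model ::
    "'w measure \<Rightarrow> 'a measure \<Rightarrow> ('a \<Rightarrow> 'a measure) \<Rightarrow> 'a measure \<Rightarrow>
     (nat \<Rightarrow> 'w \<Rightarrow> 'a measure) \<Rightarrow> (nat \<Rightarrow> 'w \<Rightarrow> 'a) \<Rightarrow> bool" where
  "urn_model M N R U\<^sub>0 U Z \<longleftrightarrow>
     prob_space M \<and>
     (\<forall>n. Z n \<in> M \<rightarrow>\<^sub>M N) \<and>
     (\<forall>\<omega>\<in>space M. U 0 \<omega> = U\<^sub>0) \<and>
     (\<forall>n. \<forall>\<omega>\<in>space M. sets (U n \<omega>) = sets N \<and>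
        (\<forall>A\<in>sets N. emeasure (U (Suc n) \<omega>) A = emeasure (U n \<omega>) A + emeasure (R (Z n \<omega>)) A)) \<and>
     (\<forall>n. regular_cond_distr M (past M N Z n) N (Z n)
        (\<lambda>\<omega>. scale_measure (ennreal (1 / real (n + 1))) (U n \<omega>)))"

text \<open>The topology of weak convergence on the Borel probability measures on \<open>S\<close>: the coarsest
  one making the integrals of all bounded continuous real functions on \<open>S\<close> continuous.\<close>

definition weak_topology :: "'a::topological_space set \<Rightarrow> 'a measure topology" where
  "weak_topology S = topology_generated_by
     {{\<mu>. prob_on (borel_on S) \<mu> \<and> (\<integral>x. f x \<partial>\<mu>) \<in> V} |(f :: 'a \<Rightarrow> real) V.
        continuous_on S f \<and> bounded (f ` S) \<and> open V}"

definition conv_in_distribution ::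
    "'w measure \<Rightarrow> (nat \<Rightarrow> 'w \<Rightarrow> 'a::topological_space) \<Rightarrow> 'a measure \<Rightarrow> bool" where
  "conv_in_distribution M Y \<Lambda> \<longleftrightarrow>
     (\<forall>f :: 'a \<Rightarrow> real. continuous_on UNIV f \<and> bounded (range f) \<longrightarrow>
        (\<lambda>n. \<integral>\<omega>. f (Y n \<omega>) \<partial>M) \<longlonglongrightarrow> (\<integral>x. f x \<partial>\<Lambda>))"

text \<open>Convergence in probability to a constant, stated without choosing a metric for the
  metrizable topology \<open>X\<close>; for any metric inducing \<open>X\<close> it is the usual notion, by the lemma below.
  For the weak topology on the probability measures on a separable metrizable space, open
  sets are measurable for the \<open>\<sigma>\<close>-algebra generated by the evaluations, so that all events
  involved are measurable whenever the \<open>Y n\<close> are Markov kernels.\<close>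

definition conv_in_prob :: "'w measure \<Rightarrow> 'b topology \<Rightarrow> (nat \<Rightarrow> 'w \<Rightarrow> 'b) \<Rightarrow> 'b \<Rightarrow> bool" where
  "conv_in_prob M X Y c \<longleftrightarrow> c \<in> topspace X \<and>
     (\<forall>G. openin X G \<and> c \<in> G \<longrightarrow> (\<lambda>n. measure M {\<omega>\<in>space M. Y n \<omega> \<notin> G}) \<longlonglongrightarrow> 0)"

lemma (in Metric_space) conv_in_prob_mtopology:
  assumes "prob_space P" and c: "c \<in> M"
    and Y: "\<And>n \<omega>. \<omega> \<in> space P \<Longrightarrow> Y n \<omega> \<in> M"
    and meas: "\<And>n G. openin mtopology G \<Longrightarrow> {\<omega>\<in>space P. Y n \<omega> \<in> G} \<in> sets P"
  shows "conv_in_prob P mtopology Y c \<longleftrightarrow>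
    (\<forall>\<epsilon>>0. (\<lambda>n. measure P {\<omega>\<in>space P. d (Y n \<omega>) c \<ge> \<epsilon>}) \<longlonglongrightarrow> 0)"
proof -
  interpret P: prob_space P by fact
  have eq: "{\<omega>\<in>space P. Y n \<omega> \<notin> mball c \<epsilon>} = {\<omega>\<in>space P. d (Y n \<omega>) c \<ge> \<epsilon>}" for n \<epsilon>
    using Y c by (auto simp: commute not_less)
  have cmeas: "{\<omega>\<in>space P. Y n \<omega> \<notin> G} \<in> sets P" if "openin mtopology G" for n G
  proof -
    have "{\<omega>\<in>space P. Y n \<omega> \<notin> G} = space P - {\<omega>\<in>space P. Y n \<omega> \<in> G}"
      by auto
    with meas[OF that] show ?thesis by auto
  qed
  show ?thesis
  proof
    assume L: "conv_in_prob P mtopology Y c"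
    show "\<forall>\<epsilon>>0. (\<lambda>n. measure P {\<omega>\<in>space P. d (Y n \<omega>) c \<ge> \<epsilon>}) \<longlonglongrightarrow> 0"
      using L c unfolding conv_in_prob_def eq[symmetric] by auto
  next
    assume R: "\<forall>\<epsilon>>0. (\<lambda>n. measure P {\<omega>\<in>space P. d (Y n \<omega>) c \<ge> \<epsilon>}) \<longlonglongrightarrow> 0"
    have "(\<lambda>n. measure P {\<omega>\<in>space P. Y n \<omega> \<notin> G}) \<longlonglongrightarrow> 0"
      if G: "openin mtopology G" "c \<in> G" for G
    proof -
      obtain r where r: "r > 0" "mball c r \<subseteq> G"
        using G by (auto simp: openin_mtopology)
      have lim: "(\<lambda>n. measure P {\<omega>\<in>space P. Y n \<omega> \<notin> mball c r}) \<longlonglongrightarrow> 0"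
        using R r unfolding eq by auto
      show ?thesis
      proof (rule tendsto_sandwich[OF _ _ tendsto_const lim])
        show "\<forall>\<^sub>F n in sequentially. measure P {\<omega>\<in>space P. Y n \<omega> \<notin> G}
            \<le> measure P {\<omega>\<in>space P. Y n \<omega> \<notin> mball c r}"
          using r cmeas[OF openin_mball] by (intro always_eventually allI P.finite_measure_mono) auto
      qed auto
    qed
    with c show "conv_in_prob P mtopology Y c"
      by (auto simp: conv_in_prob_def)
  qed
qed

definition regularly_varying :: "(real \<Rightarrow> real) \<Rightarrow> bool" where
  "regularly_varying b \<longleftrightarrow>
     (\<exists>x\<^sub>0. b \<in> borel_measurable (restrict_space borel {x\<^sub>0..}) \<and> (\<forall>x\<ge>x\<^sub>0. b x > 0)) \<and>
     (\<exists>\<rho>. \<forall>c>0. ((\<lambda>x. b (c * x) / b x) \<longlongrightarrow> c powr \<rho>) at_top)"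

text \<open>The law of \<open>N v\<close> for a centred normal variable \<open>N\<close> with standard deviation \<open>\<sigma> > 0\<close>.\<close>

definition normal_along :: "real \<Rightarrow> 'a::real_normed_vector \<Rightarrow> 'a measure" where
  "normal_along \<sigma> v = distr (density lborel (\<lambda>x. ennreal (normal_density 0 \<sigma> x))) borel (\<lambda>x. x *\<^sub>R v)"

end

theory Submission
  imports Defs "HOL-Real_Asymp.Real_Asymp"
begin

text \<open>Write \<open>P\<^sub>n = U\<^sub>n / (n + 1)\<close>. Given the past, the mean of \<open>P\<^sub>n\<^sub>+\<^sub>1 f\<close> is \<open>P\<^sub>n (A\<^sub>n f)\<close> with
  \<open>A\<^sub>n f = ((n + 1) f + R f) / (n + 2)\<close>, so \<open>P\<^sub>n f\<close> is compared with \<open>P\<^sub>K (A\<^sub>K \<dots> A\<^sub>n\<^sub>-\<^sub>1 f)\<close>: the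
  difference is a sum of orthogonal increments, and its second moment is at most
  \<open>4 B\<^sup>2 / (K + 1)\<close> if \<open>f\<close> is bounded by \<open>B\<close>, uniformly in \<open>n\<close>. On the other hand
  \<open>A\<^sub>K \<dots> A\<^sub>n\<^sub>-\<^sub>1 f (s)\<close> is the mean of \<open>f\<close> at the chain started at \<open>s\<close>, observed at an independent
  time that is a sum of Bernoulli variables of parameters \<open>1 / (i + 2)\<close>, \<open>K \<le> i < n\<close>. This time is
  \<open>ln n + sqrt (ln n) N\<close> up to lower order with \<open>N\<close> standard normal, so that the rescaled chain
  converges to \<open>\<Lambda>\<close> shifted by \<open>a' b' N v\<close>, for every starting point; here \<open>b\<close> at the random time
  may be replaced by \<open>b (ln n)\<close> by the uniform convergence theorem of regular variation. Letting first \<open>n\<close> and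
  then \<open>K\<close> tend to infinity gives the theorem.\<close>

section \<open>Bounded measurable functions and conditional distributions\<close>

text \<open>Test functions are handled one at a time and their bound \<open>B\<close> is carried
  explicitly: the rescaling changes the test function with \<open>n\<close>, so an estimate is
  useful only if it depends on the function through \<open>B\<close> alone. For fixed
  \<open>K\<close> the fluctuation bound does not shrink as \<open>n\<close> grows; it is made small
  by \<open>K\<close> alone. The random law of the urn at time \<open>K\<close> then does no harm,
  because the limit of the mean is the same from every starting point and dominated convergence
  applies. Conditioning on the depth leaves a deterministic double array, indexed by time and depth.
  Its limit is known along depth sequences with a limiting standardised value, so convergence in law
  of the depth is first turned into pointwise convergence on an auxiliary space. Two further
  obstacles shape the proof. The hypothesis speaks of realised chains, so a chain has to be
  constructed from each point. And in case (a) the test functions are continuous on \<open>S\<close>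
  only and may have no continuous extension, so they are approximated by minorants instead.\<close>

definition bdd_measurable :: "'a measure \<Rightarrow> real \<Rightarrow> ('a \<Rightarrow> real) \<Rightarrow> bool" where
  "bdd_measurable N B f \<longleftrightarrow> f \<in> borel_measurable N \<and> (\<forall>x\<in>space N. \<bar>f x\<bar> \<le> B)"

lemma bdd_measurable_measurable: "bdd_measurable N B f \<Longrightarrow> f \<in> borel_measurable N"
  and bdd_measurable_abs_le: "bdd_measurable N B f \<Longrightarrow> x \<in> space N \<Longrightarrow> \<bar>f x\<bar> \<le> B"
  by (auto simp: bdd_measurable_def)

text \<open>A monotone class principle in terms of linear combinations and bounded pointwise limits,
  the two operations that integrals respect. It rests on the induction for nonnegative functions,
  applied to \<open>f + B\<close>.\<close>

lemma bdd_measurable_induct [consumes 1, case_names set lin lim]: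
  fixes f :: "'a \<Rightarrow> real"
  assumes f: "bdd_measurable N B f"
    and set: "\<And>A. A \<in> sets N \<Longrightarrow> P (indicat_real A)"
    and lin: "\<And>f g B C c d. bdd_measurable N B f \<Longrightarrow> P f \<Longrightarrow> bdd_measurable N C g \<Longrightarrow> P g \<Longrightarrow>
                P (\<lambda>x. c * f x + d * g x)"
    and lim: "\<And>s g B. (\<And>i. bdd_measurable N B (s i)) \<Longrightarrow> (\<And>i. P (s i)) \<Longrightarrow>
                (\<And>x. x \<in> space N \<Longrightarrow> (\<lambda>i::nat. s i x) \<longlonglongrightarrow> g x) \<Longrightarrow> P g"
  shows "P f"
proof -
  have f_meas[measurable]: "f \<in> borel_measurable N" and fB: "\<And>x. x \<in> space N \<Longrightarrow> \<bar>f x\<bar> \<le> B"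
    using f by (auto simp: bdd_measurable_def)
  \<comment> \<open>Off \<open>space N\<close> nothing bounds \<open>f\<close>, so the shift alone
    need not be nonnegative there; truncation at 0 repairs this and changes nothing on
    \<open>space N\<close>.\<close>
  define g where "g x = max 0 (f x + B)" for x
  have g: "g \<in> borel_measurable N" "\<And>x. 0 \<le> g x"
    unfolding g_def[abs_def] by auto
  have P0: "P (\<lambda>x. 0)"
    using lin[of 0 "indicat_real {}" 0 "indicat_real {}" 0 0] set[of "{}"]
    by (simp add: bdd_measurable_def)
  \<comment> \<open>Case \<open>lin\<close> asks for bounds, which the nonnegative induction does
    not supply. Carrying the bound as a premise works because the parts of a nonnegative sum and the
    members of an increasing sequence lie below the whole.\<close>
  have "(\<exists>C. \<forall>x\<in>space N. g x \<le> C) \<longrightarrow> P g"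
    using g
  proof (induction rule: borel_measurable_induct_real)
    case (set A) then show ?case using assms(2) by auto
  next
    case (mult u c)
    show ?case
    proof (cases "c = 0")
      case True with P0 show ?thesis by simp
    next
      case False
      with mult have c: "c > 0" by simp
      show ?thesis
      proof safe
        fix C assume C: "\<forall>x\<in>space N. c * u x \<le> C"
        then have u: "\<forall>x\<in>space N. u x \<le> C / c" using c by (simp add: field_simps)
        then have "bdd_measurable N (C / c) u" "P u"
          using mult by (auto simp: bdd_measurable_def)
        then show "P (\<lambda>x. c * u x)" using lin[of "C/c" u "C/c" u c 0] by simp
      qed
    qed
  next
    case (add u v)
    show ?case
    proof safe
      fix C assume C: "\<forall>x\<in>space N. v x + u x \<le> C"
      have "\<forall>x\<in>space N. v x \<le> C" "\<forall>x\<in>space N. u x \<le> C"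
      proof safe
        fix x assume "x \<in> space N"
        then have "v x + u x \<le> C" using C by blast
        with add.hyps(2,4)[of x] show "v x \<le> C" "u x \<le> C" by linarith+
      qed
      then have "bdd_measurable N C v" "P v" "bdd_measurable N C u" "P u"
        using add.hyps add.IH by (auto simp: bdd_measurable_def)
      then show "P (\<lambda>x. v x + u x)" using lin[of C v C u 1 1] by simp
    qed
  next
    case (seq V)
    show ?case
    proof safe
      fix C assume C: "\<forall>x\<in>space N. g x \<le> C"
      have le: "V i x \<le> C" if "x \<in> space N" for i x
      proof -
        have "incseq (\<lambda>i. V i x)" using seq.hyps(3) by (auto simp: mono_def le_fun_def)
        then have "V i x \<le> g x" using incseq_le[OF _ seq.hyps(4)[OF that]] by auto
        with C that show ?thesis by force
      qed
      then have "bdd_measurable N C (V i)" for i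
        using seq.hyps by (auto simp: bdd_measurable_def)
      moreover have "P (V i)" for i
        using seq.IH[of i] le by blast
      ultimately show "P g" using seq.hyps(4) by (rule lim)
    qed
  qed
  moreover have gB: "bdd_measurable N (2 * B) g"
    unfolding bdd_measurable_def using g(1)
  proof safe
    fix x assume "x \<in> space N"
    from fB[OF this] show "\<bar>g x\<bar> \<le> 2 * B" by (simp add: g_def)
  qed
  ultimately have "P g"
    by (auto simp: bdd_measurable_def abs_le_iff)
  moreover have "bdd_measurable N 1 (indicat_real (space N))" "P (indicat_real (space N))"
    using set by (auto simp: bdd_measurable_def)
  ultimately have P: "P (\<lambda>x. 1 * g x + (- B) * indicat_real (space N) x)"
    using lin[OF gB] by blast
  have eq: "1 * g x + (- B) * indicat_real (space N) x = f x" if "x \<in> space N" for x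
    using that fB[OF that] by (auto simp: g_def abs_le_iff)
  \<comment> \<open>The function shifted back agrees with \<open>f\<close> only on
    \<open>space N\<close>. Case \<open>lim\<close>, for a constant sequence, moves \<open>P\<close>
    to \<open>f\<close>, as it asks for convergence on \<open>space N\<close> only.\<close>
  show ?thesis
  proof (rule lim[of B "\<lambda>i x. 1 * g x + (- B) * indicat_real (space N) x"])
    show "bdd_measurable N B (\<lambda>x. 1 * g x + (- B) * indicat_real (space N) x)"
      using g(1) eq fB by (auto simp: bdd_measurable_def simp del: mult_minus_left)
  qed (use P eq in auto)
qed

lemma bdd_measurable_comp:
  "bdd_measurable N B f \<Longrightarrow> Y \<in> M \<rightarrow>\<^sub>M N \<Longrightarrow> bdd_measurable M B (\<lambda>\<omega>. f (Y \<omega>))"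
  unfolding bdd_measurable_def by (auto dest: measurable_space)

lemma bdd_measurable_mult:
  "bdd_measurable N B f \<Longrightarrow> bdd_measurable N C g \<Longrightarrow> bdd_measurable N (B * C) (\<lambda>x. f x * g x)"
  unfolding bdd_measurable_def
  by (auto simp: abs_mult intro!: mult_mono)

lemma bdd_measurable_lin:
  assumes "bdd_measurable N B f" "bdd_measurable N C g"
  shows "bdd_measurable N (\<bar>c\<bar> * B + \<bar>d\<bar> * C) (\<lambda>x. c * f x + d * g x)"
proof -
  have "\<bar>c * f x + d * g x\<bar> \<le> \<bar>c\<bar> * B + \<bar>d\<bar> * C" if "x \<in> space N" for x
  proof -
    have "\<bar>c * f x + d * g x\<bar> \<le> \<bar>c\<bar> * \<bar>f x\<bar> + \<bar>d\<bar> * \<bar>g x\<bar>"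
      by (metis abs_mult abs_triangle_ineq)
    also have "\<dots> \<le> \<bar>c\<bar> * B + \<bar>d\<bar> * C"
      using assms that by (intro add_mono mult_left_mono) (auto simp: bdd_measurable_def)
    finally show ?thesis .
  qed
  with assms show ?thesis by (auto simp: bdd_measurable_def)
qed

lemma bdd_measurable_diff:
  "bdd_measurable N B f \<Longrightarrow> bdd_measurable N C g \<Longrightarrow> bdd_measurable N (B + C) (\<lambda>x. f x - g x)"
  using bdd_measurable_lin[of N B f C g 1 "-1"] by simp

lemma bdd_measurable_cong_sets:
  "sets N = sets M \<Longrightarrow> bdd_measurable N B f \<longleftrightarrow> bdd_measurable M B f"
  unfolding bdd_measurable_def
  using sets_eq_imp_space_eq[of N M] measurable_cong_sets[of N M "borel::real measure" borel] by simp

lemma bdd_measurable_subalgebra: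
  "subalgebra M F \<Longrightarrow> bdd_measurable F B f \<Longrightarrow> bdd_measurable M B f"
  by (auto simp: bdd_measurable_def subalgebra_def measurable_from_subalg)

lemma (in prob_space)
  assumes "bdd_measurable M B f"
  shows integrable_bdd_measurable: "integrable M f"
    and abs_integral_le_bdd_measurable: "\<bar>\<integral>x. f x \<partial>M\<bar> \<le> B"
proof -
  show i: "integrable M f"
    using assms by (intro integrable_const_bound[where B=B]) (auto simp: bdd_measurable_def)
  have "\<bar>\<integral>x. f x \<partial>M\<bar> \<le> (\<integral>x. \<bar>f x\<bar> \<partial>M)"
    using integral_abs_bound by blast
  also have "\<dots> \<le> (\<integral>x. B \<partial>M)"
    using i assms by (intro integral_mono) (auto simp: bdd_measurable_def)
  finally show "\<bar>\<integral>x. f x \<partial>M\<bar> \<le> B" by (simp add: prob_space)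
qed

lemma (in prob_space) integral_bdd_measurable_LIMSEQ:
  assumes "\<And>i. bdd_measurable M B (s i)" "\<And>x. x \<in> space M \<Longrightarrow> (\<lambda>i. s i x) \<longlonglongrightarrow> f x"
  shows "(\<lambda>i. \<integral>x. s i x \<partial>M) \<longlonglongrightarrow> (\<integral>x. f x \<partial>M)"
proof (rule integral_dominated_convergence[where w="\<lambda>_. B"])
  have s: "s i \<in> borel_measurable M" for i
    using assms(1)[of i] by (simp add: bdd_measurable_def)
  show "f \<in> borel_measurable M"
    by (rule borel_measurable_LIMSEQ_real[OF assms(2) s])
  show "AE x in M. norm (s i x) \<le> B" for i
    using assms(1)[of i] by (intro AE_I2) (simp add: bdd_measurable_def)
  show "AE x in M. (\<lambda>i. s i x) \<longlonglongrightarrow> f x"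
    using assms(2) by (intro AE_I2)
qed (use assms(1) in \<open>simp_all add: bdd_measurable_def\<close>)

lemma prob_on_bdd_measurable: "prob_on N \<mu> \<Longrightarrow> bdd_measurable N B f \<Longrightarrow> bdd_measurable \<mu> B f"
  using bdd_measurable_cong_sets[of \<mu> N B f] by (simp add: prob_on_def)

lemma prob_on_space: "prob_on N \<mu> \<Longrightarrow> space \<mu> = space N"
  by (auto simp: prob_on_def dest: sets_eq_imp_space_eq)

lemma
  assumes p: "prob_on N \<mu>" and f: "bdd_measurable N B f"
  shows integrable_prob_on: "integrable \<mu> f"
    and abs_integral_prob_on_le: "\<bar>\<integral>x. f x \<partial>\<mu>\<bar> \<le> B"
proof -
  interpret prob_space \<mu> using p by (simp add: prob_on_def)
  show "integrable \<mu> f" "\<bar>\<integral>x. f x \<partial>\<mu>\<bar> \<le> B"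
    using prob_on_bdd_measurable[OF p f]
    by (rule integrable_bdd_measurable abs_integral_le_bdd_measurable)+
qed

lemma integral_prob_on_lin:
  assumes "prob_on N \<mu>" "bdd_measurable N B f" "bdd_measurable N C g"
  shows "(\<integral>x. c * f x + d * g x \<partial>\<mu>) = c * (\<integral>x. f x \<partial>\<mu>) + d * (\<integral>x. g x \<partial>\<mu>)"
  using integrable_prob_on[OF assms(1,2)] integrable_prob_on[OF assms(1,3)] by simp

lemma integral_prob_on_LIMSEQ:
  assumes p: "prob_on N \<mu>" and s: "\<And>i. bdd_measurable N B (s i)"
    and lim: "\<And>x. x \<in> space N \<Longrightarrow> (\<lambda>i. s i x) \<longlonglongrightarrow> f x"
  shows "(\<lambda>i. \<integral>x. s i x \<partial>\<mu>) \<longlonglongrightarrow> (\<integral>x. f x \<partial>\<mu>)"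
proof -
  interpret prob_space \<mu> using p by (simp add: prob_on_def)
  show ?thesis
    using prob_on_bdd_measurable[OF p s] lim[folded prob_on_space[OF p]]
    by (rule integral_bdd_measurable_LIMSEQ)
qed

lemma integral_indicator_prob_on:
  "prob_on N \<mu> \<Longrightarrow> A \<in> sets N \<Longrightarrow> (\<integral>x. indicat_real A x \<partial>\<mu>) = measure \<mu> A"
  using sets.sets_into_space[of A N] prob_on_space[of N \<mu>] by (simp add: Int_absorb2)

text \<open>Turns the additive recursion of the urn, which is given on sets, into one for test
  functions.\<close>

lemma integral_mixture:
  assumes p: "prob_on N \<mu>" "prob_on N \<nu>" "prob_on N \<rho>"
    and mix: "\<And>A. A \<in> sets N \<Longrightarrow> measure \<mu> A = \<alpha> * measure \<nu> A + \<beta> * measure \<rho> A"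
    and f: "bdd_measurable N B f"
  shows "(\<integral>x. f x \<partial>\<mu>) = \<alpha> * (\<integral>x. f x \<partial>\<nu>) + \<beta> * (\<integral>x. f x \<partial>\<rho>)"
  using f
proof (induction f rule: bdd_measurable_induct)
  case (set A)
  show ?case
    unfolding integral_indicator_prob_on[OF p(1) set] integral_indicator_prob_on[OF p(2) set]
      integral_indicator_prob_on[OF p(3) set] by (rule mix[OF set])
next
  case (lin f g B C c d)
  then show ?case
    by (simp only: integral_prob_on_lin[OF p(1) lin.hyps] integral_prob_on_lin[OF p(2) lin.hyps]
        integral_prob_on_lin[OF p(3) lin.hyps] lin.IH) (simp add: algebra_simps)
next
  case (lim t g B)
  have "(\<lambda>i. \<integral>x. t i x \<partial>\<mu>) \<longlonglongrightarrow> (\<integral>x. g x \<partial>\<mu>)"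
    using p(1) lim.hyps by (rule integral_prob_on_LIMSEQ)
  moreover have "(\<lambda>i. \<alpha> * (\<integral>x. t i x \<partial>\<nu>) + \<beta> * (\<integral>x. t i x \<partial>\<rho>)) \<longlonglongrightarrow>
      \<alpha> * (\<integral>x. g x \<partial>\<nu>) + \<beta> * (\<integral>x. g x \<partial>\<rho>)"
    by (intro tendsto_intros integral_prob_on_LIMSEQ[OF p(2) lim.hyps]
        integral_prob_on_LIMSEQ[OF p(3) lim.hyps])
  ultimately show ?case unfolding lim.IH by (rule LIMSEQ_unique)
qed

lemma bdd_measurable_kernel_integral:
  assumes K: "markov_kernel F N K" and f: "bdd_measurable N B f"
  shows "bdd_measurable F B (\<lambda>\<omega>. \<integral>x. f x \<partial>K \<omega>)"
proof -
  have p: "prob_on N (K \<omega>)" if "\<omega> \<in> space F" for \<omega>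
    using K that by (auto simp: markov_kernel_def)
  have "(\<lambda>\<omega>. \<integral>x. f x \<partial>K \<omega>) \<in> borel_measurable F"
    using f
  proof (induction f rule: bdd_measurable_induct)
    case (set A)
    have "(\<lambda>\<omega>. \<integral>x. indicat_real A x \<partial>K \<omega>) \<in> borel_measurable F \<longleftrightarrow> (\<lambda>\<omega>. measure (K \<omega>) A) \<in> borel_measurable F"
      using set by (intro measurable_cong integral_indicator_prob_on[OF p])
    with K set show ?case by (auto simp: markov_kernel_def)
  next
    case (lin f g B C c d)
    have "(\<lambda>\<omega>. \<integral>x. c * f x + d * g x \<partial>K \<omega>) \<in> borel_measurable F \<longleftrightarrow>
        (\<lambda>\<omega>. c * (\<integral>x. f x \<partial>K \<omega>) + d * (\<integral>x. g x \<partial>K \<omega>)) \<in> borel_measurable F"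
      by (intro measurable_cong integral_prob_on_lin[OF p lin.hyps])
    with lin.IH(1,2) show ?case by simp
  next
    case (lim s g B)
    show ?case
    proof (rule borel_measurable_LIMSEQ_real)
      show "(\<lambda>i. \<integral>x. s i x \<partial>K \<omega>) \<longlonglongrightarrow> (\<integral>x. g x \<partial>K \<omega>)" if "\<omega> \<in> space F" for \<omega>
        using p[OF that] lim.hyps by (rule integral_prob_on_LIMSEQ)
    qed (rule lim.IH)
  qed
  moreover have "\<bar>\<integral>x. f x \<partial>K \<omega>\<bar> \<le> B" if "\<omega> \<in> space F" for \<omega>
    using p[OF that] f by (rule abs_integral_prob_on_le)
  ultimately show ?thesis by (simp add: bdd_measurable_def)
qed

text \<open>Testing against a past-measurable weight \<open>W\<close> serves two purposes: with
  \<open>W\<close> the accumulated fluctuation it gives orthogonality of the increments, with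
  \<open>W = 1\<close> the one-step marginals of a chain.\<close>

lemma integral_regular_cond_distr:
  assumes M: "prob_space M" and sub: "subalgebra M F" and Y: "Y \<in> M \<rightarrow>\<^sub>M N"
    and K: "regular_cond_distr M F N Y K"
    and f: "bdd_measurable N B f" and W: "bdd_measurable F C W"
  shows "(\<integral>\<omega>. f (Y \<omega>) * W \<omega> \<partial>M) = (\<integral>\<omega>. (\<integral>x. f x \<partial>K \<omega>) * W \<omega> \<partial>M)"
  using f
proof (induction f rule: bdd_measurable_induct)
  interpret M: prob_space M by fact
  interpret fs: finite_measure_subalgebra M F
    using sub by unfold_locales
  have Kk: "markov_kernel F N K" using K by (simp add: regular_cond_distr_def)
  have spF: "space F = space M" using sub by (simp add: subalgebra_def)
  have p: "prob_on N (K \<omega>)" if "\<omega> \<in> space M" for \<omega>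
    using Kk that spF by (auto simp: markov_kernel_def)
  have WM: "bdd_measurable M C W" using bdd_measurable_subalgebra[OF sub W] .
  have Wm[measurable]: "W \<in> borel_measurable M" "W \<in> borel_measurable F"
    using WM W by (auto simp: bdd_measurable_def)
  note Y[measurable]
  have kb: "bdd_measurable M B (\<lambda>\<omega>. \<integral>x. h x \<partial>K \<omega>)" if "bdd_measurable N B h" for h B
    using bdd_measurable_subalgebra[OF sub bdd_measurable_kernel_integral[OF Kk that]] .
  {
    case (set A)
    note [measurable] = set
    let ?I = "indicat_real (Y -` A \<inter> space M)"
    have YA[measurable]: "Y -` A \<inter> space M \<in> sets M" by measurable
    have "bdd_measurable M 1 ?I" by (auto simp: bdd_measurable_def)
    then have int: "integrable M (\<lambda>\<omega>. W \<omega> * ?I \<omega>)"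
      using M.integrable_bdd_measurable[OF bdd_measurable_mult[OF WM]] by blast
    have "(\<integral>\<omega>. indicat_real A (Y \<omega>) * W \<omega> \<partial>M) = (\<integral>\<omega>. W \<omega> * ?I \<omega> \<partial>M)"
      by (intro Bochner_Integration.integral_cong) (auto split: split_indicator)
    also have "\<dots> = (\<integral>\<omega>. W \<omega> * real_cond_exp M F ?I \<omega> \<partial>M)"
      using int by (intro fs.real_cond_exp_intg(2)[symmetric]) auto
    also have "\<dots> = (\<integral>\<omega>. (\<integral>x. indicat_real A x \<partial>K \<omega>) * W \<omega> \<partial>M)"
    proof (rule integral_cong_AE)
      have "bdd_measurable M 1 (\<lambda>\<omega>. \<integral>x. indicat_real A x \<partial>K \<omega>)"
        using set by (intro kb) (auto simp: bdd_measurable_def)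
      then show "(\<lambda>\<omega>. (\<integral>x. indicat_real A x \<partial>K \<omega>) * W \<omega>) \<in> borel_measurable M"
        using Wm by (intro borel_measurable_times) (auto simp: bdd_measurable_def)
      have "AE \<omega> in M. real_cond_exp M F ?I \<omega> = measure (K \<omega>) A"
        using K set by (auto simp: regular_cond_distr_def)
      then show "AE \<omega> in M. W \<omega> * real_cond_exp M F ?I \<omega> = (\<integral>x. indicat_real A x \<partial>K \<omega>) * W \<omega>"
        using AE_space
      proof eventually_elim
        case (elim \<omega>)
        show ?case
          unfolding integral_indicator_prob_on[OF p[OF elim(2)] set] elim(1) by (rule mult.commute)
      qed
    qed simp
    finally show ?case .
  next
    case (lin f g B' C' c d)
    have i: "integrable M (\<lambda>\<omega>. f (Y \<omega>) * W \<omega>)" "integrable M (\<lambda>\<omega>. g (Y \<omega>) * W \<omega>)"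
      using M.integrable_bdd_measurable[OF bdd_measurable_mult[OF bdd_measurable_comp[OF _ Y] WM]] lin.hyps(1,2)
      by blast+
    have j: "integrable M (\<lambda>\<omega>. (\<integral>x. f x \<partial>K \<omega>) * W \<omega>)" "integrable M (\<lambda>\<omega>. (\<integral>x. g x \<partial>K \<omega>) * W \<omega>)"
      using M.integrable_bdd_measurable[OF bdd_measurable_mult[OF kb WM]] lin.hyps(1,2)
      by blast+
    have "(\<integral>\<omega>. (c * f (Y \<omega>) + d * g (Y \<omega>)) * W \<omega> \<partial>M) =
        (\<integral>\<omega>. c * (f (Y \<omega>) * W \<omega>) + d * (g (Y \<omega>) * W \<omega>) \<partial>M)"
      by (simp add: algebra_simps)
    also have "\<dots> = (\<integral>\<omega>. c * ((\<integral>x. f x \<partial>K \<omega>) * W \<omega>) + d * ((\<integral>x. g x \<partial>K \<omega>) * W \<omega>) \<partial>M)"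
      using i j lin.IH(1,2) by simp
    also have "\<dots> = (\<integral>\<omega>. (\<integral>x. c * f x + d * g x \<partial>K \<omega>) * W \<omega> \<partial>M)"
    proof (rule Bochner_Integration.integral_cong[OF refl])
      fix \<omega> assume \<omega>: "\<omega> \<in> space M"
      show "c * ((\<integral>x. f x \<partial>K \<omega>) * W \<omega>) + d * ((\<integral>x. g x \<partial>K \<omega>) * W \<omega>) =
         (\<integral>x. c * f x + d * g x \<partial>K \<omega>) * W \<omega>"
        by (simp only: integral_prob_on_lin[OF p[OF \<omega>] lin.hyps]) (simp add: algebra_simps)
    qed
    finally show ?case .
  next
    case (lim s g B')
    have "(\<lambda>i. \<integral>\<omega>. s i (Y \<omega>) * W \<omega> \<partial>M) \<longlonglongrightarrow> (\<integral>\<omega>. g (Y \<omega>) * W \<omega> \<partial>M)"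
    proof (rule M.integral_bdd_measurable_LIMSEQ)
      show "bdd_measurable M (B' * C) (\<lambda>\<omega>. s i (Y \<omega>) * W \<omega>)" for i
        using bdd_measurable_mult[OF bdd_measurable_comp[OF lim.hyps(1) Y] WM] .
      show "(\<lambda>i. s i (Y \<omega>) * W \<omega>) \<longlonglongrightarrow> g (Y \<omega>) * W \<omega>" if "\<omega> \<in> space M" for \<omega>
        using that measurable_space[OF Y] by (intro tendsto_intros lim) auto
    qed
    moreover have "(\<lambda>i. \<integral>\<omega>. (\<integral>x. s i x \<partial>K \<omega>) * W \<omega> \<partial>M) \<longlonglongrightarrow> (\<integral>\<omega>. (\<integral>x. g x \<partial>K \<omega>) * W \<omega> \<partial>M)"
    proof (rule M.integral_bdd_measurable_LIMSEQ)
      show "bdd_measurable M (B' * C) (\<lambda>\<omega>. (\<integral>x. s i x \<partial>K \<omega>) * W \<omega>)" for i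
        using bdd_measurable_mult[OF kb[OF lim.hyps(1)] WM] .
      fix \<omega> assume \<omega>: "\<omega> \<in> space M"
      show "(\<lambda>i. (\<integral>x. s i x \<partial>K \<omega>) * W \<omega>) \<longlonglongrightarrow> (\<integral>x. g x \<partial>K \<omega>) * W \<omega>"
        by (intro tendsto_intros integral_prob_on_LIMSEQ[OF p[OF \<omega>] lim.hyps])
    qed
    ultimately show ?case unfolding lim.IH(1) by (rule LIMSEQ_unique)
  }
qed

section \<open>Mean square fluctuation of the urn\<close>

lemma
  assumes "\<And>n. Z n \<in> M \<rightarrow>\<^sub>M N"
  shows subalgebra_past: "subalgebra M (past M N Z n)"
    and subalgebra_past_mono: "m \<le> n \<Longrightarrow> subalgebra (past M N Z n) (past M N Z m)"
proof -
  let ?G = "\<lambda>n. \<Union>i<n. {Z i -` A \<inter> space M |A. A \<in> sets N}"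
  have G: "?G n \<subseteq> sets M" for n
    using assms by (auto intro: measurable_sets)
  then have GP: "?G n \<subseteq> Pow (space M)" for n
    using sets.space_closed[of M] by blast
  have sets: "sets (past M N Z n) = sigma_sets (space M) (?G n)" for n
    unfolding past_def by (rule sets_measure_of[OF GP])
  have space: "space (past M N Z n) = space M" for n
    unfolding past_def by (rule space_measure_of[OF GP])
  show "subalgebra M (past M N Z n)"
    unfolding subalgebra_def space sets using sets.sigma_sets_subset[OF G] by blast
  show "subalgebra (past M N Z n) (past M N Z m)" if "m \<le> n"
    unfolding subalgebra_def space sets using that
    by (intro conjI refl sigma_sets_mono') fastforce
qed

definition kernel_op :: "('a \<Rightarrow> 'a measure) \<Rightarrow> ('a \<Rightarrow> real) \<Rightarrow> 'a \<Rightarrow> real" where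
  "kernel_op R f s = (\<integral>x. f x \<partial>R s)"

text \<open>One urn step moves a uniformly chosen ball along \<open>R\<close> with probability \<open>1 / (n + 2)\<close>.\<close>

definition urn_op :: "('a \<Rightarrow> 'a measure) \<Rightarrow> nat \<Rightarrow> ('a \<Rightarrow> real) \<Rightarrow> 'a \<Rightarrow> real" where
  "urn_op R n f s = real (n + 1) / real (n + 2) * f s + 1 / real (n + 2) * kernel_op R f s"

text \<open>The latest step acts on \<open>f\<close> first, as in a backward equation, so that an
  induction on \<open>j\<close> peels off the last urn step by replacing \<open>f\<close> with
  \<open>urn_op R (K + j) f\<close>.\<close>

primrec urn_iter :: "('a \<Rightarrow> 'a measure) \<Rightarrow> nat \<Rightarrow> nat \<Rightarrow> ('a \<Rightarrow> real) \<Rightarrow> 'a \<Rightarrow> real" where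
  "urn_iter R K 0 f = f"
| "urn_iter R K (Suc j) f = urn_iter R K j (urn_op R (K + j) f)"

definition urn_law :: "(nat \<Rightarrow> 'w \<Rightarrow> 'a measure) \<Rightarrow> nat \<Rightarrow> 'w \<Rightarrow> 'a measure" where
  "urn_law U n \<omega> = scale_measure (ennreal (1 / real (n + 1))) (U n \<omega>)"

lemma bdd_measurable_kernel_op:
  "markov_kernel N N R \<Longrightarrow> bdd_measurable N B f \<Longrightarrow> bdd_measurable N B (kernel_op R f)"
  unfolding kernel_op_def[abs_def] by (rule bdd_measurable_kernel_integral)

lemma bdd_measurable_urn_op:
  assumes "markov_kernel N N R" "bdd_measurable N B f"
  shows "bdd_measurable N B (urn_op R n f)"
proof -
  have eq: "\<bar>real (n + 1) / real (n + 2)\<bar> * B + \<bar>1 / real (n + 2)\<bar> * B = B"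
  proof -
    have "real (n + 1) / real (n + 2) + 1 / real (n + 2) = 1"
      unfolding add_divide_distrib[symmetric] by simp
    then have "(real (n + 1) / real (n + 2) + 1 / real (n + 2)) * B = B" by simp
    then show ?thesis by (simp add: distrib_right)
  qed
  show ?thesis
    using bdd_measurable_lin[OF assms(2) bdd_measurable_kernel_op[OF assms],
        of "real (n + 1) / real (n + 2)" "1 / real (n + 2)"]
    unfolding eq urn_op_def[abs_def] .
qed

lemma bdd_measurable_urn_iter:
  "markov_kernel N N R \<Longrightarrow> bdd_measurable N B f \<Longrightarrow> bdd_measurable N B (urn_iter R K j f)"
  by (induction j arbitrary: f) (auto intro: bdd_measurable_urn_op)

context
  fixes M :: "'w measure" and N :: "'a measure" and R U\<^sub>0 U Z
  assumes urn: "urn_model M N R U\<^sub>0 U Z" and R: "markov_kernel N N R"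
begin

lemma prob_space_urn: "prob_space M"
  and measurable_urn_draw: "Z n \<in> M \<rightarrow>\<^sub>M N"
  and urn_law_cond_distr: "regular_cond_distr M (past M N Z n) N (Z n) (urn_law U n)"
  using urn by (auto simp: urn_model_def urn_law_def[abs_def])

interpretation M: prob_space M by (rule prob_space_urn)

lemma markov_kernel_urn_law: "markov_kernel (past M N Z n) N (urn_law U n)"
  using urn_law_cond_distr by (simp add: regular_cond_distr_def)

lemma subalgebra_urn: "subalgebra M (past M N Z n)"
  by (rule subalgebra_past) (rule measurable_urn_draw)

lemma space_urn_past: "space (past M N Z n) = space M"
  using subalgebra_urn by (simp add: subalgebra_def)

lemma prob_on_urn_law: "\<omega> \<in> space M \<Longrightarrow> prob_on N (urn_law U n \<omega>)"
  using markov_kernel_urn_law[of n] by (simp add: markov_kernel_def space_urn_past)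

lemma prob_on_urn_kernel: "\<omega> \<in> space M \<Longrightarrow> prob_on N (R (Z n \<omega>))"
  using R measurable_space[OF measurable_urn_draw] by (auto simp: markov_kernel_def)

lemma bdd_measurable_urn_law:
  "bdd_measurable N B f \<Longrightarrow> bdd_measurable (past M N Z n) B (\<lambda>\<omega>. \<integral>x. f x \<partial>urn_law U n \<omega>)"
  by (rule bdd_measurable_kernel_integral[OF markov_kernel_urn_law])

lemma integral_urn_law_Suc:
  assumes f: "bdd_measurable N B f" and \<omega>: "\<omega> \<in> space M"
  shows "(\<integral>x. f x \<partial>urn_law U (Suc n) \<omega>) =
    real (n + 1) / real (n + 2) * (\<integral>x. f x \<partial>urn_law U n \<omega>) + 1 / real (n + 2) * kernel_op R f (Z n \<omega>)"
  unfolding kernel_op_def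
proof (rule integral_mixture[OF _ _ _ _ f])
  show "prob_on N (urn_law U (Suc n) \<omega>)" "prob_on N (urn_law U n \<omega>)" "prob_on N (R (Z n \<omega>))"
    using \<omega> by (auto intro: prob_on_urn_law prob_on_urn_kernel)
  fix A assume A: "A \<in> sets N"
  have m: "measure (urn_law U k \<omega>) B = 1 / real (k + 1) * measure (U k \<omega>) B" for k B
    unfolding urn_law_def measure_def by (simp add: enn2real_mult)
  \<comment> \<open>Passing from \<open>emeasure\<close> to \<open>measure\<close> in the recursion
    requires finite values; these come from the normalised measure being a probability
    measure.\<close>
  have fin: "emeasure (U k \<omega>) A \<noteq> \<infinity>" for k
  proof
    assume inf: "emeasure (U k \<omega>) A = \<infinity>"
    interpret prob_space "urn_law U k \<omega>"
      using prob_on_urn_law[OF \<omega>] by (simp add: prob_on_def)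
    have "emeasure (urn_law U k \<omega>) A = \<infinity>"
      using inf by (simp add: urn_law_def ennreal_mult_top)
    then show False by (simp add: emeasure_eq_measure)
  qed
  interpret K: prob_space "R (Z n \<omega>)"
    using prob_on_urn_kernel[OF \<omega>] by (simp add: prob_on_def)
  have "emeasure (U (Suc n) \<omega>) A = emeasure (U n \<omega>) A + emeasure (R (Z n \<omega>)) A"
    using urn \<omega> A by (simp add: urn_model_def)
  then have "measure (U (Suc n) \<omega>) A = measure (U n \<omega>) A + measure (R (Z n \<omega>)) A"
    using fin[of n] unfolding measure_def
    by (simp add: enn2real_plus less_top[symmetric])
  moreover have c: "real (n + 1) / real (n + 2) * (1 / real (n + 1) * x) = 1 / real (n + 2) * x" for x
    by simp
  ultimately show "measure (urn_law U (Suc n) \<omega>) A =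
      real (n + 1) / real (n + 2) * measure (urn_law U n \<omega>) A + 1 / real (n + 2) * measure (R (Z n \<omega>)) A"
    unfolding m c by (simp add: distrib_left)
qed

text \<open>In one step the error becomes \<open>X + Y / (n + 2)\<close>: \<open>X\<close> is the
  error for the test function \<open>f'\<close> and is known from the past, \<open>Y\<close> is the
  deviation of \<open>g (Z n)\<close> from its conditional mean. The cross term integrates to 0, and
  \<open>\<bar>Y\<bar> \<le> 2 * B\<close> makes the new term at most
  \<open>4 * B\<^sup>2 / (n + 2)\<^sup>2\<close>. The right-hand side is a telescoping majorant of
  the sum of these terms.\<close>

lemma urn_law_fluctuation:
  assumes "bdd_measurable N B f"
  shows "(\<integral>\<omega>. ((\<integral>x. f x \<partial>urn_law U (K + j) \<omega>) - (\<integral>x. urn_iter R K j f x \<partial>urn_law U K \<omega>))\<^sup>2 \<partial>M)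
    \<le> 4 * B\<^sup>2 * (1 / real (K + 1) - 1 / real (K + j + 1))"
  using assms
proof (induction j arbitrary: f)
  case 0
  then show ?case by simp
next
  case (Suc j)
  define n where "n = K + j"
  define f' where "f' = urn_op R n f"
  have f': "bdd_measurable N B f'"
    unfolding f'_def by (rule bdd_measurable_urn_op[OF R Suc.prems])
  define g where "g = kernel_op R f"
  have g: "bdd_measurable N B g"
    unfolding g_def by (rule bdd_measurable_kernel_op[OF R Suc.prems])
  define X where "X \<omega> = (\<integral>x. f' x \<partial>urn_law U n \<omega>) - (\<integral>x. urn_iter R K j f' x \<partial>urn_law U K \<omega>)" for \<omega>
  define Y where "Y \<omega> = g (Z n \<omega>) - (\<integral>x. g x \<partial>urn_law U n \<omega>)" for \<omega>
  have XF: "bdd_measurable (past M N Z n) (B + B) X"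
    unfolding X_def
  proof (rule bdd_measurable_diff[OF bdd_measurable_urn_law[OF f']])
    have "subalgebra (past M N Z n) (past M N Z K)"
      unfolding n_def by (rule subalgebra_past_mono[OF measurable_urn_draw]) simp
    then show "bdd_measurable (past M N Z n) B (\<lambda>\<omega>. \<integral>x. urn_iter R K j f' x \<partial>urn_law U K \<omega>)"
      by (rule bdd_measurable_subalgebra)
        (rule bdd_measurable_urn_law[OF bdd_measurable_urn_iter[OF R f']])
  qed
  have XM: "bdd_measurable M (B + B) X"
    by (rule bdd_measurable_subalgebra[OF subalgebra_urn XF])
  have gZ: "bdd_measurable M B (\<lambda>\<omega>. g (Z n \<omega>))"
    by (rule bdd_measurable_comp[OF g measurable_urn_draw])
  have gU: "bdd_measurable M B (\<lambda>\<omega>. \<integral>x. g x \<partial>urn_law U n \<omega>)"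
    by (rule bdd_measurable_subalgebra[OF subalgebra_urn bdd_measurable_urn_law[OF g]])
  have YM: "bdd_measurable M (B + B) Y"
    unfolding Y_def by (rule bdd_measurable_diff[OF gZ gU])
  note int = M.integrable_bdd_measurable
  have XY: "(\<integral>\<omega>. X \<omega> * Y \<omega> \<partial>M) = 0"
  proof -
    have "(\<integral>\<omega>. X \<omega> * Y \<omega> \<partial>M) = (\<integral>\<omega>. g (Z n \<omega>) * X \<omega> - (\<integral>x. g x \<partial>urn_law U n \<omega>) * X \<omega> \<partial>M)"
      by (simp add: Y_def algebra_simps)
    also have "\<dots> = (\<integral>\<omega>. g (Z n \<omega>) * X \<omega> \<partial>M) - (\<integral>\<omega>. (\<integral>x. g x \<partial>urn_law U n \<omega>) * X \<omega> \<partial>M)"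
      by (intro Bochner_Integration.integral_diff int[OF bdd_measurable_mult[OF gZ XM]]
          int[OF bdd_measurable_mult[OF gU XM]])
    also have "\<dots> = 0"
      using integral_regular_cond_distr[OF prob_space_urn subalgebra_urn measurable_urn_draw
          urn_law_cond_distr g XF] by simp
    finally show ?thesis .
  qed
  have iXX: "integrable M (\<lambda>\<omega>. X \<omega> * X \<omega>)" and iXY: "integrable M (\<lambda>\<omega>. X \<omega> * Y \<omega>)"
    and iYY: "integrable M (\<lambda>\<omega>. Y \<omega> * Y \<omega>)"
    by (rule int[OF bdd_measurable_mult[OF XM XM]] int[OF bdd_measurable_mult[OF XM YM]]
        int[OF bdd_measurable_mult[OF YM YM]])+
  have YY: "(\<integral>\<omega>. Y \<omega> * Y \<omega> \<partial>M) \<le> 4 * B\<^sup>2"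
    using M.abs_integral_le_bdd_measurable[OF bdd_measurable_mult[OF YM YM]]
    by (simp add: power2_eq_square algebra_simps)
  have "(\<integral>x. f x \<partial>urn_law U (K + Suc j) \<omega>) - (\<integral>x. urn_iter R K (Suc j) f x \<partial>urn_law U K \<omega>)
      = X \<omega> + 1 / real (n + 2) * Y \<omega>" if "\<omega> \<in> space M" for \<omega>
  proof -
    have *: "(\<integral>x. f' x \<partial>urn_law U n \<omega>) =
        real (n + 1) / real (n + 2) * (\<integral>x. f x \<partial>urn_law U n \<omega>) + 1 / real (n + 2) * (\<integral>x. g x \<partial>urn_law U n \<omega>)"
      unfolding f'_def urn_op_def g_def[symmetric]
      by (rule integral_prob_on_lin[OF prob_on_urn_law[OF that] Suc.prems g])
    show ?thesis
      using integral_urn_law_Suc[OF Suc.prems that, of n]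
      by (simp add: X_def Y_def * g_def[symmetric] algebra_simps flip: n_def f'_def)
  qed
  then have "(\<integral>\<omega>. ((\<integral>x. f x \<partial>urn_law U (K + Suc j) \<omega>) - (\<integral>x. urn_iter R K (Suc j) f x \<partial>urn_law U K \<omega>))\<^sup>2 \<partial>M)
     = (\<integral>\<omega>. (X \<omega> + 1 / real (n + 2) * Y \<omega>)\<^sup>2 \<partial>M)"
    by (intro Bochner_Integration.integral_cong refl) simp
  also have "\<dots> = (\<integral>\<omega>. X \<omega> * X \<omega> + 2 / real (n + 2) * (X \<omega> * Y \<omega>) + 1 / (real (n + 2))\<^sup>2 * (Y \<omega> * Y \<omega>) \<partial>M)"
  proof (intro Bochner_Integration.integral_cong refl)
    have "(x + c * y)\<^sup>2 = x * x + 2 * c * (x * y) + c\<^sup>2 * (y * y)" for x y c :: real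
      by (simp add: power2_eq_square algebra_simps)
    from this[of _ "1 / real (n + 2)"]
    show "(X \<omega> + 1 / real (n + 2) * Y \<omega>)\<^sup>2 =
        X \<omega> * X \<omega> + 2 / real (n + 2) * (X \<omega> * Y \<omega>) + 1 / (real (n + 2))\<^sup>2 * (Y \<omega> * Y \<omega>)" for \<omega>
      by (simp add: power_divide)
  qed
  also have "\<dots> = (\<integral>\<omega>. X \<omega> * X \<omega> \<partial>M) + 2 / real (n + 2) * (\<integral>\<omega>. X \<omega> * Y \<omega> \<partial>M)
      + 1 / (real (n + 2))\<^sup>2 * (\<integral>\<omega>. Y \<omega> * Y \<omega> \<partial>M)"
    using iXX iXY iYY by simp
  also have "\<dots> \<le> 4 * B\<^sup>2 * (1 / real (K + 1) - 1 / real (n + 1)) + 1 / (real (n + 2))\<^sup>2 * (4 * B\<^sup>2)"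
    unfolding XY using Suc.IH[OF f'] YY
    by (intro add_mono mult_left_mono) (simp_all add: X_def n_def power2_eq_square)
  also have "\<dots> = 4 * B\<^sup>2 * (1 / real (K + 1) - 1 / real (n + 1) + 1 / (real (n + 2))\<^sup>2)"
    by (simp add: algebra_simps)
  also have "\<dots> \<le> 4 * B\<^sup>2 * (1 / real (K + 1) - 1 / real (K + Suc j + 1))"
  proof (intro mult_left_mono)
    have "1 / (real (n + 2))\<^sup>2 \<le> 1 / (real (n + 1) * real (n + 2))"
      by (intro divide_left_mono) (auto simp: power2_eq_square intro!: mult_right_mono)
    also have "\<dots> = 1 / real (n + 1) - 1 / real (n + 2)"
      by (simp add: field_simps)
    finally show "1 / real (K + 1) - 1 / real (n + 1) + 1 / (real (n + 2))\<^sup>2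
        \<le> 1 / real (K + 1) - 1 / real (K + Suc j + 1)"
      by (simp add: n_def)
  qed simp
  finally show ?case .
qed

end

section \<open>Uniqueness of conditional distributions and weak convergence in probability\<close>

text \<open>The exceptional null set may depend on \<open>f\<close>, which suffices for the
  convergence in probability of one integral at a time.\<close>

lemma regular_cond_distr_integral_unique:
  assumes sub: "subalgebra M F"
    and K: "regular_cond_distr M F N Y K" and K': "regular_cond_distr M F N Y K'"
    and f: "bdd_measurable N B f"
  shows "AE \<omega> in M. (\<integral>x. f x \<partial>K \<omega>) = (\<integral>x. f x \<partial>K' \<omega>)"
  using f
proof (induction f rule: bdd_measurable_induct)
  have sp: "space F = space M" using sub by (simp add: subalgebra_def)
  have p: "prob_on N (K \<omega>)" "prob_on N (K' \<omega>)" if "\<omega> \<in> space M" for \<omega>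
    using K K' that sp by (auto simp: regular_cond_distr_def markov_kernel_def)
  {
    case (set A)
    have "AE \<omega> in M. real_cond_exp M F (indicat_real (Y -` A \<inter> space M)) \<omega> = measure (K \<omega>) A"
      "AE \<omega> in M. real_cond_exp M F (indicat_real (Y -` A \<inter> space M)) \<omega> = measure (K' \<omega>) A"
      using K K' set by (auto simp: regular_cond_distr_def)
    then show ?case
      using AE_space
    proof eventually_elim
      case (elim \<omega>)
      show ?case
        unfolding integral_indicator_prob_on[OF p(1)[OF elim(3)] set]
          integral_indicator_prob_on[OF p(2)[OF elim(3)] set]
        using elim(1,2) by simp
    qed
  next
    case (lin f g B C c d)
    from lin.IH AE_space show ?case
    proof eventually_elim
      case (elim \<omega>)
      show ?case
        unfolding integral_prob_on_lin[OF p(1)[OF elim(3)] lin.hyps]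
          integral_prob_on_lin[OF p(2)[OF elim(3)] lin.hyps] elim(1,2) by (rule refl)
    qed
  next
    case (lim s g B)
    have "AE \<omega> in M. \<forall>i. (\<integral>x. s i x \<partial>K \<omega>) = (\<integral>x. s i x \<partial>K' \<omega>)"
      using lim.IH by (simp add: AE_all_countable)
    then show ?case
      using AE_space
    proof eventually_elim
      case (elim \<omega>)
      have "(\<lambda>i. \<integral>x. s i x \<partial>K \<omega>) \<longlonglongrightarrow> (\<integral>x. g x \<partial>K \<omega>)"
        by (rule integral_prob_on_LIMSEQ[OF p(1)[OF elim(2)] lim.hyps])
      moreover have "(\<lambda>i. \<integral>x. s i x \<partial>K' \<omega>) \<longlonglongrightarrow> (\<integral>x. g x \<partial>K' \<omega>)"
        by (rule integral_prob_on_LIMSEQ[OF p(2)[OF elim(2)] lim.hyps])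
      ultimately show ?case
        using elim(1) LIMSEQ_unique by simp
    qed
  }
qed

text \<open>Equality of the measures themselves asks for a single null set. Countably many almost
  sure identities share one, and on a generator closed under intersections they determine a
  probability measure.\<close>

lemma regular_cond_distr_unique:
  fixes Y :: "'w \<Rightarrow> 'a::second_countable_topology"
  assumes sub: "subalgebra M F"
    and K: "regular_cond_distr M F borel Y K" and K': "regular_cond_distr M F borel Y K'"
  shows "AE \<omega> in M. K \<omega> = K' \<omega>"
proof -
  obtain B :: "'a set set" where B: "countable B" "topological_basis B"
    using ex_countable_basis by blast
  \<comment> \<open>Finite intersections of a countable base. The empty intersection is
    \<open>UNIV\<close>, which later serves as the exhausting sequence.\<close>
  define E where "E = (\<lambda>F. \<Inter>F) ` {F. F \<subseteq> B \<and> finite F}"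
  have cE: "countable E"
    unfolding E_def using countable_Collect_finite_subset[OF B(1)] by (simp add: conj_commute)
  have stable: "Int_stable E"
  proof (rule Int_stableI)
    fix a b assume "a \<in> E" "b \<in> E"
    then obtain F G where "F \<subseteq> B" "finite F" "a = \<Inter>F" "G \<subseteq> B" "finite G" "b = \<Inter>G"
      by (auto simp: E_def)
    then show "a \<inter> b \<in> E"
      unfolding E_def by (intro image_eqI[of _ _ "F \<union> G"]) auto
  qed
  have open_E: "open X" if "X \<in> E" for X
    using that topological_basis_open[OF B(2)] by (auto simp: E_def)
  have gen: "sets borel = sigma_sets UNIV E"
  proof
    have "sets (borel :: 'a measure) = sigma_sets UNIV B"
      unfolding borel_eq_countable_basis[OF B] by (rule sets_measure_of) simp
    also have "\<dots> \<subseteq> sigma_sets UNIV E"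
    proof (rule sigma_sets_mono')
      show "B \<subseteq> E"
      proof
        fix X assume "X \<in> B" then show "X \<in> E"
          unfolding E_def by (intro image_eqI[of _ _ "{X}"]) auto
      qed
    qed
    finally show "sets borel \<subseteq> sigma_sets UNIV E" .
    have "sigma_sets (space borel) E \<subseteq> sets borel"
      using open_E by (intro sets.sigma_sets_subset) auto
    then show "sigma_sets UNIV E \<subseteq> sets borel" by simp
  qed
  have UE: "UNIV \<in> E"
    unfolding E_def by (intro image_eqI[of _ _ "{}"]) auto
  have sp: "space F = space M" using sub by (simp add: subalgebra_def)
  have p: "prob_on borel (K \<omega>)" "prob_on borel (K' \<omega>)" if "\<omega> \<in> space M" for \<omega>
    using K K' that sp by (auto simp: regular_cond_distr_def markov_kernel_def)
  have "AE \<omega> in M. measure (K \<omega>) X = measure (K' \<omega>) X" if "X \<in> E" for X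
  proof -
    have X: "X \<in> sets borel" using open_E[OF that] by simp
    have "AE \<omega> in M. real_cond_exp M F (indicat_real (Y -` X \<inter> space M)) \<omega> = measure (K \<omega>) X"
      "AE \<omega> in M. real_cond_exp M F (indicat_real (Y -` X \<inter> space M)) \<omega> = measure (K' \<omega>) X"
      using K K' X by (auto simp: regular_cond_distr_def)
    then show ?thesis by eventually_elim simp
  qed
  then have "AE \<omega> in M. \<forall>X\<in>E. measure (K \<omega>) X = measure (K' \<omega>) X"
    using cE by (simp add: AE_ball_countable)
  then show ?thesis
    using AE_space
  proof eventually_elim
    case (elim \<omega>)
    interpret K: prob_space "K \<omega>" using p(1)[OF elim(2)] by (simp add: prob_on_def)
    interpret K': prob_space "K' \<omega>" using p(2)[OF elim(2)] by (simp add: prob_on_def)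
    show ?case
    proof (rule measure_eqI_generator_eq[OF stable, of UNIV _ _ "\<lambda>_. UNIV"])
      show "emeasure (K \<omega>) X = emeasure (K' \<omega>) X" if "X \<in> E" for X
        using elim(1) that by (simp add: K.emeasure_eq_measure K'.emeasure_eq_measure)
    qed (use p[OF elim(2)] UE in \<open>auto simp: gen[symmetric] prob_on_def\<close>)
  qed
qed

lemma prob_on_distr:
  "prob_on N \<mu> \<Longrightarrow> g \<in> N \<rightarrow>\<^sub>M N' \<Longrightarrow> prob_on N' (distr \<mu> N' g)"
  by (auto simp: prob_on_def intro!: prob_space.prob_space_distr cong: measurable_cong_sets)

lemma regular_cond_distr_distr:
  assumes sub: "subalgebra M F" and Y: "Y \<in> M \<rightarrow>\<^sub>M N"
    and K: "regular_cond_distr M F N Y K" and g: "g \<in> N \<rightarrow>\<^sub>M N'"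
  shows "regular_cond_distr M F N' (\<lambda>\<omega>. g (Y \<omega>)) (\<lambda>\<omega>. distr (K \<omega>) N' g)"
proof -
  have sp: "space F = space M" using sub by (simp add: subalgebra_def)
  have p: "prob_on N (K \<omega>)" if "\<omega> \<in> space M" for \<omega>
    using K that sp by (auto simp: regular_cond_distr_def markov_kernel_def)
  have gA: "g -` A \<inter> space N \<in> sets N" if "A \<in> sets N'" for A
    using measurable_sets[OF g that] .
  have m: "measure (distr (K \<omega>) N' g) A = measure (K \<omega>) (g -` A \<inter> space N)"
    if "\<omega> \<in> space M" "A \<in> sets N'" for \<omega> A
  proof -
    have "g \<in> K \<omega> \<rightarrow>\<^sub>M N'" using p[OF that(1)] g by (simp add: prob_on_def cong: measurable_cong_sets)
    from measure_distr[OF this that(2)] show ?thesis by (simp add: prob_on_space[OF p[OF that(1)]])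
  qed
  show ?thesis
    unfolding regular_cond_distr_def markov_kernel_def
  proof safe
    show "prob_on N' (distr (K \<omega>) N' g)" if "\<omega> \<in> space F" for \<omega>
      using p that g sp by (intro prob_on_distr) auto
    fix A assume A: "A \<in> sets N'"
    have "(\<lambda>\<omega>. measure (K \<omega>) (g -` A \<inter> space N)) \<in> borel_measurable F"
      using K gA[OF A] by (auto simp: regular_cond_distr_def markov_kernel_def)
    also have "?this \<longleftrightarrow> (\<lambda>\<omega>. measure (distr (K \<omega>) N' g) A) \<in> borel_measurable F"
      using sp A by (intro measurable_cong) (simp add: m)
    finally show "(\<lambda>\<omega>. measure (distr (K \<omega>) N' g) A) \<in> borel_measurable F" .
    have eq: "Y -` (g -` A \<inter> space N) \<inter> space M = (\<lambda>\<omega>. g (Y \<omega>)) -` A \<inter> space M"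
      using measurable_space[OF Y] by auto
    have "AE \<omega> in M. real_cond_exp M F (indicat_real (Y -` (g -` A \<inter> space N) \<inter> space M)) \<omega> =
        measure (K \<omega>) (g -` A \<inter> space N)"
      using K gA[OF A] by (auto simp: regular_cond_distr_def)
    then show "AE \<omega> in M. real_cond_exp M F (indicat_real ((\<lambda>\<omega>. g (Y \<omega>)) -` A \<inter> space M)) \<omega> =
        measure (distr (K \<omega>) N' g) A"
      unfolding eq using AE_space
    proof eventually_elim
      case (elim \<omega>)
      with A show ?case by (simp add: m)
    qed
  qed
qed

text \<open>It is enough to test subbasic open sets, since the property passes to finite
  intersections and arbitrary unions. Index 0 is exempt because the rescaled conditional laws, which
  involve \<open>ln (real n)\<close>, are prescribed from \<open>n = 1\<close> on.\<close>

lemma conv_in_prob_weak_topology: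
  fixes Y :: "nat \<Rightarrow> 'w \<Rightarrow> 'a::topological_space measure"
  assumes M: "prob_space M" and c: "prob_on (borel_on S) c"
    and Y: "\<And>n \<omega>. n \<ge> 1 \<Longrightarrow> \<omega> \<in> space M \<Longrightarrow> prob_on (borel_on S) (Y n \<omega>)"
    and meas: "\<And>n (f :: 'a \<Rightarrow> real). n \<ge> 1 \<Longrightarrow> continuous_on S f \<Longrightarrow> bounded (f ` S) \<Longrightarrow>
        (\<lambda>\<omega>. \<integral>x. f x \<partial>Y n \<omega>) \<in> borel_measurable M"
    and lim: "\<And>(f :: 'a \<Rightarrow> real) e. continuous_on S f \<Longrightarrow> bounded (f ` S) \<Longrightarrow> e > 0 \<Longrightarrow>
        (\<lambda>n. measure M {\<omega>\<in>space M. \<bar>(\<integral>x. f x \<partial>Y n \<omega>) - (\<integral>x. f x \<partial>c)\<bar> \<ge> e}) \<longlonglongrightarrow> 0"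
  shows "conv_in_prob M (weak_topology S) Y c"
proof -
  interpret prob_space M by fact
  let ?B = "{{\<mu>. prob_on (borel_on S) \<mu> \<and> (\<integral>x. f x \<partial>\<mu>) \<in> V} |(f :: 'a \<Rightarrow> real) V.
        continuous_on S f \<and> bounded (f ` S) \<and> open V}"
  \<comment> \<open>A trivial constraint, which puts every probability measure on \<open>S\<close>
    into the topological space.\<close>
  have "{\<mu>. prob_on (borel_on S) \<mu> \<and> (\<integral>x. 0 \<partial>\<mu>) \<in> (UNIV :: real set)} \<in> ?B"
    by (intro CollectI exI[of _ "\<lambda>_. 0 :: real"] exI[of _ "UNIV :: real set"])
      (auto intro: boundedI[of _ 0])
  then have top: "c \<in> topspace (weak_topology S)"
    unfolding weak_topology_def topology_generated_by_topspace using c by blast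
  define small where "small G \<longleftrightarrow> (\<exists>E. (\<forall>n\<ge>1. E n \<in> sets M \<and> {\<omega>\<in>space M. Y n \<omega> \<notin> G} \<subseteq> E n) \<and>
      (\<lambda>n. measure M (E n)) \<longlonglongrightarrow> 0)" for G
  have small: "c \<in> G \<longrightarrow> small G" if "generate_topology_on ?B G" for G
    using that
  proof (induction rule: generate_topology_on.induct)
    case Empty
    then show ?case by simp
  next
    case (Int G H)
    show ?case
    proof
      assume "c \<in> G \<inter> H"
      with Int obtain E E' where E: "\<And>n. n \<ge> 1 \<Longrightarrow> E n \<in> sets M \<and> {\<omega>\<in>space M. Y n \<omega> \<notin> G} \<subseteq> E n"
        "(\<lambda>n. measure M (E n)) \<longlonglongrightarrow> 0"
        and E': "\<And>n. n \<ge> 1 \<Longrightarrow> E' n \<in> sets M \<and> {\<omega>\<in>space M. Y n \<omega> \<notin> H} \<subseteq> E' n"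
        "(\<lambda>n. measure M (E' n)) \<longlonglongrightarrow> 0"
        unfolding small_def by blast
      have "(\<lambda>n. measure M (E n \<union> E' n)) \<longlonglongrightarrow> 0"
      proof (rule tendsto_sandwich[OF _ _ tendsto_const])
        show "(\<lambda>n. measure M (E n) + measure M (E' n)) \<longlonglongrightarrow> 0"
          using tendsto_add[OF E(2) E'(2)] by simp
        show "eventually (\<lambda>n. measure M (E n \<union> E' n) \<le> measure M (E n) + measure M (E' n)) sequentially"
          using eventually_ge_at_top[of 1] by eventually_elim (use E(1) E'(1) in \<open>auto intro!: measure_Un_le\<close>)
      qed simp
      then show "small (G \<inter> H)"
        unfolding small_def using E(1) E'(1) by (intro exI[of _ "\<lambda>n. E n \<union> E' n"]) blast
    qed
  next
    case (UN K)
    show ?case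
    proof
      assume "c \<in> \<Union>K"
      then obtain G where "G \<in> K" "c \<in> G" by blast
      with UN have "small G" by blast
      then obtain E where E: "\<And>n. n \<ge> 1 \<Longrightarrow> E n \<in> sets M \<and> {\<omega>\<in>space M. Y n \<omega> \<notin> G} \<subseteq> E n"
        "(\<lambda>n. measure M (E n)) \<longlonglongrightarrow> 0"
        unfolding small_def by blast
      then show "small (\<Union>K)"
        unfolding small_def using \<open>G \<in> K\<close> by (intro exI[of _ E]) blast
    qed
  next
    case (Basis G)
    then obtain f V where G: "G = {\<mu>. prob_on (borel_on S) \<mu> \<and> (\<integral>x. f x \<partial>\<mu>) \<in> V}"
      and f: "continuous_on S f" "bounded (f ` S)" and V: "open (V :: real set)" by blast
    show ?case
    proof
      assume "c \<in> G"
      then have "(\<integral>x. f x \<partial>c) \<in> V" by (simp add: G)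
      then obtain e where e: "e > 0" "ball (\<integral>x. f x \<partial>c) e \<subseteq> V"
        using V open_contains_ball by blast
      let ?E = "\<lambda>n. {\<omega>\<in>space M. \<bar>(\<integral>x. f x \<partial>Y n \<omega>) - (\<integral>x. f x \<partial>c)\<bar> \<ge> e}"
      have "?E n \<in> sets M" if "n \<ge> 1" for n
      proof -
        note [measurable] = meas[OF that f]
        show ?thesis by measurable
      qed
      moreover have "{\<omega>\<in>space M. Y n \<omega> \<notin> G} \<subseteq> ?E n" if "n \<ge> 1" for n
      proof safe
        fix \<omega> assume \<omega>: "\<omega> \<in> space M" "Y n \<omega> \<notin> G"
        then have "(\<integral>x. f x \<partial>Y n \<omega>) \<notin> ball (\<integral>x. f x \<partial>c) e"
          using Y[OF that] e(2) by (auto simp: G)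
        then show "e \<le> \<bar>(\<integral>x. f x \<partial>Y n \<omega>) - (\<integral>x. f x \<partial>c)\<bar>"
          by (simp add: dist_real_def abs_minus_commute)
      qed
      ultimately show "small G"
        unfolding small_def using lim[OF f e(1)] by (intro exI[of _ ?E]) blast
    qed
  qed
  have "(\<lambda>n. measure M {\<omega>\<in>space M. Y n \<omega> \<notin> G}) \<longlonglongrightarrow> 0" if "openin (weak_topology S) G" "c \<in> G" for G
  proof -
    have "small G"
      using small that by (simp add: weak_topology_def openin_topology_generated_by_iff)
    then obtain E where E: "\<And>n. n \<ge> 1 \<Longrightarrow> E n \<in> sets M \<and> {\<omega>\<in>space M. Y n \<omega> \<notin> G} \<subseteq> E n"
      "(\<lambda>n. measure M (E n)) \<longlonglongrightarrow> 0"
      unfolding small_def by blast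
    show ?thesis
    proof (rule tendsto_sandwich[OF _ _ tendsto_const E(2)])
      show "eventually (\<lambda>n. measure M {\<omega>\<in>space M. Y n \<omega> \<notin> G} \<le> measure M (E n)) sequentially"
        using eventually_ge_at_top[of 1] by eventually_elim (use E(1) in \<open>auto intro!: finite_measure_mono\<close>)
    qed simp
  qed
  with top show ?thesis by (auto simp: conv_in_prob_def)
qed

lemma (in prob_space) L2_imp_conv_in_prob:
  fixes W :: "nat \<Rightarrow> 'a \<Rightarrow> real"
  assumes W: "\<And>n. bdd_measurable M B (W n)"
    and lim: "(\<lambda>n. \<integral>\<omega>. (W n \<omega> - c)\<^sup>2 \<partial>M) \<longlonglongrightarrow> 0" and e: "e > 0"
  shows "(\<lambda>n. measure M {\<omega>\<in>space M. \<bar>W n \<omega> - c\<bar> \<ge> e}) \<longlonglongrightarrow> 0"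
proof (rule tendsto_sandwich[OF _ _ tendsto_const])
  show "(\<lambda>n. (\<integral>\<omega>. (W n \<omega> - c)\<^sup>2 \<partial>M) / e\<^sup>2) \<longlonglongrightarrow> 0"
    using tendsto_divide[OF lim tendsto_const[of "e\<^sup>2"]] e by simp
  show "eventually (\<lambda>n. measure M {\<omega>\<in>space M. \<bar>W n \<omega> - c\<bar> \<ge> e} \<le> (\<integral>\<omega>. (W n \<omega> - c)\<^sup>2 \<partial>M) / e\<^sup>2) sequentially"
  proof (intro always_eventually allI)
    fix n
    have d: "bdd_measurable M (B + \<bar>c\<bar>) (\<lambda>\<omega>. W n \<omega> - c)"
      by (rule bdd_measurable_diff[OF W]) (simp add: bdd_measurable_def)
    have i: "integrable M (\<lambda>\<omega>. (W n \<omega> - c)\<^sup>2)"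
      unfolding power2_eq_square by (rule integrable_bdd_measurable[OF bdd_measurable_mult[OF d d]])
    have "{\<omega>\<in>space M. \<bar>W n \<omega> - c\<bar> \<ge> e} = {\<omega>\<in>space M. (W n \<omega> - c)\<^sup>2 \<ge> e\<^sup>2}"
      using e by (auto simp: abs_le_square_iff[symmetric])
    also have "measure M \<dots> \<le> (\<integral>\<omega>. (W n \<omega> - c)\<^sup>2 \<partial>M) / e\<^sup>2"
      using e by (intro integral_Markov_inequality_measure[OF i]) auto
    finally show "measure M {\<omega>\<in>space M. \<bar>W n \<omega> - c\<bar> \<ge> e} \<le> (\<integral>\<omega>. (W n \<omega> - c)\<^sup>2 \<partial>M) / e\<^sup>2" .
  qed
qed simp

section \<open>The depth distribution\<close>

text \<open>The number of \<open>R\<close>-steps in \<open>urn_iter R K j\<close>: a sum of independent Bernoulli variables with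
  parameters \<open>1 / (K + i + 2)\<close>, \<open>i < j\<close>.\<close>

primrec urn_depth :: "nat \<Rightarrow> nat \<Rightarrow> nat pmf" where
  "urn_depth K 0 = return_pmf 0"
| "urn_depth K (Suc j) =
    bind_pmf (bernoulli_pmf (1 / real (K + j + 2))) (\<lambda>y. map_pmf (\<lambda>m. m + of_bool y) (urn_depth K j))"

lemma finite_set_urn_depth: "finite (set_pmf (urn_depth K j))"
  by (induction j) (auto intro: finite_subset)

lemma integrable_urn_depth:
  fixes h :: "nat \<Rightarrow> 'b::{banach, second_countable_topology}"
  shows "integrable (measure_pmf (urn_depth K j)) h"
  by (rule integrable_measure_pmf_finite[OF finite_set_urn_depth])

lemma expectation_urn_depth_Suc:
  fixes h :: "nat \<Rightarrow> 'b::{banach, second_countable_topology}"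
  shows "measure_pmf.expectation (urn_depth K (Suc j)) h =
    (real (K + j + 1) / real (K + j + 2)) *\<^sub>R measure_pmf.expectation (urn_depth K j) h +
    (1 / real (K + j + 2)) *\<^sub>R measure_pmf.expectation (urn_depth K j) (\<lambda>m. h (Suc m))"
proof -
  have "1 - 1 / real (K + j + 2) = real (K + j + 1) / real (K + j + 2)"
    by (simp add: field_simps)
  then show ?thesis
    unfolding urn_depth.simps
    by (subst pmf_expectation_bind[of UNIV]) (auto simp: UNIV_bool finite_set_urn_depth)
qed

lemma kernel_op_pow_lin:
  assumes R: "markov_kernel N N R" and f: "bdd_measurable N B f" and g: "bdd_measurable N C g"
  shows "s \<in> space N \<Longrightarrow> (kernel_op R ^^ m) (\<lambda>x. c * f x + d * g x) s =
    c * (kernel_op R ^^ m) f s + d * (kernel_op R ^^ m) g s"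
proof (induction m arbitrary: s)
  case (Suc m)
  have b: "bdd_measurable N B ((kernel_op R ^^ m) f)" if "bdd_measurable N B f" for B f
    using that by (induction m) (auto intro: bdd_measurable_kernel_op[OF R])
  have p: "prob_on N (R s)" using R Suc.prems by (auto simp: markov_kernel_def)
  have "(kernel_op R ^^ Suc m) (\<lambda>x. c * f x + d * g x) s =
      (\<integral>x. c * (kernel_op R ^^ m) f x + d * (kernel_op R ^^ m) g x \<partial>R s)"
    unfolding funpow.simps o_def kernel_op_def[of R _ s]
    by (intro Bochner_Integration.integral_cong refl Suc.IH) (simp add: prob_on_space[OF p])
  also have "\<dots> = c * (kernel_op R ^^ Suc m) f s + d * (kernel_op R ^^ Suc m) g s"
    unfolding funpow.simps o_def kernel_op_def[of R _ s]
    by (rule integral_prob_on_lin[OF p b[OF f] b[OF g]])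
  finally show ?case .
qed simp

text \<open>Every urn operator mixes the identity with \<open>R\<close>, so the iterate is a
  polynomial in \<open>R\<close>; its coefficients are the probabilities of the possible numbers of
  chosen \<open>R\<close>-steps.\<close>

lemma urn_iter_eq_expectation:
  assumes R: "markov_kernel N N R" and s: "s \<in> space N"
  shows "bdd_measurable N B f \<Longrightarrow> urn_iter R K j f s =
    measure_pmf.expectation (urn_depth K j) (\<lambda>m. (kernel_op R ^^ m) f s)"
proof (induction j arbitrary: f)
  case (Suc j)
  let ?E = "measure_pmf.expectation (urn_depth K j)"
  have "urn_iter R K (Suc j) f s = ?E (\<lambda>m. (kernel_op R ^^ m) (urn_op R (K + j) f) s)"
    using Suc.IH[OF bdd_measurable_urn_op[OF R Suc.prems]] by simp
  also have "\<dots> = ?E (\<lambda>m. real (K + j + 1) / real (K + j + 2) * (kernel_op R ^^ m) f s +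
      1 / real (K + j + 2) * (kernel_op R ^^ Suc m) f s)"
    unfolding urn_op_def[abs_def] funpow_Suc_right o_def
    by (subst kernel_op_pow_lin[OF R Suc.prems bdd_measurable_kernel_op[OF R Suc.prems] s]) (rule refl)
  also have "\<dots> = measure_pmf.expectation (urn_depth K (Suc j)) (\<lambda>m. (kernel_op R ^^ m) f s)"
    unfolding expectation_urn_depth_Suc real_scaleR_def
    by (subst Bochner_Integration.integral_add) (simp_all add: integrable_urn_depth)
  finally show ?case .
qed simp

section \<open>Poisson comparison and central limit theorem for the depth\<close>

lemma norm_exp_minus_linear_le:
  fixes w :: complex
  assumes "norm w \<le> 1"
  shows "norm (1 + w - exp w) \<le> 3 * (norm w)\<^sup>2"
proof -
  have "norm (exp w - (1 + w)) \<le> exp \<bar>Re w\<bar> * (norm w)\<^sup>2"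
    using Taylor_exp[of w 1] by (simp add: power2_eq_square)
  also have "\<dots> \<le> 3 * (norm w)\<^sup>2"
  proof (rule mult_right_mono)
    have "exp \<bar>Re w\<bar> \<le> exp 1" using assms abs_Re_le_cmod[of w] by simp
    with exp_le show "exp \<bar>Re w\<bar> \<le> 3" by linarith
  qed simp
  finally show ?thesis by (simp add: norm_minus_commute)
qed

text \<open>Le Cam's comparison with the Poisson distribution of the same mean; it is only sharp for
  small \<open>z\<close>, which is the range used in the central limit theorem.\<close>

lemma urn_depth_char_poisson:
  fixes \<theta> :: real
  defines "z \<equiv> iexp \<theta> - 1"
  shows "norm (measure_pmf.expectation (urn_depth K j) (\<lambda>m. iexp (\<theta> * real m)) -
      exp (z * of_real (\<Sum>i<j. 1 / real (K + i + 2)))) \<le> 3 * (norm z)\<^sup>2 * (1 - 1 / real (j + 1))"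
proof (induction j)
  case (Suc j)
  define \<phi> where "\<phi> = measure_pmf.expectation (urn_depth K j) (\<lambda>m. iexp (\<theta> * real m))"
  define h where "h = (\<Sum>i<j. 1 / real (K + i + 2))"
  define p where "p = 1 / real (K + j + 2)"
  define w where "w = z * of_real p"
  have p: "0 \<le> p" "p \<le> 1/2" by (auto simp: p_def field_simps)
  have q: "real (K + j + 1) / real (K + j + 2) = 1 - p" by (simp add: p_def field_simps)
  have h: "0 \<le> h" unfolding h_def by (intro sum_nonneg) simp
  have z2: "norm z \<le> 2"
    unfolding z_def using norm_triangle_ineq4[of "iexp \<theta>" 1] by simp
  have Rez: "Re z \<le> 0" by (simp add: z_def exp_eq_polar cis.ctr)
  have e: "measure_pmf.expectation (urn_depth K (Suc j)) (\<lambda>m. iexp (\<theta> * real m)) = (1 + w) * \<phi>"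
  proof -
    have "measure_pmf.expectation (urn_depth K j) (\<lambda>m. iexp (\<theta> * real (Suc m))) = iexp \<theta> * \<phi>"
      unfolding \<phi>_def by (simp add: distrib_left exp_add mult.commute)
    then show ?thesis
      unfolding expectation_urn_depth_Suc q p_def[symmetric] \<phi>_def[symmetric]
      by (simp add: w_def z_def scaleR_conv_of_real algebra_simps)
  qed
  \<comment> \<open>\<open>1 + w\<close> is a convex combination of 1 and a point of the unit
    circle.\<close>
  have n1: "norm (1 + w) \<le> 1"
  proof -
    have "1 + w = of_real (1 - p) + of_real p * iexp \<theta>"
      by (simp add: w_def z_def algebra_simps)
    then have "norm (1 + w) \<le> norm (of_real (1 - p) :: complex) + norm (of_real p * iexp \<theta>)"
      by (metis norm_triangle_ineq)
    also have "\<dots> = 1" using p by (simp add: norm_mult del: of_real_diff)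
    finally show ?thesis .
  qed
  have n2: "norm (exp (z * of_real h)) \<le> 1"
    using Rez h by (simp add: mult_nonpos_nonneg)
  have nw: "norm w \<le> 1"
    using p z2 mult_mono[of "norm z" 2 p "1/2"] by (simp add: w_def norm_mult)
  have "exp (z * of_real (\<Sum>i<Suc j. 1 / real (K + i + 2))) = exp w * exp (z * of_real h)"
    unfolding w_def h_def p_def sum.lessThan_Suc of_real_add
    by (simp add: distrib_left exp_add mult.commute)
  then have "norm (measure_pmf.expectation (urn_depth K (Suc j)) (\<lambda>m. iexp (\<theta> * real m)) -
      exp (z * of_real (\<Sum>i<Suc j. 1 / real (K + i + 2))))
    = norm ((1 + w) * (\<phi> - exp (z * of_real h)) + (1 + w - exp w) * exp (z * of_real h))"
    unfolding e by (simp add: algebra_simps)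
  also have "\<dots> \<le> norm (1 + w) * norm (\<phi> - exp (z * of_real h)) + norm (1 + w - exp w) * norm (exp (z * of_real h))"
    using norm_triangle_ineq by (simp only: norm_mult[symmetric])
  also have "\<dots> \<le> 1 * (3 * (norm z)\<^sup>2 * (1 - 1 / real (j + 1))) + 3 * (norm w)\<^sup>2 * 1"
    using n1 n2 Suc.IH norm_exp_minus_linear_le[OF nw] unfolding \<phi>_def h_def
    by (intro add_mono mult_mono) auto
  also have "\<dots> = 3 * (norm z)\<^sup>2 * (1 - 1 / real (j + 1) + p\<^sup>2)"
    using p by (simp add: w_def norm_mult power_mult_distrib algebra_simps)
  also have "\<dots> \<le> 3 * (norm z)\<^sup>2 * (1 - 1 / real (Suc j + 1))"
  proof (rule mult_left_mono)
    \<comment> \<open>The error added in this step is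
      \<open>3 * (norm z)\<^sup>2 * p\<^sup>2\<close>. Dropping \<open>K\<close> from
      \<open>p\<close> makes these terms telescope to a bound that is the same for all
      \<open>K\<close>.\<close>
    have "p\<^sup>2 \<le> 1 / (real (j + 1) * real (j + 2))"
      unfolding p_def power2_eq_square
      by (simp only: times_divide_times_eq mult_1_left) (intro divide_left_mono mult_mono; simp)
    also have "\<dots> = 1 / real (j + 1) - 1 / real (j + 2)"
      by (simp add: field_simps)
    finally show "1 - 1 / real (j + 1) + p\<^sup>2 \<le> 1 - 1 / real (Suc j + 1)" by simp
  qed simp
  finally show ?case .
qed simp

text \<open>Convergence of the difference lets the centring \<open>ln (K + j)\<close> replace the
  exact mean of the depth: in the characteristic function the difference is multiplied by a
  frequency tending to 0.\<close>

lemma harmonic_tail_asymp: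
  "\<exists>c. (\<lambda>j. (\<Sum>i<j. 1 / real (K + i + 2)) - ln (real (K + j))) \<longlonglongrightarrow> c"
proof -
  have eq: "(\<Sum>i<j. 1 / real (K + i + 2)) = harm (K + j + 1) - harm (K + 1)" for j
    by (induction j) (simp_all add: harm_Suc inverse_eq_divide)
  have "(\<lambda>n. harm (n + (K + 1)) - ln (real (n + (K + 1)))) \<longlonglongrightarrow> euler_mascheroni"
    using LIMSEQ_ignore_initial_segment[OF euler_mascheroni_LIMSEQ, of "K + 1"] by simp
  moreover have "(\<lambda>n. ln (real (n + (K + 1))) - ln (real (K + n))) \<longlonglongrightarrow> 0"
    by real_asymp
  ultimately have "(\<lambda>n. (harm (n + (K + 1)) - ln (real (n + (K + 1)))) +
      (ln (real (n + (K + 1))) - ln (real (K + n))) - harm (K + 1)) \<longlonglongrightarrow> euler_mascheroni + 0 - harm (K + 1)"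
    by (intro tendsto_intros)
  then show ?thesis
    unfolding eq by (intro exI[of _ "euler_mascheroni + 0 - harm (K + 1)"]) (simp add: algebra_simps)
qed

text \<open>The cubic Taylor remainder contributes at most
  \<open>\<bar>\<theta>\<bar> ^ 3 * h / 6\<close>, which is \<open>\<bar>\<theta>\<bar> / 6\<close>
  times the convergent sequence \<open>\<theta>\<^sup>2 * h\<close>.\<close>

lemma iexp_second_order:
  assumes \<theta>: "\<theta> \<longlonglongrightarrow> 0" and h: "(\<lambda>n. (\<theta> n)\<^sup>2 * h n) \<longlonglongrightarrow> t"
    and nonneg: "\<And>n. 0 \<le> h n"
  shows "(\<lambda>n. (iexp (\<theta> n) - 1 - \<i> * of_real (\<theta> n)) * of_real (h n)) \<longlonglongrightarrow> - of_real t / 2"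
proof -
  have lim: "(\<lambda>n. - of_real ((\<theta> n)\<^sup>2 * h n) / 2) \<longlonglongrightarrow> (- of_real t / 2 :: complex)"
    by (intro tendsto_intros h) simp
  have "(\<lambda>n. (iexp (\<theta> n) - 1 - \<i> * of_real (\<theta> n)) * of_real (h n) - (- of_real ((\<theta> n)\<^sup>2 * h n) / 2)) \<longlonglongrightarrow> 0"
  proof (rule Lim_null_comparison)
    show "(\<lambda>n. \<bar>\<theta> n\<bar> * ((\<theta> n)\<^sup>2 * h n) / 6) \<longlonglongrightarrow> 0"
      using tendsto_divide[OF tendsto_mult[OF tendsto_rabs[OF \<theta>] h] tendsto_const[of 6]] by simp
    show "eventually (\<lambda>n. norm ((iexp (\<theta> n) - 1 - \<i> * of_real (\<theta> n)) * of_real (h n) -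
        (- of_real ((\<theta> n)\<^sup>2 * h n) / 2)) \<le> \<bar>\<theta> n\<bar> * ((\<theta> n)\<^sup>2 * h n) / 6) sequentially"
    proof (intro always_eventually allI)
      fix n
      have "(\<Sum>k\<le>2. (\<i> * of_real (\<theta> n))^k / fact k) = 1 + \<i> * of_real (\<theta> n) - of_real ((\<theta> n)\<^sup>2) / 2"
        by (simp add: numeral_2_eq_2 algebra_simps)
      then have "norm (iexp (\<theta> n) - (1 + \<i> * of_real (\<theta> n) - of_real ((\<theta> n)\<^sup>2) / 2)) \<le> \<bar>\<theta> n\<bar> ^ 3 / 6"
        using iexp_approx1[of "\<theta> n" 2] by (simp add: fact_numeral numeral_3_eq_3)
      then have "norm ((iexp (\<theta> n) - (1 + \<i> * of_real (\<theta> n) - of_real ((\<theta> n)\<^sup>2) / 2)) * of_real (h n))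
          \<le> \<bar>\<theta> n\<bar> ^ 3 / 6 * h n"
        unfolding norm_mult using nonneg[of n] by (intro mult_mono) auto
      then show "norm ((iexp (\<theta> n) - 1 - \<i> * of_real (\<theta> n)) * of_real (h n) -
        (- of_real ((\<theta> n)\<^sup>2 * h n) / 2)) \<le> \<bar>\<theta> n\<bar> * ((\<theta> n)\<^sup>2 * h n) / 6"
        by (simp add: algebra_simps power2_eq_square power3_eq_cube)
    qed
  qed
  from tendsto_add[OF this lim] show ?thesis by simp
qed

text \<open>Standardised by \<open>ln (K + j)\<close> instead of the exact mean and variance,
  because this is the number at which \<open>a\<close> and \<open>b\<close> are evaluated in the
  rescaling.\<close>

definition urn_depth_std :: "nat \<Rightarrow> nat \<Rightarrow> real measure" where
  "urn_depth_std K j = distr (measure_pmf (urn_depth K j)) borel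
     (\<lambda>m. (real m - ln (real (K + j))) / sqrt (ln (real (K + j))))"

lemma real_distribution_urn_depth_std: "real_distribution (urn_depth_std K j)"
  unfolding urn_depth_std_def
  by (rule prob_space.real_distribution_distr[OF prob_space_measure_pmf]) simp

text \<open>Levy continuity. At the frequency \<open>t / sqrt (L j)\<close> the Poisson comparison
  has an error of order \<open>t\<^sup>2 / L j\<close>, so a bound that does not improve at a fixed
  frequency still vanishes here.\<close>

lemma urn_depth_clt: "weak_conv_m (urn_depth_std K) std_normal_distribution"
proof (rule levy_continuity[OF real_distribution_urn_depth_std real_dist_normal_dist])
  fix t :: real
  define L where "L j = ln (real (K + j))" for j
  define h where "h j = (\<Sum>i<j. 1 / real (K + i + 2))" for j
  define \<theta> where "\<theta> j = t / sqrt (L j)" for j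
  define z where "z j = iexp (\<theta> j) - 1" for j
  have L: "filterlim L at_top sequentially"
    unfolding L_def by real_asymp
  then have Lpos: "eventually (\<lambda>j. L j > 0) sequentially"
    using filterlim_at_top_dense by blast
  obtain c where c: "(\<lambda>j. h j - L j) \<longlonglongrightarrow> c"
    using harmonic_tail_asymp[of K] unfolding h_def L_def by blast
  have sqL: "filterlim (\<lambda>j. sqrt (L j)) at_top sequentially"
    by (rule filterlim_compose[OF sqrt_at_top L])
  have \<theta>: "\<theta> \<longlonglongrightarrow> 0"
    unfolding \<theta>_def using real_tendsto_divide_at_top[OF tendsto_const sqL] .
  have hL: "(\<lambda>j. h j / L j) \<longlonglongrightarrow> 1"
  proof -
    have "(\<lambda>j. (h j - L j) / L j + 1) \<longlonglongrightarrow> 0 + 1"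
      by (intro tendsto_intros real_tendsto_divide_at_top[OF c L])
    moreover have "eventually (\<lambda>j. (h j - L j) / L j + 1 = h j / L j) sequentially"
      using Lpos by eventually_elim (simp add: field_simps)
    ultimately show ?thesis by (simp add: tendsto_cong)
  qed
  have \<theta>h: "(\<lambda>j. (\<theta> j)\<^sup>2 * h j) \<longlonglongrightarrow> t\<^sup>2"
  proof -
    have "(\<lambda>j. t\<^sup>2 * (h j / L j)) \<longlonglongrightarrow> t\<^sup>2 * 1"
      by (intro tendsto_intros hL)
    moreover have "eventually (\<lambda>j. t\<^sup>2 * (h j / L j) = (\<theta> j)\<^sup>2 * h j) sequentially"
      using Lpos by eventually_elim (simp add: \<theta>_def power_divide)
    ultimately show ?thesis by (simp add: tendsto_cong)
  qed
  have h_nonneg: "0 \<le> h j" for j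
    unfolding h_def by (intro sum_nonneg) simp
  \<comment> \<open>The exponent splits into a second-order part, which tends to minus half of
    \<open>t\<^sup>2\<close>, and \<open>\<i> * \<theta> * (h - L)\<close>, which vanishes because
    \<open>h - L\<close> converges.\<close>
  have main: "(\<lambda>j. exp (- (\<i> * of_real (\<theta> j * L j)) + z j * of_real (h j))) \<longlonglongrightarrow> exp (- of_real (t\<^sup>2) / 2)"
  proof (rule tendsto_exp)
    have "(\<lambda>j. (iexp (\<theta> j) - 1 - \<i> * of_real (\<theta> j)) * of_real (h j) + \<i> * of_real (\<theta> j * (h j - L j)))
       \<longlonglongrightarrow> - of_real (t\<^sup>2) / 2 + \<i> * of_real (0 * c)"
      by (intro tendsto_intros iexp_second_order[OF \<theta> \<theta>h h_nonneg] \<theta> c)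
    then show "(\<lambda>j. - (\<i> * of_real (\<theta> j * L j)) + z j * of_real (h j)) \<longlonglongrightarrow> - of_real (t\<^sup>2) / 2"
      by (simp add: z_def algebra_simps)
  qed
  have char: "char (urn_depth_std K j) t =
      exp (- (\<i> * of_real (\<theta> j * L j))) * measure_pmf.expectation (urn_depth K j) (\<lambda>m. iexp (\<theta> j * real m))" for j
  proof -
    have "char (urn_depth_std K j) t = measure_pmf.expectation (urn_depth K j) (\<lambda>m. iexp (t * ((real m - L j) / sqrt (L j))))"
      unfolding char_def urn_depth_std_def L_def by (rule integral_distr) simp_all
    also have "\<dots> = measure_pmf.expectation (urn_depth K j) (\<lambda>m. exp (- (\<i> * of_real (\<theta> j * L j))) * iexp (\<theta> j * real m))"
    proof (intro Bochner_Integration.integral_cong refl)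
      fix m
      have "t * ((real m - L j) / sqrt (L j)) = - (\<theta> j * L j) + \<theta> j * real m"
        by (simp add: \<theta>_def algebra_simps diff_divide_distrib)
      then show "iexp (t * ((real m - L j) / sqrt (L j))) = exp (- (\<i> * of_real (\<theta> j * L j))) * iexp (\<theta> j * real m)"
        by (simp only: of_real_add distrib_left exp_add of_real_minus mult_minus_right)
    qed
    finally show ?thesis by simp
  qed
  have "(\<lambda>j. char (urn_depth_std K j) t - exp (- (\<i> * of_real (\<theta> j * L j)) + z j * of_real (h j))) \<longlonglongrightarrow> 0"
  proof (rule Lim_null_comparison)
    have "z \<longlonglongrightarrow> iexp 0 - 1"
      unfolding z_def[abs_def] by (intro tendsto_intros \<theta>)
    then have "z \<longlonglongrightarrow> 0" by simp
    then have "(\<lambda>j. 3 * (norm (z j))\<^sup>2) \<longlonglongrightarrow> 3 * (norm (0::complex))\<^sup>2"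
      by (intro tendsto_intros)
    then show "(\<lambda>j. 3 * (norm (z j))\<^sup>2) \<longlonglongrightarrow> 0" by simp
    show "eventually (\<lambda>j. norm (char (urn_depth_std K j) t - exp (- (\<i> * of_real (\<theta> j * L j)) + z j * of_real (h j)))
        \<le> 3 * (norm (z j))\<^sup>2) sequentially"
    proof (intro always_eventually allI)
      fix j
      have "norm (char (urn_depth_std K j) t - exp (- (\<i> * of_real (\<theta> j * L j)) + z j * of_real (h j)))
        = norm (measure_pmf.expectation (urn_depth K j) (\<lambda>m. iexp (\<theta> j * real m)) - exp (z j * of_real (h j)))"
        unfolding char exp_add right_diff_distrib[symmetric] norm_mult by simp
      also have "\<dots> \<le> 3 * (norm (z j))\<^sup>2 * (1 - 1 / real (j + 1))"
        using urn_depth_char_poisson[of K j "\<theta> j"] by (simp only: z_def h_def)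
      also have "\<dots> \<le> 3 * (norm (z j))\<^sup>2 * 1"
        by (intro mult_left_mono) auto
      finally show "norm (char (urn_depth_std K j) t - exp (- (\<i> * of_real (\<theta> j * L j)) + z j * of_real (h j)))
        \<le> 3 * (norm (z j))\<^sup>2" by simp
    qed
  qed
  from tendsto_add[OF this main]
  have "(\<lambda>j. char (urn_depth_std K j) t) \<longlonglongrightarrow> exp (- of_real (t\<^sup>2) / 2)" by simp
  also have "exp (- of_real (t\<^sup>2) / 2) = char std_normal_distribution t"
    unfolding char_std_normal_distribution by (simp flip: exp_of_real)
  finally show "(\<lambda>j. char (urn_depth_std K j) t) \<longlonglongrightarrow> char std_normal_distribution t" .
qed

section \<open>Regular variation\<close>

text \<open>The uniform convergence theorem of regular variation, in additive form. Averaging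
  \<open>\<bar>k (y + t) - k y\<bar>\<close> over \<open>t\<close> in a fixed interval turns the pointwise hypothesis into a
  uniform one by dominated convergence.\<close>

lemma slowly_varying_uniform:
  fixes k :: "real \<Rightarrow> real" and x u :: "nat \<Rightarrow> real"
  assumes k[measurable]: "k \<in> borel_measurable borel"
    and lim: "\<And>t. ((\<lambda>y. k (y + t) - k y) \<longlongrightarrow> 0) at_top"
    and x: "filterlim x at_top sequentially" and u: "\<And>n. \<bar>u n\<bar> \<le> 1"
  shows "(\<lambda>n. k (x n + u n) - k (x n)) \<longlonglongrightarrow> 0"
proof -
  \<comment> \<open>Cut off at 1 so that dominated convergence applies without a local bound on
    \<open>k\<close>.\<close>
  define \<psi> where "\<psi> y t = min 1 \<bar>k (y + t) - k y\<bar>" for y t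
  have \<psi>_meas[measurable]: "\<psi> y \<in> borel_measurable borel" for y
    unfolding \<psi>_def[abs_def] by measurable
  have \<psi>_nonneg: "0 \<le> \<psi> y t" and \<psi>_le: "\<psi> y t \<le> 1" for y t
    by (auto simp: \<psi>_def)
  \<comment> \<open>The window has to contain \<open>t\<close> and \<open>u + t\<close> for all
    \<open>t\<close> in [0, 1] and \<open>u\<close> in [-1, 1].\<close>
  define J where "J y = (\<integral>t. indicator {-1..2} t * \<psi> y t \<partial>lborel)" for y
  have int: "integrable lborel (\<lambda>t. indicator {-1..2} t * \<psi> y t)" for y
  proof (rule Bochner_Integration.integrable_bound)
    show "integrable lborel (indicat_real {-1..2::real})"
      by (rule integrable_real_indicator) simp_all
  qed (auto simp: \<psi>_nonneg \<psi>_le split: split_indicator)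
  have J: "(\<lambda>n. J (y n)) \<longlonglongrightarrow> 0" if y: "filterlim y at_top sequentially" for y :: "nat \<Rightarrow> real"
  proof -
    have "(\<lambda>n. \<integral>t. indicator {-1..2} t * \<psi> (y n) t \<partial>lborel) \<longlonglongrightarrow> (\<integral>t. 0 \<partial>(lborel :: real measure))"
    proof (rule integral_dominated_convergence[where w="indicat_real {-1..2}"])
      show "AE t in lborel. (\<lambda>n. indicator {-1..2} t * \<psi> (y n) t) \<longlonglongrightarrow> 0"
      proof (rule AE_I2)
        fix t :: real
        have "(\<lambda>n. k (y n + t) - k (y n)) \<longlonglongrightarrow> 0"
          using filterlim_compose[OF lim y] .
        then have "(\<lambda>n. indicator {-1..2} t * min 1 \<bar>k (y n + t) - k (y n)\<bar>) \<longlonglongrightarrow> indicator {-1..2} t * min 1 \<bar>0\<bar>"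
          by (intro tendsto_intros)
        then show "(\<lambda>n. indicator {-1..2} t * \<psi> (y n) t) \<longlonglongrightarrow> 0"
          by (simp add: \<psi>_def)
      qed
    qed (auto simp: \<psi>_nonneg \<psi>_le split: split_indicator)
    then show ?thesis by (simp add: J_def)
  qed
  define y where "y n = x n + u n" for n
  have y: "filterlim y at_top sequentially"
  proof (rule filterlim_at_top_mono)
    show "filterlim (\<lambda>n. -1 + x n) at_top sequentially"
      by (rule filterlim_tendsto_add_at_top[OF tendsto_const x])
    show "eventually (\<lambda>n. -1 + x n \<le> y n) sequentially"
      using u by (intro always_eventually allI) (simp add: y_def abs_le_iff)
  qed
  \<comment> \<open>With \<open>y = x + u\<close> the points \<open>y + t\<close> and
    \<open>x + (u + t)\<close> coincide, so the triangle inequality through \<open>k (y + t)\<close>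
    holds for each \<open>t\<close>. Integrating over [0, 1] and translating the second integral by
    \<open>u\<close> gives the bound.\<close>
  have bound: "min 1 \<bar>k (x n + u n) - k (x n)\<bar> \<le> J (y n) + J (x n)" for n
  proof -
    let ?m = "min 1 \<bar>k (x n + u n) - k (x n)\<bar>"
    have un: "-1 \<le> u n" "u n \<le> 1" using u[of n] by auto
    have i2: "integrable lborel (\<lambda>t. indicator {-1..2} (u n + 1 * t) * \<psi> (x n) (u n + 1 * t))"
      by (subst lborel_integrable_real_affine_iff) (auto intro: int)
    have "?m = (\<integral>t. indicator {0..1} t * ?m \<partial>(lborel :: real measure))"
      by simp
    also have "\<dots> \<le> (\<integral>t. indicator {-1..2} t * \<psi> (y n) t +
        indicator {-1..2} (u n + 1 * t) * \<psi> (x n) (u n + 1 * t) \<partial>lborel)"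
    proof (rule integral_mono)
      show "integrable lborel (\<lambda>t::real. indicator {0..1} t * ?m)"
        by (intro integrable_mult_left) simp
      show "integrable lborel (\<lambda>t. indicator {-1..2} t * \<psi> (y n) t +
        indicator {-1..2} (u n + 1 * t) * \<psi> (x n) (u n + 1 * t))"
        by (intro Bochner_Integration.integrable_add int i2)
      fix t :: real
      have "?m \<le> \<psi> (y n) t + \<psi> (x n) (u n + t)"
        unfolding \<psi>_def y_def by (auto simp: min_def abs_if add.assoc)
      then show "indicator {0..1} t * ?m \<le> indicator {-1..2} t * \<psi> (y n) t +
        indicator {-1..2} (u n + 1 * t) * \<psi> (x n) (u n + 1 * t)"
        using un \<psi>_nonneg[of "y n" t] \<psi>_nonneg[of "x n" "u n + t"]
        by (auto split: split_indicator)
    qed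
    also have "\<dots> = J (y n) + (\<integral>t. indicator {-1..2} (u n + 1 * t) * \<psi> (x n) (u n + 1 * t) \<partial>lborel)"
      unfolding J_def by (intro Bochner_Integration.integral_add int i2)
    also have "(\<integral>t. indicator {-1..2} (u n + 1 * t) * \<psi> (x n) (u n + 1 * t) \<partial>lborel) = J (x n)"
      unfolding J_def using lborel_integral_real_affine[of 1 "\<lambda>t. indicator {-1..2} t * \<psi> (x n) t" "u n"] by simp
    finally show ?thesis .
  qed
  have "(\<lambda>n. min 1 \<bar>k (x n + u n) - k (x n)\<bar>) \<longlonglongrightarrow> 0"
  proof (rule tendsto_sandwich[OF _ _ tendsto_const])
    show "(\<lambda>n. J (y n) + J (x n)) \<longlonglongrightarrow> 0"
      using tendsto_add[OF J[OF y] J[OF x]] by simp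
  qed (auto intro!: always_eventually bound)
  \<comment> \<open>Once below 1, the minimum equals its second argument.\<close>
  moreover then have "eventually (\<lambda>n. min 1 \<bar>k (x n + u n) - k (x n)\<bar> < 1) sequentially"
    by (rule order_tendstoD) simp
  then have "eventually (\<lambda>n. min 1 \<bar>k (x n + u n) - k (x n)\<bar> = \<bar>k (x n + u n) - k (x n)\<bar>) sequentially"
    by eventually_elim auto
  ultimately have "(\<lambda>n. \<bar>k (x n + u n) - k (x n)\<bar>) \<longlonglongrightarrow> 0"
    using tendsto_cong by fast
  then show ?thesis
    by (simp add: tendsto_rabs_zero_iff)
qed

text \<open>The definition gives a limit for each fixed ratio \<open>c\<close>, whereas the ratio
  \<open>m n / L n\<close> moves with \<open>n\<close>; uniformity near ratio 1 closes this gap.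
  Substituting \<open>exp y\<close> for the argument, taking logarithms and subtracting
  \<open>\<rho> * y\<close> makes \<open>b\<close> slowly varying in the additive sense.\<close>

lemma regularly_varying_ratio_LIMSEQ:
  fixes L m :: "nat \<Rightarrow> real"
  assumes b: "regularly_varying b"
    and L: "filterlim L at_top sequentially" and mL: "(\<lambda>n. m n / L n) \<longlonglongrightarrow> 1"
  shows "(\<lambda>n. b (m n) / b (L n)) \<longlonglongrightarrow> 1"
proof -
  obtain x0 \<rho> where meas: "b \<in> borel_measurable (restrict_space borel {x0..})"
    and pos: "\<And>x. x \<ge> x0 \<Longrightarrow> b x > 0"
    and rv: "\<And>c. c > 0 \<Longrightarrow> ((\<lambda>x. b (c * x) / b x) \<longlongrightarrow> c powr \<rho>) at_top"
    using b unfolding regularly_varying_def by blast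
  \<comment> \<open>Nothing is assumed on measurability or positivity of \<open>b\<close> below
    \<open>x0\<close>; the default value 1 provides both there.\<close>
  have meas': "(\<lambda>x. if x \<in> {x0..} then b x else 1) \<in> borel_measurable borel"
    using measurable_restrict_space_iff[of "{x0..}" borel 1 borel b] meas by auto
  define k where "k y = ln (if exp y \<in> {x0..} then b (exp y) else 1) - \<rho> * y" for y
  have k[measurable]: "k \<in> borel_measurable borel"
    unfolding k_def[abs_def] using measurable_compose[OF _ meas', of exp borel] by measurable
  have k_eq: "k y = ln (b (exp y)) - \<rho> * y" if "exp y \<ge> x0" for y
    using that by (simp add: k_def)
  have ex: "eventually (\<lambda>y. exp (y + t) \<ge> x0) at_top" for t
  proof -
    have "filterlim (\<lambda>y. exp (t + y)) at_top at_top"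
      by (intro filterlim_compose[OF exp_at_top] filterlim_tendsto_add_at_top[OF tendsto_const filterlim_ident])
    then show ?thesis by (simp add: filterlim_at_top add.commute)
  qed
  have lim: "((\<lambda>y. k (y + t) - k y) \<longlongrightarrow> 0) at_top" for t
  proof -
    have "((\<lambda>y. b (exp t * exp y) / b (exp y)) \<longlongrightarrow> exp t powr \<rho>) at_top"
      using filterlim_compose[OF rv exp_at_top, of "exp t"] by simp
    then have "((\<lambda>y. ln (b (exp t * exp y) / b (exp y)) - \<rho> * t) \<longlongrightarrow> ln (exp t powr \<rho>) - \<rho> * t) at_top"
      by (intro tendsto_intros) auto
    moreover have "eventually (\<lambda>y. ln (b (exp t * exp y) / b (exp y)) - \<rho> * t = k (y + t) - k y) at_top"
      using ex[of t] ex[of 0]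
    proof eventually_elim
      case (elim y)
      then show ?case
        using pos[of "exp (y + t)"] pos[of "exp y"]
        by (simp add: k_eq ln_div exp_add[symmetric] add.commute algebra_simps)
    qed
    ultimately show ?thesis
      by (simp add: ln_powr tendsto_cong)
  qed
  have m: "filterlim m at_top sequentially"
  proof -
    have "filterlim (\<lambda>n. m n / L n * L n) at_top sequentially"
      by (rule filterlim_tendsto_pos_mult_at_top[OF mL _ L]) simp
    moreover have "eventually (\<lambda>n. m n / L n * L n = m n) sequentially"
      using L[unfolded filterlim_at_top_gt[where c=0]] eventually_at_top_dense
        filterlim_at_top_dense[THEN iffD1, OF L, rule_format, of 0]
      by (auto elim: eventually_mono)
    ultimately show ?thesis
      by (rule filterlim_cong[OF refl refl, THEN iffD1, rotated])
  qed
  have evL: "eventually (\<lambda>n. L n \<ge> max 1 x0) sequentially" and evm: "eventually (\<lambda>n. m n \<ge> max 1 x0) sequentially"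
    using L m unfolding filterlim_at_top by blast+
  have lnlim: "(\<lambda>n. ln (m n / L n)) \<longlonglongrightarrow> 0"
    using tendsto_ln[OF mL] by simp
  \<comment> \<open>Clipped because the uniform theorem asks for the bound 1 at every index;
    \<open>evu\<close> shows that the clipping is eventually inactive.\<close>
  define u where "u n = max (-1) (min 1 (ln (m n / L n)))" for n
  have evu: "eventually (\<lambda>n. u n = ln (m n / L n)) sequentially"
  proof -
    have "eventually (\<lambda>n. \<bar>ln (m n / L n)\<bar> < 1) sequentially"
      using order_tendstoD(2)[OF tendsto_rabs[OF lnlim], of 1] by simp
    then show ?thesis by eventually_elim (auto simp: u_def)
  qed
  have "(\<lambda>n. k (ln (L n) + u n) - k (ln (L n))) \<longlonglongrightarrow> 0"
  proof (rule slowly_varying_uniform[OF k lim])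
    show "filterlim (\<lambda>n. ln (L n)) at_top sequentially"
      by (rule filterlim_compose[OF ln_at_top L])
    show "\<bar>u n\<bar> \<le> 1" for n by (auto simp: u_def)
  qed
  then have "(\<lambda>n. exp (k (ln (L n) + u n) - k (ln (L n)) + \<rho> * ln (m n / L n))) \<longlonglongrightarrow> exp (0 + \<rho> * 0)"
    by (intro tendsto_intros lnlim)
  moreover have "eventually (\<lambda>n. exp (k (ln (L n) + u n) - k (ln (L n)) + \<rho> * ln (m n / L n)) = b (m n) / b (L n)) sequentially"
    using evL evm evu
  proof eventually_elim
    case (elim n)
    then have p: "L n > 0" "m n > 0" "L n \<ge> x0" "m n \<ge> x0" by auto
    then have e: "ln (L n) + u n = ln (m n)"
      using elim by (simp add: ln_div)
    show ?case
      unfolding e using p pos[of "L n"] pos[of "m n"]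
      by (simp add: k_eq ln_div algebra_simps exp_diff)
  qed
  ultimately show ?thesis
    by (simp add: tendsto_cong)
qed

section \<open>Perturbation of weak limits\<close>

text \<open>By tightness only a compact ball matters, where \<open>f\<close> is uniformly continuous.\<close>

lemma weak_limit_affine_perturbation:
  fixes \<mu> :: "nat \<Rightarrow> 'a::euclidean_space measure" and f :: "'a \<Rightarrow> real" and w :: "nat \<Rightarrow> 'a"
  assumes \<mu>: "\<And>n. prob_on borel (\<mu> n)" and \<Lambda>: "prob_on borel \<Lambda>"
    and weak: "\<And>f :: 'a \<Rightarrow> real. continuous_on UNIV f \<Longrightarrow> bounded (range f) \<Longrightarrow>
        (\<lambda>n. \<integral>x. f x \<partial>\<mu> n) \<longlonglongrightarrow> (\<integral>x. f x \<partial>\<Lambda>)"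
    and f: "continuous_on UNIV f" "bounded (range f)"
    and r: "r \<longlonglongrightarrow> 1" and w: "w \<longlonglongrightarrow> w0"
  shows "(\<lambda>n. \<integral>y. f (r n *\<^sub>R y + w n) \<partial>\<mu> n) \<longlonglongrightarrow> (\<integral>y. f (y + w0) \<partial>\<Lambda>)"
proof -
  obtain B where B: "\<And>x. \<bar>f x\<bar> \<le> B" using f(2) by (auto simp: bounded_iff)
  have B0: "0 \<le> B" using B[of undefined] by linarith
  have fm[measurable]: "f \<in> borel_measurable borel" by (rule borel_measurable_continuous_onI[OF f(1)])
  \<comment> \<open>A continuous cutoff, 1 on the ball of radius \<open>T\<close> and 0 outside
    radius \<open>T + 1\<close>. Being a weak test function, it carries the tightness of
    \<open>\<Lambda>\<close> over to all but finitely many \<open>\<mu> n\<close>.\<close>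
  define \<phi> :: "nat \<Rightarrow> 'a \<Rightarrow> real" where "\<phi> T y = max 0 (min 1 (real T + 1 - norm y))" for T y
  have \<phi>c: "continuous_on UNIV (\<phi> T)" for T
    unfolding \<phi>_def[abs_def] by (intro continuous_intros)
  have \<phi>01: "0 \<le> \<phi> T y" "\<phi> T y \<le> 1" for T y by (auto simp: \<phi>_def)
  have \<phi>out: "\<phi> T y = 0" if "norm y \<ge> real T + 1" for T y using that by (auto simp: \<phi>_def)
  have \<phi>b: "bounded (range (\<phi> T))" for T using \<phi>01 by (auto simp: bounded_iff intro!: exI[of _ 1])
  have \<phi>bm: "bdd_measurable borel 1 (\<phi> T)" for T
    using \<phi>01 borel_measurable_continuous_onI[OF \<phi>c] by (auto simp: bdd_measurable_def)
  have bm: "bdd_measurable borel B (\<lambda>y. f (c *\<^sub>R y + x))" for c x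
    using B by (auto simp: bdd_measurable_def)
  have lim1: "(\<lambda>n. \<integral>y. f (y + w0) \<partial>\<mu> n) \<longlonglongrightarrow> (\<integral>y. f (y + w0) \<partial>\<Lambda>)"
  proof (rule weak)
    show "continuous_on UNIV (\<lambda>y. f (y + w0))"
      by (intro continuous_on_compose2[OF f(1)] continuous_intros) auto
    show "bounded (range (\<lambda>y. f (y + w0)))"
      using B by (auto simp: bounded_iff)
  qed
  have "(\<lambda>n. (\<integral>y. f (r n *\<^sub>R y + w n) \<partial>\<mu> n) - (\<integral>y. f (y + w0) \<partial>\<mu> n)) \<longlonglongrightarrow> 0"
  proof (rule LIMSEQ_I)
    fix e :: real assume e: "0 < e"
    \<comment> \<open>The final bound is \<open>\<epsilon> + 2 * B * \<epsilon>\<close>, which this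
      choice keeps strictly below \<open>e\<close>, also for \<open>B = 0\<close>.\<close>
    define \<epsilon> where "\<epsilon> = e / (2 * B + 2)"
    have \<epsilon>: "\<epsilon> > 0" using e B0 by (simp add: \<epsilon>_def)
    have "(\<lambda>T. \<integral>y. \<phi> T y \<partial>\<Lambda>) \<longlonglongrightarrow> (\<integral>y. 1 \<partial>\<Lambda>)"
    proof (rule integral_prob_on_LIMSEQ[OF \<Lambda> \<phi>bm])
      fix y :: 'a
      have "eventually (\<lambda>T. real T \<ge> norm y) sequentially"
        using filterlim_real_sequentially by (auto simp: filterlim_at_top)
      then have "eventually (\<lambda>T. \<phi> T y = 1) sequentially"
        by eventually_elim (simp add: \<phi>_def)
      then show "(\<lambda>T. \<phi> T y) \<longlonglongrightarrow> 1" by (rule tendsto_eventually)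
    qed
    moreover have "(\<integral>y. 1 \<partial>\<Lambda>) = (1::real)"
      using \<Lambda> by (simp add: prob_on_def prob_space.prob_space)
    ultimately have "eventually (\<lambda>T. (\<integral>y. \<phi> T y \<partial>\<Lambda>) > 1 - \<epsilon>) sequentially"
      using \<epsilon> by (auto intro: order_tendstoD(1))
    then obtain T where T: "(\<integral>y. \<phi> T y \<partial>\<Lambda>) > 1 - \<epsilon>"
      by (auto dest: eventually_happens)
    have evT: "eventually (\<lambda>n. (\<integral>y. \<phi> T y \<partial>\<mu> n) > 1 - \<epsilon>) sequentially"
      using order_tendstoD(1)[OF weak[OF \<phi>c \<phi>b] T] .
    \<comment> \<open>Large enough for \<open>y + w0\<close> with the norm of \<open>y\<close> at
      most \<open>T + 1\<close>, and for the perturbed point, which lies within \<open>T + 2\<close>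
      of it.\<close>
    define D where "D = real T + 1 + norm w0 + real T + 2"
    have "uniformly_continuous_on (cball 0 D) f"
      by (rule compact_uniformly_continuous[OF continuous_on_subset[OF f(1)]]) auto
    then obtain d where d: "d > 0" "\<And>x x'. x \<in> cball 0 D \<Longrightarrow> x' \<in> cball 0 D \<Longrightarrow> dist x' x < d \<Longrightarrow> dist (f x') (f x) < \<epsilon>"
      unfolding uniformly_continuous_on_def using \<epsilon> by metis
    \<comment> \<open>The two points differ by at most \<open>d' * (T + 2)\<close>: the quotient
      makes this less than \<open>d\<close>, and the bound 1 keeps it at most
      \<open>T + 2\<close>.\<close>
    define d' where "d' = min 1 (d / (real T + 3))"
    have d': "d' > 0" using d by (simp add: d'_def)
    have evr: "eventually (\<lambda>n. \<bar>r n - 1\<bar> < d') sequentially"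
      using tendstoD[OF r d'] by (simp add: dist_real_def)
    have evw: "eventually (\<lambda>n. norm (w n - w0) < d') sequentially"
      using tendstoD[OF w d'] by (simp add: dist_norm)
    have "eventually (\<lambda>n. norm ((\<integral>y. f (r n *\<^sub>R y + w n) \<partial>\<mu> n) - (\<integral>y. f (y + w0) \<partial>\<mu> n) - 0) < e) sequentially"
      using evT evr evw
    proof eventually_elim
      case (elim n)
      have pt: "\<bar>f (r n *\<^sub>R y + w n) - f (y + w0)\<bar> \<le> \<epsilon> + 2 * B * (1 - \<phi> T y)" for y
      proof (cases "norm y \<ge> real T + 1")
        case True
        have "\<bar>f (r n *\<^sub>R y + w n) - f (y + w0)\<bar> \<le> B + B"
          using B[of "r n *\<^sub>R y + w n"] B[of "y + w0"] by linarith
        with True \<epsilon> show ?thesis by (simp add: \<phi>out)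
      next
        case False
        have n1: "norm ((r n *\<^sub>R y + w n) - (y + w0)) \<le> \<bar>r n - 1\<bar> * norm y + norm (w n - w0)"
        proof -
          have "(r n *\<^sub>R y + w n) - (y + w0) = (r n - 1) *\<^sub>R y + (w n - w0)"
            by (simp add: algebra_simps)
          then show ?thesis by (metis norm_scaleR norm_triangle_ineq)
        qed
        also have "\<dots> \<le> d' * (real T + 1) + d'"
          using elim False d' by (intro add_mono mult_mono) auto
        also have "\<dots> = d' * (real T + 2)" by (simp add: algebra_simps)
        finally have n2: "norm ((r n *\<^sub>R y + w n) - (y + w0)) \<le> d' * (real T + 2)" .
        have "d' * (real T + 2) \<le> d / (real T + 3) * (real T + 2)"
          unfolding d'_def by (intro mult_right_mono) auto
        also have "\<dots> < d" using d(1) by (simp add: field_simps)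
        finally have n3: "dist (r n *\<^sub>R y + w n) (y + w0) < d"
          using n2 by (simp add: dist_norm)
        have y0: "norm (y + w0) \<le> real T + 1 + norm w0"
          using norm_triangle_ineq[of y w0] False by linarith
        have "d' * (real T + 2) \<le> 1 * (real T + 2)"
          unfolding d'_def by (intro mult_right_mono) auto
        then have "norm (r n *\<^sub>R y + w n) \<le> D"
          using n2 y0 norm_triangle_ineq2[of "r n *\<^sub>R y + w n" "y + w0"] unfolding D_def
          by (smt (verit) mult_1)
        then have "dist (f (r n *\<^sub>R y + w n)) (f (y + w0)) < \<epsilon>"
          using y0 by (intro d(2) n3) (auto simp: D_def)
        then have "\<bar>f (r n *\<^sub>R y + w n) - f (y + w0)\<bar> \<le> \<epsilon>" by (simp add: dist_real_def)
        moreover have "0 \<le> 2 * B * (1 - \<phi> T y)" using B0 \<phi>01 by simp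
        ultimately show ?thesis by linarith
      qed
      interpret prob_space "\<mu> n" using \<mu> by (simp add: prob_on_def)
      have i1: "integrable (\<mu> n) (\<lambda>y. f (r n *\<^sub>R y + w n))" "integrable (\<mu> n) (\<lambda>y. f (y + w0))"
        and i2: "integrable (\<mu> n) (\<phi> T)"
        using integrable_prob_on[OF \<mu> bm] integrable_prob_on[OF \<mu> bm[of 1]] integrable_prob_on[OF \<mu> \<phi>bm]
        by simp_all
      have "\<bar>(\<integral>y. f (r n *\<^sub>R y + w n) \<partial>\<mu> n) - (\<integral>y. f (y + w0) \<partial>\<mu> n)\<bar>
          = \<bar>\<integral>y. f (r n *\<^sub>R y + w n) - f (y + w0) \<partial>\<mu> n\<bar>"
        using i1 by simp
      also have "\<dots> \<le> (\<integral>y. \<bar>f (r n *\<^sub>R y + w n) - f (y + w0)\<bar> \<partial>\<mu> n)"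
        by (rule integral_abs_bound)
      also have "\<dots> \<le> (\<integral>y. \<epsilon> + 2 * B * (1 - \<phi> T y) \<partial>\<mu> n)"
        using i1 i2 pt by (intro integral_mono) auto
      also have "\<dots> = \<epsilon> + 2 * B * (1 - (\<integral>y. \<phi> T y \<partial>\<mu> n))"
        using i2 by (simp add: prob_space)
      also have "\<dots> \<le> \<epsilon> + 2 * B * \<epsilon>"
        using elim B0 by (intro add_left_mono mult_left_mono) auto
      also have "\<dots> = e * ((2 * B + 1) / (2 * B + 2))" by (simp add: \<epsilon>_def algebra_simps add_divide_distrib)
      also have "\<dots> < e * 1"
        using e B0 by (intro mult_strict_left_mono) auto
      finally show ?case by simp
    qed
    then show "\<exists>no. \<forall>n\<ge>no. norm ((\<integral>y. f (r n *\<^sub>R y + w n) \<partial>\<mu> n) - (\<integral>y. f (y + w0) \<partial>\<mu> n) - 0) < e"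
      by (simp add: eventually_sequentially)
  qed
  from tendsto_add[OF this lim1] show ?thesis by simp
qed

section \<open>Existence and marginals of Markov chains\<close>

lemma markov_kernel_measurable:
  assumes "markov_kernel F N K"
  shows "K \<in> F \<rightarrow>\<^sub>M subprob_algebra N"
proof (rule measurable_subprob_algebra)
  have p: "prob_space (K a)" "sets (K a) = sets N" if "a \<in> space F" for a
    using assms that by (auto simp: markov_kernel_def prob_on_def)
  show "subprob_space (K a)" "sets (K a) = sets N" if "a \<in> space F" for a
    using p[OF that] by (auto intro: prob_space_imp_subprob_space)
  fix A assume A: "A \<in> sets N"
  have "(\<lambda>a. ennreal (measure (K a) A)) \<in> borel_measurable F"
    using assms A by (auto simp: markov_kernel_def)
  also have "?this \<longleftrightarrow> (\<lambda>a. emeasure (K a) A) \<in> borel_measurable F"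
  proof (rule measurable_cong)
    fix a assume "a \<in> space F"
    then interpret prob_space "K a" by (rule p)
    show "ennreal (measure (K a) A) = emeasure (K a) A" by (simp add: emeasure_eq_measure)
  qed
  finally show "(\<lambda>a. emeasure (K a) A) \<in> borel_measurable F" .
qed

text \<open>The convergence hypothesis quantifies over chains on sample spaces of type
  \<open>nat \<Rightarrow> 'a\<close>, so it yields information only after a chain has been built on
  path space. The construction is that of Ionescu-Tulcea.\<close>

lemma markov_chain_exists:
  fixes N :: "'a measure"
  assumes R: "markov_kernel N N R" and \<mu>: "prob_on N \<mu>"
  shows "\<exists>(\<Omega> :: (nat \<Rightarrow> 'a) measure) X. markov_chain \<Omega> N R \<mu> X"
proof -
  note R_meas[measurable] = markov_kernel_measurable[OF R]
  \<comment> \<open>The law of coordinate \<open>i\<close> given the earlier ones: the initial law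
    at 0, and afterwards a function of the predecessor alone.\<close>
  define P where "P i \<omega> = (case i of 0 \<Rightarrow> \<mu> | Suc n \<Rightarrow> R (\<omega> n))" for i and \<omega> :: "nat \<Rightarrow> 'a"
  have \<mu>_sub: "\<mu> \<in> space (subprob_algebra N)"
    using \<mu> by (auto simp: prob_on_def space_subprob_algebra intro: prob_space_imp_subprob_space)
  have P_meas: "P i \<in> PiM {0..<i} (\<lambda>_. N) \<rightarrow>\<^sub>M subprob_algebra N"
    and P_prob: "x \<in> space (PiM {0..<i} (\<lambda>_. N)) \<Longrightarrow> prob_space (P i x)" for i x
  proof -
    show "P i \<in> PiM {0..<i} (\<lambda>_. N) \<rightarrow>\<^sub>M subprob_algebra N"
    proof (cases i)
      case 0 with \<mu>_sub show ?thesis by (simp add: P_def[abs_def])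
    next
      case (Suc n)
      have "(\<lambda>\<omega>. R (\<omega> n)) \<in> PiM {0..<Suc n} (\<lambda>_. N) \<rightarrow>\<^sub>M subprob_algebra N"
        by (rule measurable_compose[OF _ R_meas]) (rule measurable_component_singleton, simp)
      with Suc show ?thesis by (simp add: P_def[abs_def])
    qed
    show "prob_space (P i x)" if x: "x \<in> space (PiM {0..<i} (\<lambda>_. N))"
    proof (cases i)
      case 0 with \<mu> show ?thesis by (simp add: P_def prob_on_def)
    next
      case (Suc n)
      then have "x n \<in> space N" using x by (auto simp: space_PiM PiE_iff)
      with R Suc show ?thesis by (auto simp: P_def markov_kernel_def prob_on_def)
    qed
  qed
  interpret IT: Ionescu_Tulcea P "\<lambda>_. N"
    using P_meas P_prob by (rule Ionescu_Tulcea.intro)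
  define \<Omega> where "\<Omega> = IT.PF.lim"
  \<comment> \<open>The only point of the product over the empty index set, from which the
    construction starts.\<close>
  define u :: "nat \<Rightarrow> 'a" where "u = (\<lambda>_. undefined)"
  define J where "J n = {0..<n::nat}" for n
  have sets\<Omega>[measurable_cong]: "sets \<Omega> = sets (PiM UNIV (\<lambda>_. N))"
    by (simp add: \<Omega>_def)
  have space\<Omega>: "space \<Omega> = space (PiM UNIV (\<lambda>_. N))" by (simp add: \<Omega>_def)
  \<comment> \<open>The projective limit has the iterated kernels as its finite-dimensional laws;
    the computations below are made with these.\<close>
  have C: "IT.C 0 n u = distr \<Omega> (PiM (J n) (\<lambda>_. N)) (\<lambda>x. restrict x (J n))" for n
  proof (rule measure_eqI)
    have u: "u \<in> space (PiM {0..<0} (\<lambda>_. N))" by (simp add: u_def space_PiM)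
    show "sets (IT.C 0 n u) = sets (distr \<Omega> (PiM (J n) (\<lambda>_. N)) (\<lambda>x. restrict x (J n)))"
      using IT.sets_C[OF u, of n] by (simp add: J_def)
    fix X assume "X \<in> sets (IT.C 0 n u)"
    then have X: "X \<in> sets (PiM {0..<n} (\<lambda>_. N))" using IT.sets_C[OF u, of n] by simp
    have "emeasure (IT.C 0 n u) X = emeasure (IT.CI {0..<n}) X"
      using IT.emeasure_CI[OF subset_refl X] sets.sets_into_space[OF X]
      by (simp add: u_def prod_emb_id space_PiM)
    then show "emeasure (IT.C 0 n u) X = emeasure (distr \<Omega> (PiM (J n) (\<lambda>_. N)) (\<lambda>x. restrict x (J n))) X"
      unfolding \<Omega>_def J_def by (simp add: IT.distr_lim)
  qed
  have u: "u \<in> space (PiM {0..<0} (\<lambda>_. N))" by (simp add: u_def space_PiM)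
  have restr[measurable]: "(\<lambda>x. restrict x (J n)) \<in> \<Omega> \<rightarrow>\<^sub>M PiM (J n) (\<lambda>_. N)" for n
    by (intro measurable_restrict) measurable
  have "prob_space (distr \<Omega> (PiM (J 0) (\<lambda>_. N)) (\<lambda>x. restrict x (J 0)))"
    unfolding C[symmetric] by (rule IT.prob_space_C[OF u])
  then have ps: "prob_space \<Omega>"
    by (rule prob_space_distrD[OF restr])
  interpret prob_space \<Omega> by (rule ps)
  define X where "X n \<omega> = \<omega> n" for n and \<omega> :: "nat \<Rightarrow> 'a"
  have X[measurable]: "X n \<in> \<Omega> \<rightarrow>\<^sub>M N" for n
    unfolding X_def[abs_def] by measurable
  have C_Suc: "emeasure (IT.C 0 (Suc n) u) B = (\<integral>\<^sup>+x. emeasure (IT.eP n x) B \<partial>IT.C 0 n u)"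
    if B: "B \<in> sets (PiM (J (Suc n)) (\<lambda>_. N))" for n B
    using B IT.measurable_eP[of n] IT.sets_C[OF u, of n] IT.prob_space_C[OF u, of n]
    by (simp add: J_def) (intro emeasure_bind[where N="PiM {0..<Suc n} (\<lambda>_. N)"],
        auto simp: prob_space.not_empty cong: measurable_cong_sets)
  have init: "distr \<Omega> N (X 0) = \<mu>"
  proof (rule measure_eqI)
    show "sets (distr \<Omega> N (X 0)) = sets \<mu>" using \<mu> by (simp add: prob_on_def)
    fix A assume "A \<in> sets (distr \<Omega> N (X 0))"
    then have A[measurable]: "A \<in> sets N" by simp
    define B where "B = {x \<in> space (PiM (J (Suc 0)) (\<lambda>_. N)). x 0 \<in> A}"
    have B: "B \<in> sets (PiM (J (Suc 0)) (\<lambda>_. N))"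
      unfolding B_def J_def by measurable
    have "emeasure (distr \<Omega> N (X 0)) A = emeasure \<Omega> {\<omega> \<in> space \<Omega>. \<omega> 0 \<in> A}"
      by (subst emeasure_distr) (auto simp: X_def intro!: arg_cong[where f="emeasure \<Omega>"])
    also have "\<dots> = emeasure (IT.C 0 (Suc 0) u) B"
      unfolding C using B by (subst emeasure_distr)
        (auto simp: B_def J_def space\<Omega> space_PiM PiE_iff intro!: arg_cong[where f="emeasure \<Omega>"])
    also have "\<dots> = emeasure (IT.eP 0 u) B"
      using bind_return[OF IT.measurable_eP[of 0] u] by simp
    also have "\<dots> = emeasure \<mu> ((\<lambda>x. u(0 := x)) -` B \<inter> space N)"
      using B by (subst IT.emeasure_eP[OF u]) (auto simp: P_def J_def)
    also have "(\<lambda>x. u(0 := x)) -` B \<inter> space N = A"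
      using sets.sets_into_space[OF A] by (auto simp: B_def J_def space_PiM u_def PiE_iff extensional_def)
    finally show "emeasure (distr \<Omega> N (X 0)) A = emeasure \<mu> A" .
  qed
  have "regular_cond_distr \<Omega> (past \<Omega> N X (Suc n)) N (X (Suc n)) (\<lambda>\<omega>. R (X n \<omega>))" for n
    unfolding regular_cond_distr_def
  proof safe
    let ?F = "past \<Omega> N X (Suc n)"
    have sub: "subalgebra \<Omega> ?F" by (rule subalgebra_past) (rule X)
    interpret fs: finite_measure_subalgebra \<Omega> ?F
      using sub by unfold_locales
    have spF: "space ?F = space \<Omega>" using sub by (simp add: subalgebra_def)
    have GP: "(\<Union>i<k. {X i -` A \<inter> space \<Omega> |A. A \<in> sets N}) \<subseteq> Pow (space \<Omega>)" for k by auto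
    have setsF: "sets ?F = sigma_sets (space \<Omega>) (\<Union>i<Suc n. {X i -` A \<inter> space \<Omega> |A. A \<in> sets N})"
      unfolding past_def by (rule sets_measure_of[OF GP])
    have XF: "X n \<in> ?F \<rightarrow>\<^sub>M N"
    proof (rule measurableI)
      show "X n x \<in> space N" if "x \<in> space ?F" for x
        using that measurable_space[OF X] by (simp add: spF)
      show "X n -` A \<inter> space ?F \<in> sets ?F" if "A \<in> sets N" for A
        unfolding spF setsF using that by (intro sigma_sets.Basic) auto
    qed
    show kern: "markov_kernel ?F N (\<lambda>\<omega>. R (X n \<omega>))"
      unfolding markov_kernel_def
    proof safe
      show "prob_on N (R (X n \<omega>))" if "\<omega> \<in> space ?F" for \<omega>
        using R measurable_space[OF XF that] by (simp add: markov_kernel_def)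
      show "(\<lambda>\<omega>. measure (R (X n \<omega>)) A) \<in> borel_measurable ?F" if "A \<in> sets N" for A
        using R that by (intro measurable_compose[OF XF]) (auto simp: markov_kernel_def)
    qed
    fix A assume A[measurable]: "A \<in> sets N"
    have m: "(\<lambda>\<omega>. measure (R (X n \<omega>)) A) \<in> borel_measurable ?F"
      using kern A by (simp add: markov_kernel_def)
    have m\<Omega>: "(\<lambda>\<omega>. measure (R (X n \<omega>)) A) \<in> borel_measurable \<Omega>"
      by (rule measurable_from_subalg[OF sub m])
    have RP: "prob_space (R (X n \<omega>))" if "\<omega> \<in> space \<Omega>" for \<omega>
      using R measurable_space[OF X that] by (simp add: markov_kernel_def prob_on_def)
    let ?I = "indicat_real (X (Suc n) -` A \<inter> space \<Omega>)"
    have E[measurable]: "X (Suc n) -` A \<inter> space \<Omega> \<in> sets \<Omega>" by measurable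
    show "AE \<omega> in \<Omega>. real_cond_exp \<Omega> ?F ?I \<omega> = measure (R (X n \<omega>)) A"
    proof (rule fs.real_cond_exp_charact)
      show "integrable \<Omega> ?I" by (intro integrable_real_indicator E) (simp add: less_top[symmetric])
      show "integrable \<Omega> (\<lambda>\<omega>. measure (R (X n \<omega>)) A)"
      proof (rule integrable_const_bound[of _ 1])
        show "AE \<omega> in \<Omega>. norm (measure (R (X n \<omega>)) A) \<le> 1"
          using RP by (intro AE_I2) (simp add: prob_space.prob_le_1)
      qed (rule m\<Omega>)
      show "(\<lambda>\<omega>. measure (R (X n \<omega>)) A) \<in> borel_measurable ?F" by (rule m)
      fix B assume BF: "B \<in> sets ?F"
      let ?r = "\<lambda>\<omega>. restrict \<omega> (J (Suc n))"
      \<comment> \<open>Events of the past are preimages under the projection to the first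
        \<open>n + 1\<close> coordinates, so they can be carried over to a finite product.\<close>
      have "sets ?F \<subseteq> sets (vimage_algebra (space \<Omega>) ?r (PiM (J (Suc n)) (\<lambda>_. N)))"
      proof -
        let ?V = "vimage_algebra (space \<Omega>) ?r (PiM (J (Suc n)) (\<lambda>_. N))"
        have r: "?r \<in> ?V \<rightarrow>\<^sub>M PiM (J (Suc n)) (\<lambda>_. N)"
          by (intro measurable_vimage_algebra1 Pi_I measurable_space[OF restr])
        have "X i -` A \<inter> space \<Omega> \<in> sets ?V" if i: "i < Suc n" and A: "A \<in> sets N" for i A
        proof -
          have "(\<lambda>\<omega>. ?r \<omega> i) \<in> ?V \<rightarrow>\<^sub>M N"
            by (rule measurable_compose[OF r measurable_component_singleton]) (use i in \<open>simp add: J_def\<close>)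
          from measurable_sets[OF this A] i show ?thesis
            by (simp add: X_def J_def vimage_def)
        qed
        then have "(\<Union>i<Suc n. {X i -` A \<inter> space \<Omega> |A. A \<in> sets N}) \<subseteq> sets ?V" by auto
        from sets.sigma_sets_subset[OF this] show ?thesis
          unfolding setsF by simp
      qed
      with BF obtain B' where B'[measurable]: "B' \<in> sets (PiM (J (Suc n)) (\<lambda>_. N))"
        and B: "B = ?r -` B' \<inter> space \<Omega>"
        using sets_vimage_algebra2[of ?r "space \<Omega>" "PiM (J (Suc n)) (\<lambda>_. N)"] measurable_space[OF restr]
        by blast
      have B_meas[measurable]: "B \<in> sets \<Omega>" using BF sub by (auto simp: subalgebra_def)
      \<comment> \<open>The joint event as a set of paths of length \<open>n + 2\<close>, whose last
        coordinate is integrated out first.\<close>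
      define D where "D = {x \<in> space (PiM (J (Suc (Suc n))) (\<lambda>_. N)). restrict x (J (Suc n)) \<in> B' \<and> x (Suc n) \<in> A}"
      have D: "D \<in> sets (PiM (J (Suc (Suc n))) (\<lambda>_. N))"
      proof -
        have [measurable]: "(\<lambda>x. restrict x (J (Suc n))) \<in> PiM (J (Suc (Suc n))) (\<lambda>_. N) \<rightarrow>\<^sub>M PiM (J (Suc n)) (\<lambda>_. N)"
          by (intro measurable_restrict_subset) (auto simp: J_def)
        have [measurable]: "(\<lambda>x. x (Suc n)) \<in> PiM (J (Suc (Suc n))) (\<lambda>_. N) \<rightarrow>\<^sub>M N"
          by (intro measurable_component_singleton) (auto simp: J_def)
        show ?thesis unfolding D_def by measurable
      qed
      have "emeasure \<Omega> (B \<inter> (X (Suc n) -` A \<inter> space \<Omega>)) = emeasure (IT.C 0 (Suc (Suc n)) u) D"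
        unfolding C using D restr[of "Suc (Suc n)"] by (subst emeasure_distr)
          (auto simp: D_def B X_def J_def space\<Omega> space_PiM PiE_iff restrict_restrict Int_absorb1
            intro!: arg_cong[where f="emeasure \<Omega>"])
      also have "\<dots> = (\<integral>\<^sup>+x. emeasure (IT.eP (Suc n) x) D \<partial>IT.C 0 (Suc n) u)"
        by (rule C_Suc[OF D])
      also have "\<dots> = (\<integral>\<^sup>+x. indicator B' x * emeasure (R (x n)) A \<partial>IT.C 0 (Suc n) u)"
      proof (rule nn_integral_cong)
        fix x assume "x \<in> space (IT.C 0 (Suc n) u)"
        then have x: "x \<in> space (PiM {0..<Suc n} (\<lambda>_. N))" using IT.space_C[OF u] by (simp del: IT.C.simps)
        have *: "restrict (x(Suc n := y)) (J (Suc n)) = x" for y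
          using x by (auto simp: J_def space_PiM PiE_iff extensional_def fun_eq_iff)
        have "(\<lambda>y. x(Suc n := y)) -` D \<inter> space N = (if x \<in> B' then A else {})"
          using sets.sets_into_space[OF A] x
          by (auto simp: D_def *) (auto simp: J_def space_PiM PiE_iff extensional_def)
        then show "emeasure (IT.eP (Suc n) x) D = indicator B' x * emeasure (R (x n)) A"
          using D by (subst IT.emeasure_eP[OF x]) (auto simp: J_def P_def)
      qed
      also have "\<dots> = (\<integral>\<^sup>+\<omega>. indicator B \<omega> * emeasure (R (X n \<omega>)) A \<partial>\<Omega>)"
      proof -
        have "(\<lambda>x. emeasure (R (x n)) A) \<in> borel_measurable (PiM (J (Suc n)) (\<lambda>_. N))"
          by (rule measurable_compose[OF measurable_component_singleton[of n] measurable_emeasure_kernel[OF R_meas A]])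
            (simp add: J_def)
        then have "(\<lambda>x. indicator B' x * emeasure (R (x n)) A) \<in> borel_measurable (PiM (J (Suc n)) (\<lambda>_. N))"
          by measurable
        then have "(\<lambda>x. indicator B' x * emeasure (R (x n)) A) \<in>
            borel_measurable (distr \<Omega> (PiM (J (Suc n)) (\<lambda>_. N)) ?r)"
          by simp
        from nn_integral_distr[OF restr this] show ?thesis
          unfolding C by (simp add: B X_def)
            (auto simp: J_def intro!: nn_integral_cong split: split_indicator)
      qed
      also have "\<dots> = (\<integral>\<^sup>+\<omega>. ennreal (indicator B \<omega> * measure (R (X n \<omega>)) A) \<partial>\<Omega>)"
      proof (rule nn_integral_cong)
        fix \<omega> assume "\<omega> \<in> space \<Omega>"
        then interpret K: prob_space "R (X n \<omega>)" by (rule RP)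
        show "indicator B \<omega> * emeasure (R (X n \<omega>)) A = ennreal (indicator B \<omega> * measure (R (X n \<omega>)) A)"
          by (simp add: K.emeasure_eq_measure split: split_indicator)
      qed
      finally have eq: "emeasure \<Omega> (B \<inter> (X (Suc n) -` A \<inter> space \<Omega>)) =
        (\<integral>\<^sup>+\<omega>. ennreal (indicator B \<omega> * measure (R (X n \<omega>)) A) \<partial>\<Omega>)" .
      have "(\<integral>\<omega>\<in>B. ?I \<omega> \<partial>\<Omega>) = (\<integral>\<omega>. indicat_real (B \<inter> (X (Suc n) -` A \<inter> space \<Omega>)) \<omega> \<partial>\<Omega>)"
        unfolding set_lebesgue_integral_def by (simp add: indicator_inter_arith)
      also have "\<dots> = measure \<Omega> (B \<inter> (X (Suc n) -` A \<inter> space \<Omega>))"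
        by (simp add: Int_assoc[symmetric] Int_absorb2)
      also have "\<dots> = (\<integral>\<omega>. indicator B \<omega> * measure (R (X n \<omega>)) A \<partial>\<Omega>)"
        unfolding measure_def eq using m\<Omega> by (intro integral_eq_nn_integral[symmetric]) auto
      also have "\<dots> = (\<integral>\<omega>\<in>B. measure (R (X n \<omega>)) A \<partial>\<Omega>)"
        unfolding set_lebesgue_integral_def by simp
      finally show "(\<integral>\<omega>\<in>B. ?I \<omega> \<partial>\<Omega>) = (\<integral>\<omega>\<in>B. measure (R (X n \<omega>)) A \<partial>\<Omega>)" .
    qed
  qed
  then have "markov_chain \<Omega> N R \<mu> X"
    unfolding markov_chain_def using ps X init by blast
  then show ?thesis by blast
qed

text \<open>Started from a point mass, this turns powers of the kernel operator into means along a
  genuine chain, to which the convergence hypothesis applies. Conditioning at the last step replaces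
  \<open>f\<close> by \<open>kernel_op R f\<close>.\<close>

lemma markov_chain_expectation:
  assumes R: "markov_kernel N N R" and chain: "markov_chain \<Omega> N R \<mu> X"
  shows "bdd_measurable N B f \<Longrightarrow> (\<integral>\<omega>. f (X m \<omega>) \<partial>\<Omega>) = (\<integral>s. (kernel_op R ^^ m) f s \<partial>\<mu>)"
proof (induction m arbitrary: f)
  case 0
  have "(\<integral>s. f s \<partial>distr \<Omega> N (X 0)) = (\<integral>\<omega>. f (X 0 \<omega>) \<partial>\<Omega>)"
    using chain 0 by (intro integral_distr) (auto simp: markov_chain_def bdd_measurable_def)
  with chain show ?case by (simp add: markov_chain_def)
next
  case (Suc m)
  have X: "X n \<in> \<Omega> \<rightarrow>\<^sub>M N" for n using chain by (simp add: markov_chain_def)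
  have 1: "bdd_measurable (past \<Omega> N X (Suc m)) 1 (\<lambda>_. 1)" by (simp add: bdd_measurable_def)
  have "(\<integral>\<omega>. f (X (Suc m) \<omega>) \<partial>\<Omega>) = (\<integral>\<omega>. kernel_op R f (X m \<omega>) \<partial>\<Omega>)"
    unfolding kernel_op_def
    using integral_regular_cond_distr[OF _ subalgebra_past X _ Suc.prems 1, of "Suc m"] X chain
    by (simp add: markov_chain_def)
  also have "\<dots> = (\<integral>s. (kernel_op R ^^ m) (kernel_op R f) s \<partial>\<mu>)"
    by (rule Suc.IH[OF bdd_measurable_kernel_op[OF R Suc.prems]])
  also have "\<dots> = (\<integral>s. (kernel_op R ^^ Suc m) f s \<partial>\<mu>)"
    by (simp only: funpow_Suc_right o_def)
  finally show ?case .
qed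

section \<open>Limit theorem for the urn\<close>

text \<open>\<open>K\<close> is chosen first, which is possible because the fluctuation bound
  involves only \<open>B\<close> and \<open>K\<close>. With \<open>K\<close> fixed, the pointwise
  limits in \<open>s\<close> are integrated against the random law \<open>urn_law U K\<close> by
  dominated convergence.\<close>

lemma urn_law_L2_limit:
  fixes f :: "nat \<Rightarrow> 'a \<Rightarrow> real"
  assumes urn: "urn_model M N R U\<^sub>0 U Z" and R: "markov_kernel N N R"
    and f: "\<And>n. bdd_measurable N B (f n)"
    and lim: "\<And>K s. s \<in> space N \<Longrightarrow> (\<lambda>j. urn_iter R K j (f (K + j)) s) \<longlonglongrightarrow> c"
  shows "(\<lambda>n. \<integral>\<omega>. ((\<integral>x. f n x \<partial>urn_law U n \<omega>) - c)\<^sup>2 \<partial>M) \<longlonglongrightarrow> 0"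
proof (rule LIMSEQ_I)
  interpret M: prob_space M by (rule prob_space_urn[OF urn R])
  fix e :: real assume e: "e > 0"
  \<comment> \<open>Splitting the square of a sum costs a factor 2, so
    \<open>2 * 4 * B\<^sup>2 / (K + 1)\<close> and twice the remaining term are each to be at most
    \<open>e / 2\<close>.\<close>
  obtain K :: nat where K: "16 * B\<^sup>2 / e < real K"
    using reals_Archimedean2 by blast
  have K8: "8 * B\<^sup>2 / real (K + 1) < e / 2"
    using K e by (simp add: field_simps)
  define W where "W j \<omega> = (\<integral>x. urn_iter R K j (f (K + j)) x \<partial>urn_law U K \<omega>)" for j \<omega>
  define X where "X n \<omega> = (\<integral>x. f n x \<partial>urn_law U n \<omega>)" for n \<omega>
  have bW: "bdd_measurable M B (W j)" for j
    unfolding W_def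
    by (rule bdd_measurable_subalgebra[OF subalgebra_urn[OF urn R]
          bdd_measurable_urn_law[OF urn R bdd_measurable_urn_iter[OF R f]]])
  have bX: "bdd_measurable M B (X n)" for n
    unfolding X_def
    by (rule bdd_measurable_subalgebra[OF subalgebra_urn[OF urn R] bdd_measurable_urn_law[OF urn R f]])
  have bc: "bdd_measurable M \<bar>c\<bar> (\<lambda>_. c)" by (simp add: bdd_measurable_def)
  note bWc = bdd_measurable_diff[OF bW bc] and bXc = bdd_measurable_diff[OF bX bc]
    and bXW = bdd_measurable_diff[OF bX bW]
  have "(\<lambda>j. \<integral>\<omega>. (W j \<omega> - c) * (W j \<omega> - c) \<partial>M) \<longlonglongrightarrow> (\<integral>\<omega>. (c - c) * (c - c) \<partial>M)"
  proof (rule M.integral_bdd_measurable_LIMSEQ[OF bdd_measurable_mult[OF bWc bWc]])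
    fix \<omega> assume \<omega>: "\<omega> \<in> space M"
    interpret p: prob_space "urn_law U K \<omega>"
      using prob_on_urn_law[OF urn R \<omega>] by (simp add: prob_on_def)
    have "(\<lambda>j. W j \<omega>) \<longlonglongrightarrow> (\<integral>x. c \<partial>urn_law U K \<omega>)"
      unfolding W_def
      by (rule integral_prob_on_LIMSEQ[OF prob_on_urn_law[OF urn R \<omega>] bdd_measurable_urn_iter[OF R f] lim])
    then have "(\<lambda>j. W j \<omega>) \<longlonglongrightarrow> c" by (simp add: p.prob_space)
    then show "(\<lambda>j. (W j \<omega> - c) * (W j \<omega> - c)) \<longlonglongrightarrow> (c - c) * (c - c)"
      by (intro tendsto_intros)
  qed
  then have "(\<lambda>j. \<integral>\<omega>. (W j \<omega> - c) * (W j \<omega> - c) \<partial>M) \<longlonglongrightarrow> 0" by simp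
  then have "eventually (\<lambda>j. (\<integral>\<omega>. (W j \<omega> - c) * (W j \<omega> - c) \<partial>M) < e / 4) sequentially"
    using e by (intro order_tendstoD(2)) auto
  then obtain J where J: "\<And>j. j \<ge> J \<Longrightarrow> (\<integral>\<omega>. (W j \<omega> - c) * (W j \<omega> - c) \<partial>M) < e / 4"
    by (auto simp: eventually_sequentially)
  show "\<exists>no. \<forall>n\<ge>no. norm ((\<integral>\<omega>. (X n \<omega> - c)\<^sup>2 \<partial>M) - 0) < e" unfolding X_def[symmetric]
  proof (intro exI allI impI)
    fix n assume "K + J \<le> n"
    then obtain j where n: "n = K + j" and j: "j \<ge> J"
      by (metis add.assoc le_add1 le_iff_add)
    have i1: "integrable M (\<lambda>\<omega>. (X n \<omega> - c) * (X n \<omega> - c))"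
      and i2: "integrable M (\<lambda>\<omega>. (X n \<omega> - W j \<omega>) * (X n \<omega> - W j \<omega>))"
      and i3: "integrable M (\<lambda>\<omega>. (W j \<omega> - c) * (W j \<omega> - c))"
      by (rule M.integrable_bdd_measurable[OF bdd_measurable_mult[OF bXc bXc]]
          M.integrable_bdd_measurable[OF bdd_measurable_mult[OF bXW bXW]]
          M.integrable_bdd_measurable[OF bdd_measurable_mult[OF bWc bWc]])+
    have "(\<integral>\<omega>. (X n \<omega> - c) * (X n \<omega> - c) \<partial>M) \<le>
        (\<integral>\<omega>. 2 * ((X n \<omega> - W j \<omega>) * (X n \<omega> - W j \<omega>)) + 2 * ((W j \<omega> - c) * (W j \<omega> - c)) \<partial>M)"
    proof (rule integral_mono[OF i1])
      show "integrable M (\<lambda>\<omega>. 2 * ((X n \<omega> - W j \<omega>) * (X n \<omega> - W j \<omega>)) + 2 * ((W j \<omega> - c) * (W j \<omega> - c)))"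
        using i2 i3 by simp
      fix \<omega>
      have "0 \<le> ((X n \<omega> - W j \<omega>) - (W j \<omega> - c))\<^sup>2" by simp
      then show "(X n \<omega> - c) * (X n \<omega> - c) \<le>
          2 * ((X n \<omega> - W j \<omega>) * (X n \<omega> - W j \<omega>)) + 2 * ((W j \<omega> - c) * (W j \<omega> - c))"
        by (simp add: power2_eq_square algebra_simps)
    qed
    also have "\<dots> = 2 * (\<integral>\<omega>. (X n \<omega> - W j \<omega>)\<^sup>2 \<partial>M) + 2 * (\<integral>\<omega>. (W j \<omega> - c) * (W j \<omega> - c) \<partial>M)"
      using i2 i3 by (simp add: power2_eq_square)
    also have "\<dots> < 2 * (4 * B\<^sup>2 * (1 / real (K + 1) - 1 / real (K + j + 1))) + 2 * (e / 4)"
      using urn_law_fluctuation[OF urn R f[of "K + j"], of K j] J[OF j]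
      unfolding X_def W_def n by (intro add_le_less_mono mult_left_mono mult_strict_left_mono) auto
    also have "\<dots> \<le> 8 * B\<^sup>2 / real (K + 1) + e / 2"
      by (simp add: right_diff_distrib)
    also have "\<dots> < e" using K8 by simp
    finally have "(\<integral>\<omega>. (X n \<omega> - c)\<^sup>2 \<partial>M) < e" by (simp add: power2_eq_square)
    moreover have "0 \<le> (\<integral>\<omega>. (X n \<omega> - c)\<^sup>2 \<partial>M)" by (rule integral_nonneg_AE) simp
    ultimately show "norm ((\<integral>\<omega>. (X n \<omega> - c)\<^sup>2 \<partial>M) - 0) < e" by simp
  qed
qed

section \<open>The chain observed at a random depth\<close>

text \<open>The index at which a chain is observed when its standardised depth is \<open>y\<close>.\<close>

lemma depth_index_asymp:
  fixes L y :: "nat \<Rightarrow> real"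
  assumes L: "filterlim L at_top sequentially" and y: "y \<longlonglongrightarrow> y0"
  defines "m \<equiv> \<lambda>j. nat (round (L j + sqrt (L j) * y j))"
  shows "(\<lambda>j. (real (m j) - L j) / sqrt (L j)) \<longlonglongrightarrow> y0"
    and "(\<lambda>j. real (m j) / L j) \<longlonglongrightarrow> 1"
    and "filterlim m at_top sequentially"
proof -
  have sqL: "filterlim (\<lambda>j. sqrt (L j)) at_top sequentially"
    by (rule filterlim_compose[OF sqrt_at_top L])
  have Lpos: "eventually (\<lambda>j. L j > 0) sequentially"
    using L filterlim_at_top_dense by blast
  \<comment> \<open>The product form makes the divergence visible: \<open>sqrt L * y\<close> is of
    lower order than \<open>L\<close>.\<close>
  have fac: "filterlim (\<lambda>j. sqrt (L j) * (sqrt (L j) + y j)) at_top sequentially"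
    by (rule filterlim_at_top_mult_at_top[OF sqL])
      (use filterlim_tendsto_add_at_top[OF y sqL] in \<open>simp add: add.commute\<close>)
  have arg: "filterlim (\<lambda>j. L j + sqrt (L j) * y j) at_top sequentially"
  proof (rule filterlim_cong[OF refl refl, THEN iffD1, OF _ fac])
    show "eventually (\<lambda>j. sqrt (L j) * (sqrt (L j) + y j) = L j + sqrt (L j) * y j) sequentially"
      using Lpos by eventually_elim (simp add: distrib_left)
  qed
  then have argpos: "eventually (\<lambda>j. L j + sqrt (L j) * y j > 0) sequentially"
    by (simp add: filterlim_at_top_dense)
  \<comment> \<open>Rounding moves the argument by at most 1/2, and \<open>nat\<close> does no harm
    once the argument is positive.\<close>
  have close: "\<bar>real (m j) - (L j + sqrt (L j) * y j)\<bar> \<le> 1 / 2" if "L j + sqrt (L j) * y j > 0" for j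
  proof -
    have "0 \<le> round (L j + sqrt (L j) * y j)"
      using that round_mono[of 0 "L j + sqrt (L j) * y j"] by simp
    then show ?thesis
      using of_int_round_abs_le[of "L j + sqrt (L j) * y j"] by (simp add: m_def)
  qed
  have small: "(\<lambda>j. (real (m j) - (L j + sqrt (L j) * y j)) / sqrt (L j)) \<longlonglongrightarrow> 0"
  proof (rule Lim_null_comparison)
    show "(\<lambda>j. (1 / 2) / sqrt (L j)) \<longlonglongrightarrow> 0"
      by (rule real_tendsto_divide_at_top[OF tendsto_const sqL])
    show "eventually (\<lambda>j. norm ((real (m j) - (L j + sqrt (L j) * y j)) / sqrt (L j)) \<le> (1 / 2) / sqrt (L j)) sequentially"
      using argpos Lpos
      by eventually_elim (use close in \<open>simp add: divide_right_mono del: divide_divide_eq_left\<close>)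
  qed
  have "(\<lambda>j. (real (m j) - (L j + sqrt (L j) * y j)) / sqrt (L j) + y j) \<longlonglongrightarrow> 0 + y0"
    by (intro tendsto_intros small y)
  moreover have "eventually (\<lambda>j. (real (m j) - (L j + sqrt (L j) * y j)) / sqrt (L j) + y j
      = (real (m j) - L j) / sqrt (L j)) sequentially"
    using Lpos by eventually_elim (simp add: field_simps)
  ultimately show 1: "(\<lambda>j. (real (m j) - L j) / sqrt (L j)) \<longlonglongrightarrow> y0"
    by (simp add: tendsto_cong)
  have "(\<lambda>j. (real (m j) - L j) / sqrt (L j) / sqrt (L j) + 1) \<longlonglongrightarrow> 0 + 1"
    by (intro tendsto_intros real_tendsto_divide_at_top[OF 1 sqL])
  moreover have "eventually (\<lambda>j. (real (m j) - L j) / sqrt (L j) / sqrt (L j) + 1 = real (m j) / L j) sequentially"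
    using Lpos by eventually_elim (simp add: field_simps)
  ultimately show "(\<lambda>j. real (m j) / L j) \<longlonglongrightarrow> 1"
    by (simp add: tendsto_cong)
  have "filterlim (\<lambda>j. real (m j)) at_top sequentially"
  proof (rule filterlim_at_top_mono)
    show "filterlim (\<lambda>j. - (1/2) + (L j + sqrt (L j) * y j)) at_top sequentially"
      by (rule filterlim_tendsto_add_at_top[OF tendsto_const arg])
    show "eventually (\<lambda>j. - (1/2) + (L j + sqrt (L j) * y j) \<le> real (m j)) sequentially"
      using argpos
    proof eventually_elim
      case (elim j)
      from close[OF this] show ?case by linarith
    qed
  qed
  then show "filterlim m at_top sequentially"
    by (simp add: filterlim_sequentially_iff_filterlim_real)
qed

lemma affine_shift_measurable:
  fixes S :: "'a::euclidean_space set"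
  shows "(\<lambda>x. (x - c *\<^sub>R v) /\<^sub>R d) \<in> borel_on S \<rightarrow>\<^sub>M borel"
  by (rule measurable_restrict_space1) measurable

text \<open>The limit of the mean: by the central limit theorem and Skorohod's representation, the chain
  is observed at depth \<open>L + sqrt L * y\<close>, where its rescaled law is an asymptotically vanishing
  perturbation of \<open>\<Lambda>\<close> shifted by \<open>\<kappa> * y\<close> along \<open>v\<close>.\<close>

lemma urn_iter_LIMSEQ:
  fixes S :: "'a::euclidean_space set" and f :: "'a \<Rightarrow> real"
  assumes R: "markov_kernel (borel_on S) (borel_on S) R"
    and \<Lambda>: "prob_on borel \<Lambda>"
    and chain: "\<And>\<mu> (\<Omega> :: (nat \<Rightarrow> 'a) measure) X.
      prob_on (borel_on S) \<mu> \<Longrightarrow> markov_chain \<Omega> (borel_on S) R \<mu> X \<Longrightarrow>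
      conv_in_distribution \<Omega> (\<lambda>n \<omega>. (X n \<omega> - a (real n) *\<^sub>R v) /\<^sub>R b (real n)) \<Lambda>"
    and b_pos: "eventually (\<lambda>x. b x > (0::real)) at_top"
    and ab: "\<And>L (m :: nat \<Rightarrow> nat) y. filterlim L at_top sequentially \<Longrightarrow> filterlim m at_top sequentially \<Longrightarrow>
      (\<lambda>j. real (m j) / L j) \<longlonglongrightarrow> 1 \<Longrightarrow> (\<lambda>j. (real (m j) - L j) / sqrt (L j)) \<longlonglongrightarrow> y \<Longrightarrow>
      (\<lambda>j. b (real (m j)) / b (L j)) \<longlonglongrightarrow> 1 \<and>
      (\<lambda>j. (a (real (m j)) - a (L j)) / b (L j)) \<longlonglongrightarrow> \<kappa> * y"
    and f: "continuous_on UNIV f" "bounded (range f)"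
    and s: "s \<in> S"
  shows "(\<lambda>j. urn_iter R K j (\<lambda>x. f ((x - a (ln (real (K + j))) *\<^sub>R v) /\<^sub>R b (ln (real (K + j))))) s)
    \<longlonglongrightarrow> (\<integral>y. (\<integral>x. f (x + (\<kappa> * y) *\<^sub>R v) \<partial>\<Lambda>) \<partial>std_normal_distribution)"
proof -
  let ?N = "borel_on S"
  have sN: "s \<in> space ?N" using s by (simp add: space_restrict_space)
  obtain B where B: "\<And>x. \<bar>f x\<bar> \<le> B" using f(2) by (auto simp: bounded_iff)
  have fm[measurable]: "f \<in> borel_measurable borel" by (rule borel_measurable_continuous_onI[OF f(1)])
  define L where "L j = ln (real (K + j))" for j
  have L: "filterlim L at_top sequentially" unfolding L_def by real_asymp
  have Lpos: "eventually (\<lambda>j. L j > 0) sequentially"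
    using L filterlim_at_top_dense by blast
  define F where "F j x = f ((x - a (L j) *\<^sub>R v) /\<^sub>R b (L j))" for j x
  have F: "bdd_measurable ?N B (F j)" for j
    using B measurable_compose[OF affine_shift_measurable[where c="a (L j)" and v=v and d="b (L j)"] fm]
    by (simp add: bdd_measurable_def F_def[abs_def])
  \<comment> \<open>The mean of the \<open>j\<close>-th test function after \<open>m\<close> steps
    from \<open>s\<close>. Depth \<open>m\<close> and index \<open>j\<close> are kept apart because
    the rescaling is made at \<open>L j\<close>, not at \<open>m\<close>.\<close>
  define g where "g j m = (kernel_op R ^^ m) (F j) s" for j m
  have p: "prob_on ?N (return ?N s)"
    using prob_space_return[OF sN] by (simp add: prob_on_def)
  obtain \<Omega> :: "(nat \<Rightarrow> 'a) measure" and X where X: "markov_chain \<Omega> ?N R (return ?N s) X"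
    using markov_chain_exists[OF R p] by blast
  have Xm: "X m \<in> \<Omega> \<rightarrow>\<^sub>M ?N" for m
    using X by (simp add: markov_chain_def)
  have \<Omega>: "prob_space \<Omega>"
    using X by (simp add: markov_chain_def)
  interpret \<Omega>: prob_space \<Omega> by (rule \<Omega>)
  have kb: "bdd_measurable ?N B ((kernel_op R ^^ m) (F j))" for m j
    by (induction m) (auto intro: F bdd_measurable_kernel_op[OF R])
  have g: "g j m = (\<integral>\<omega>. F j (X m \<omega>) \<partial>\<Omega>)" for j m
    unfolding markov_chain_expectation[OF R X F] g_def
    by (rule integral_return[OF sN bdd_measurable_measurable[OF kb], symmetric])
  have gB: "\<bar>g j m\<bar> \<le> B" for j m
    unfolding g_def by (rule bdd_measurable_abs_le[OF kb sN])
  define \<mu> where "\<mu> m = distr \<Omega> borel (\<lambda>\<omega>. (X m \<omega> - a (real m) *\<^sub>R v) /\<^sub>R b (real m))" for m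
  have Ym[measurable]: "(\<lambda>\<omega>. (X m \<omega> - c *\<^sub>R v) /\<^sub>R d) \<in> borel_measurable \<Omega>" for m c d
    by (rule measurable_compose[OF Xm affine_shift_measurable])
  have \<mu>: "prob_on borel (\<mu> m)" for m
    unfolding \<mu>_def prob_on_def using Ym by (auto intro!: \<Omega>.prob_space_distr)
  have weak: "(\<lambda>m. \<integral>x. h x \<partial>\<mu> m) \<longlonglongrightarrow> (\<integral>x. h x \<partial>\<Lambda>)"
    if h: "continuous_on UNIV h" "bounded (range h)" for h :: "'a \<Rightarrow> real"
  proof -
    have "(\<integral>x. h x \<partial>\<mu> m) = (\<integral>\<omega>. h ((X m \<omega> - a (real m) *\<^sub>R v) /\<^sub>R b (real m)) \<partial>\<Omega>)" for m
      unfolding \<mu>_def by (rule integral_distr[OF Ym borel_measurable_continuous_onI[OF h(1)]])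
    then show ?thesis
      using chain[OF p X] h by (simp add: conv_in_distribution_def)
  qed
  define G where "G w = (\<integral>x. f (x + w *\<^sub>R v) \<partial>\<Lambda>)" for w
  have g_lim: "(\<lambda>j. g j (m j)) \<longlonglongrightarrow> G (\<kappa> * y)"
    if m: "filterlim m at_top sequentially" and mL: "(\<lambda>j. real (m j) / L j) \<longlonglongrightarrow> 1"
      and my: "(\<lambda>j. (real (m j) - L j) / sqrt (L j)) \<longlonglongrightarrow> y" for m y
  proof -
    \<comment> \<open>Change of normalisation: the chain at time \<open>m j\<close>, rescaled at
      \<open>L j\<close>, is \<open>r j\<close> times its own rescaling at \<open>m j\<close>, plus
      \<open>w j\<close>.\<close>
    define r where "r j = b (real (m j)) / b (L j)" for j
    define w where "w j = ((a (real (m j)) - a (L j)) / b (L j)) *\<^sub>R v" for j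
    have r: "r \<longlonglongrightarrow> 1" and w: "w \<longlonglongrightarrow> (\<kappa> * y) *\<^sub>R v"
      using ab[OF L m mL my] unfolding r_def w_def by (auto intro!: tendsto_intros)
    have "(\<lambda>j. \<integral>x. f (r j *\<^sub>R x + w j) \<partial>\<mu> (m j)) \<longlonglongrightarrow> (\<integral>x. f (x + (\<kappa> * y) *\<^sub>R v) \<partial>\<Lambda>)"
      by (rule weak_limit_affine_perturbation[OF \<mu> \<Lambda> filterlim_compose[OF weak m] f r w])
    moreover have "eventually (\<lambda>j. (\<integral>x. f (r j *\<^sub>R x + w j) \<partial>\<mu> (m j)) = g j (m j)) sequentially"
    proof -
      have "eventually (\<lambda>j. b (L j) > 0) sequentially"
        using b_pos L by (rule eventually_compose_filterlim)
      moreover have "eventually (\<lambda>j. b (real (m j)) > 0) sequentially"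
        using b_pos filterlim_compose[OF filterlim_real_sequentially m] by (rule eventually_compose_filterlim)
      ultimately show ?thesis
      proof eventually_elim
        case (elim j)
        have "(\<integral>x. f (r j *\<^sub>R x + w j) \<partial>\<mu> (m j)) =
            (\<integral>\<omega>. f (r j *\<^sub>R ((X (m j) \<omega> - a (real (m j)) *\<^sub>R v) /\<^sub>R b (real (m j))) + w j) \<partial>\<Omega>)"
          unfolding \<mu>_def by (rule integral_distr[OF Ym]) measurable
        also have "\<dots> = (\<integral>\<omega>. F j (X (m j) \<omega>) \<partial>\<Omega>)"
        proof (intro Bochner_Integration.integral_cong refl)
          fix \<omega>
          have "r j *\<^sub>R ((X (m j) \<omega> - a (real (m j)) *\<^sub>R v) /\<^sub>R b (real (m j))) + w j =
              (X (m j) \<omega> - a (L j) *\<^sub>R v) /\<^sub>R b (L j)"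
            using elim by (simp add: r_def w_def divide_inverse scaleR_diff_right scaleR_diff_left
                left_diff_distrib algebra_simps)
          then show "f (r j *\<^sub>R ((X (m j) \<omega> - a (real (m j)) *\<^sub>R v) /\<^sub>R b (real (m j))) + w j) = F j (X (m j) \<omega>)"
            by (simp add: F_def)
        qed
        finally show ?case by (simp add: g)
      qed
    qed
    ultimately show ?thesis
      unfolding G_def by (simp add: tendsto_cong)
  qed
  \<comment> \<open>\<open>g_lim\<close> works along deterministic index sequences; each sample
    point of \<open>\<Omega>'\<close> supplies one.\<close>
  obtain \<Omega>' :: "real measure" and Yn Y where \<Omega>': "prob_space \<Omega>'"
    and Yn: "\<And>n. Yn n \<in> borel_measurable \<Omega>'" "\<And>n. distr \<Omega>' borel (Yn n) = urn_depth_std K n"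
    and Y: "Y \<in> \<Omega>' \<rightarrow>\<^sub>M lborel" "distr \<Omega>' borel Y = std_normal_distribution"
    and conv: "\<And>x. x \<in> space \<Omega>' \<Longrightarrow> (\<lambda>n. Yn n x) \<longlonglongrightarrow> Y x"
    using Skorohod[OF real_distribution_urn_depth_std real_dist_normal_dist urn_depth_clt, of K] by blast
  \<comment> \<open>Inverts the standardisation: once \<open>L j\<close> is positive, the value
    \<open>(k - L j) / sqrt (L j)\<close> of a depth \<open>k\<close> is sent back to
    \<open>k\<close> exactly. Rounding extends this measurably to the whole line.\<close>
  define m where "m j y = nat (round (L j + sqrt (L j) * y))" for j y
  have m_meas[measurable]: "m j \<in> borel \<rightarrow>\<^sub>M count_space UNIV" for j
    unfolding m_def[abs_def] round_def by measurable
  have gm_meas: "(\<lambda>y. g j (m j y)) \<in> borel_measurable borel" for j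
    by measurable
  have "(\<lambda>j. \<integral>\<omega>. g j (m j (Yn j \<omega>)) \<partial>\<Omega>') \<longlonglongrightarrow> (\<integral>\<omega>. G (\<kappa> * Y \<omega>) \<partial>\<Omega>')"
  proof (rule prob_space.integral_bdd_measurable_LIMSEQ[OF \<Omega>'])
    show "bdd_measurable \<Omega>' B (\<lambda>\<omega>. g j (m j (Yn j \<omega>)))" for j
      using gB measurable_compose[OF Yn(1) gm_meas] by (simp add: bdd_measurable_def)
    show "(\<lambda>j. g j (m j (Yn j \<omega>))) \<longlonglongrightarrow> G (\<kappa> * Y \<omega>)" if "\<omega> \<in> space \<Omega>'" for \<omega>
      unfolding m_def
      by (rule g_lim) (rule depth_index_asymp[OF L conv[OF that]])+
  qed
  moreover have "(\<integral>\<omega>. G (\<kappa> * Y \<omega>) \<partial>\<Omega>') = (\<integral>y. G (\<kappa> * y) \<partial>std_normal_distribution)"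
  proof -
    interpret \<Lambda>: prob_space \<Lambda> using \<Lambda> by (simp add: prob_on_def)
    have [measurable_cong]: "sets \<Lambda> = sets borel" using \<Lambda> by (simp add: prob_on_def)
    have "(\<lambda>y. G (\<kappa> * y)) \<in> borel_measurable borel"
      unfolding G_def by (rule \<Lambda>.borel_measurable_lebesgue_integral) measurable
    then show ?thesis
      unfolding Y(2)[symmetric] using Y(1) by (subst integral_distr) simp_all
  qed
  moreover have "eventually (\<lambda>j. (\<integral>\<omega>. g j (m j (Yn j \<omega>)) \<partial>\<Omega>') = urn_iter R K j (F j) s) sequentially"
    using Lpos
  proof eventually_elim
    case (elim j)
    have "(\<integral>\<omega>. g j (m j (Yn j \<omega>)) \<partial>\<Omega>') = (\<integral>y. g j (m j y) \<partial>urn_depth_std K j)"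
      unfolding Yn(2)[symmetric] by (rule integral_distr[OF Yn(1) gm_meas, symmetric])
    also have "\<dots> = measure_pmf.expectation (urn_depth K j) (\<lambda>k. g j (m j ((real k - L j) / sqrt (L j))))"
      unfolding urn_depth_std_def L_def[symmetric] by (rule integral_distr[OF _ gm_meas]) simp
    also have "\<dots> = measure_pmf.expectation (urn_depth K j) (\<lambda>k. g j k)"
      using elim by (simp add: m_def)
    also have "\<dots> = urn_iter R K j (F j) s"
      unfolding g_def by (rule urn_iter_eq_expectation[OF R sN F, symmetric])
    finally show ?case .
  qed
  ultimately show ?thesis
    unfolding G_def F_def[abs_def] L_def by (simp add: tendsto_cong)
qed

section \<open>Convolution with a normal law along a vector\<close>

lemma normal_along_eq_distr:
  fixes v :: "'a::euclidean_space"
  assumes "\<kappa> \<noteq> 0"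
  shows "normal_along \<bar>\<kappa>\<bar> v = distr std_normal_distribution borel (\<lambda>y. (\<kappa> * y) *\<^sub>R v)"
proof -
  interpret prob_space std_normal_distribution by (rule prob_space_normal_density) simp
  have "distributed std_normal_distribution lborel (\<lambda>x. x) std_normal_density"
    by (auto simp: distributed_def simp: emeasure_distr intro!: measure_eqI)
  from normal_density_affine[OF this _ assms, of 0]
  have "density lborel (\<lambda>x. ennreal (normal_density 0 \<bar>\<kappa>\<bar> x)) = distr std_normal_distribution lborel (\<lambda>y. \<kappa> * y)"
    by (simp add: distributed_def)
  also have "\<dots> = distr std_normal_distribution borel (\<lambda>y. \<kappa> * y)"
    by (rule distr_cong) simp_all
  finally have eq: "density lborel (\<lambda>x. ennreal (normal_density 0 \<bar>\<kappa>\<bar> x)) = \<dots>" .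
  show ?thesis
    unfolding normal_along_def eq by (subst distr_distr) (simp_all add: comp_def)
qed

text \<open>The iterated integral is the form in which the limit comes out of the central limit
  theorem; Fubini identifies it as a convolution. The law depends on \<open>\<kappa>\<close> through
  \<open>\<bar>\<kappa>\<bar>\<close> because the standard normal law is symmetric.\<close>

lemma
  fixes v :: "'a::ordered_euclidean_space"
  assumes \<Lambda>: "prob_on borel \<Lambda>" and \<kappa>: "\<kappa> \<noteq> 0"
  shows prob_on_convolution_normal: "prob_on borel (convolution \<Lambda> (normal_along \<bar>\<kappa>\<bar> v))"
    and integral_convolution_normal: "bdd_measurable borel B f \<Longrightarrow>
      (\<integral>x. f x \<partial>convolution \<Lambda> (normal_along \<bar>\<kappa>\<bar> v)) =
      (\<integral>y. (\<integral>x. f (x + (\<kappa> * y) *\<^sub>R v) \<partial>\<Lambda>) \<partial>std_normal_distribution)"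
proof -
  define \<nu> where "\<nu> = normal_along \<bar>\<kappa>\<bar> v"
  have \<nu>: "\<nu> = distr std_normal_distribution borel (\<lambda>y. (\<kappa> * y) *\<^sub>R v)"
    unfolding \<nu>_def by (rule normal_along_eq_distr[OF \<kappa>])
  interpret S: prob_space std_normal_distribution by (rule prob_space_normal_density) simp
  interpret \<Lambda>: prob_space \<Lambda> using \<Lambda> by (simp add: prob_on_def)
  interpret \<nu>: prob_space \<nu> unfolding \<nu> by (rule S.prob_space_distr) simp
  have [measurable_cong, simp]: "sets \<Lambda> = sets borel" using \<Lambda> by (simp add: prob_on_def)
  have [measurable_cong, simp]: "sets \<nu> = sets borel" by (simp add: \<nu>)
  interpret pair_prob_space \<Lambda> \<nu> ..
  have add: "(\<lambda>(x, y). x + y) \<in> \<Lambda> \<Otimes>\<^sub>M \<nu> \<rightarrow>\<^sub>M borel" by measurable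
  have "prob_space (convolution \<Lambda> \<nu>)"
    unfolding convolution_def by (rule prob_space_distr[OF add])
  then show "prob_on borel (convolution \<Lambda> (normal_along \<bar>\<kappa>\<bar> v))"
    by (simp add: prob_on_def \<nu>_def)
  assume f: "bdd_measurable borel B f"
  then have fm[measurable]: "f \<in> borel_measurable borel" and B: "\<And>x. \<bar>f x\<bar> \<le> B"
    by (auto simp: bdd_measurable_def)
  have int: "integrable (\<Lambda> \<Otimes>\<^sub>M \<nu>) (\<lambda>(x, y). f (x + y))"
    by (rule integrable_const_bound[of _ B]) (auto simp: B)
  have "(\<integral>x. f x \<partial>convolution \<Lambda> \<nu>) = (\<integral>z. (case z of (x, y) \<Rightarrow> f (x + y)) \<partial>(\<Lambda> \<Otimes>\<^sub>M \<nu>))"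
    unfolding convolution_def by (subst integral_distr[OF add fm]) (simp only: case_prod_unfold)
  also have "\<dots> = (\<integral>y. (\<integral>x. f (x + y) \<partial>\<Lambda>) \<partial>\<nu>)"
    using integral_snd[OF int] by simp
  also have "\<dots> = (\<integral>y. (\<integral>x. f (x + (\<kappa> * y) *\<^sub>R v) \<partial>\<Lambda>) \<partial>std_normal_distribution)"
  proof -
    have "(\<lambda>y. \<integral>x. f (x + y) \<partial>\<Lambda>) \<in> borel_measurable borel"
      by (rule \<Lambda>.borel_measurable_lebesgue_integral) measurable
    then show ?thesis unfolding \<nu> by (subst integral_distr) simp_all
  qed
  finally show "(\<integral>x. f x \<partial>convolution \<Lambda> (normal_along \<bar>\<kappa>\<bar> v)) =
      (\<integral>y. (\<integral>x. f (x + (\<kappa> * y) *\<^sub>R v) \<partial>\<Lambda>) \<partial>std_normal_distribution)"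
    by (simp add: \<nu>_def)
qed

section \<open>From test functions on the whole space to test functions on \<open>S\<close>\<close>

text \<open>Lipschitz minorants by inf-convolution, truncated at \<open>B\<close> to stay bounded off \<open>S\<close>.\<close>

lemma lipschitz_minorants:
  fixes f :: "'a::metric_space \<Rightarrow> real"
  assumes S: "S \<noteq> {}" and f: "continuous_on S f" and B: "\<And>x. x \<in> S \<Longrightarrow> \<bar>f x\<bar> \<le> B"
  obtains h :: "nat \<Rightarrow> 'a \<Rightarrow> real" where
    "\<And>k. continuous_on UNIV (h k)" "\<And>k x. \<bar>h k x\<bar> \<le> B"
    "\<And>k x. x \<in> S \<Longrightarrow> h k x \<le> f x" "\<And>x. x \<in> S \<Longrightarrow> (\<lambda>k. h k x) \<longlonglongrightarrow> f x"
proof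
  \<comment> \<open>Taking \<open>y = x\<close> bounds the infimum by \<open>f x\<close>, and each
    \<open>F k x y\<close> is Lipschitz in \<open>x\<close> with constant \<open>k\<close>, which
    the infimum inherits.\<close>
  define F where "F k x y = min B (f y + real k * dist x y)" for k x y
  define h where "h k x = (INF y\<in>S. F k x y)" for k x
  have B0: "0 \<le> B" using S B by fastforce
  have F_ge: "- B \<le> F k x y" if "y \<in> S" for k x y
  proof -
    have "- B \<le> f y" using B[OF that] by linarith
    moreover have "0 \<le> real k * dist x y" by simp
    ultimately show ?thesis using B0 unfolding F_def by linarith
  qed
  have bdd: "bdd_below (F k x ` S)" for k x
    using F_ge by (intro bdd_belowI2)
  have h_le: "h k x \<le> F k x y" if "y \<in> S" for k x y
    unfolding h_def by (rule cINF_lower[OF bdd that])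
  have h_ge: "c \<le> h k x" if "\<And>y. y \<in> S \<Longrightarrow> c \<le> F k x y" for c k x
    unfolding h_def by (rule cINF_greatest[OF S that])
  have lip: "h k x \<le> h k x' + real k * dist x x'" for k x x'
  proof -
    have "h k x - real k * dist x x' \<le> h k x'"
    proof (rule h_ge)
      fix y assume y: "y \<in> S"
      have lip_nonneg: "0 \<le> real k * dist x x'" by simp
      have "real k * dist x y \<le> real k * (dist x x' + dist x' y)"
        by (intro mult_left_mono dist_triangle) simp
      also have "\<dots> = real k * dist x x' + real k * dist x' y" by (rule distrib_left)
      finally have "F k x y \<le> F k x' y + real k * dist x x'"
        using lip_nonneg unfolding F_def by linarith
      with h_le[OF y, of k x] show "h k x - real k * dist x x' \<le> F k x' y" by linarith
    qed
    then show ?thesis by linarith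
  qed
  show "continuous_on UNIV (h k)" for k
  proof (rule lipschitz_on_continuous_on[where L="real k"], rule lipschitz_onI)
    show "dist (h k x) (h k x') \<le> real k * dist x x'" for x x'
      using lip[of k x x'] lip[of k x' x] by (simp add: dist_real_def dist_commute abs_le_iff)
  qed simp
  show "\<bar>h k x\<bar> \<le> B" for k x
  proof -
    obtain y where "y \<in> S" using S by blast
    then have "h k x \<le> B" using h_le[of y k x] by (simp add: F_def)
    moreover have "- B \<le> h k x" by (rule h_ge) (rule F_ge)
    ultimately show ?thesis by simp
  qed
  show le: "h k x \<le> f x" if "x \<in> S" for k x
    using h_le[OF that, of k x] by (simp add: F_def)
  show "(\<lambda>k. h k x) \<longlonglongrightarrow> f x" if x: "x \<in> S" for x
  proof (rule LIMSEQ_I)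
    fix e :: real assume e: "e > 0"
    obtain d where d: "d > 0" "\<And>y. y \<in> S \<Longrightarrow> dist y x < d \<Longrightarrow> dist (f y) (f x) < e / 2"
      using f x e unfolding continuous_on_iff by (metis half_gt_zero)
    \<comment> \<open>From this \<open>k\<close> on, points of \<open>S\<close> at distance at least
      \<open>d\<close> contribute the cap \<open>B\<close>, since \<open>f y \<ge> - B\<close> and
      the penalty is at least \<open>2 * B\<close>; the infimum is decided near
      \<open>x\<close>.\<close>
    obtain k0 :: nat where k0: "2 * B / d < real k0" using reals_Archimedean2 by blast
    have "norm (h k x - f x) < e" if k: "k \<ge> k0" for k
    proof -
      have "f x - e / 2 \<le> h k x"
      proof (rule h_ge)
        fix y assume y: "y \<in> S"
        show "f x - e / 2 \<le> F k x y"
        proof (cases "dist y x < d")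
          case True
          then have "f x - e / 2 \<le> f y" using d(2)[OF y] unfolding dist_real_def by linarith
          moreover have "0 \<le> real k * dist x y" by simp
          moreover have "f x - e / 2 \<le> B" using B[OF x] e by linarith
          ultimately show ?thesis unfolding F_def by linarith
        next
          case False
          have "2 * B \<le> real k0 * d" using k0 d(1) by (simp add: field_simps)
          also have "\<dots> \<le> real k * dist x y"
            using False k d(1) by (intro mult_mono) (auto simp: dist_commute)
          finally show ?thesis using B[OF y] B[OF x] e unfolding F_def by linarith
        qed
      qed
      with le[OF x, of k] e show ?thesis by simp
    qed
    then show "\<exists>no. \<forall>n\<ge>no. norm (h n x - f x) < e" by blast
  qed
qed

lemma (in prob_space) conv_in_prob_AE_transfer:
  fixes V W :: "nat \<Rightarrow> 'a \<Rightarrow> real"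
  assumes meas: "\<And>n. n \<ge> 1 \<Longrightarrow> V n \<in> borel_measurable M" "\<And>n. n \<ge> 1 \<Longrightarrow> W n \<in> borel_measurable M"
    and eq: "\<And>n. n \<ge> 1 \<Longrightarrow> AE \<omega> in M. V n \<omega> = W n \<omega>"
    and lim: "(\<lambda>n. measure M {\<omega>\<in>space M. \<bar>W n \<omega> - c\<bar> \<ge> e}) \<longlonglongrightarrow> 0"
  shows "(\<lambda>n. measure M {\<omega>\<in>space M. \<bar>V n \<omega> - c\<bar> \<ge> e}) \<longlonglongrightarrow> 0"
proof (rule Lim_transform_eventually[OF lim])
  show "eventually (\<lambda>n. measure M {\<omega>\<in>space M. \<bar>W n \<omega> - c\<bar> \<ge> e} = measure M {\<omega>\<in>space M. \<bar>V n \<omega> - c\<bar> \<ge> e}) sequentially"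
    using eventually_ge_at_top[of 1]
  proof eventually_elim
    case (elim n)
    note [measurable] = meas[OF elim]
    show ?case
      by (rule finite_measure_eq_AE) (use eq[OF elim] in auto)
  qed
qed

lemma prob_on_restrict_space:
  assumes \<Lambda>: "prob_on borel \<Lambda>" and S: "emeasure \<Lambda> S = 1"
  shows "prob_on (borel_on S) (restrict_space \<Lambda> S)"
proof -
  \<comment> \<open>A set outside the sigma-algebra has \<open>emeasure\<close> 0, so mass 1 forces
    \<open>S\<close> to be measurable.\<close>
  have "S \<in> sets \<Lambda>" using S emeasure_notin_sets[of S \<Lambda>] by force
  then have "emeasure (restrict_space \<Lambda> S) (space (restrict_space \<Lambda> S)) = 1"
    using S sets.sets_into_space[of S \<Lambda>] by (simp add: emeasure_restrict_space space_restrict_space Int_absorb2)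
  then show ?thesis
    using \<Lambda> by (auto simp: prob_on_def sets_restrict_space intro: prob_spaceI)
qed

lemma integral_restrict_space_full:
  fixes h :: "'a::topological_space \<Rightarrow> real"
  assumes \<Lambda>: "prob_on borel \<Lambda>" and S: "emeasure \<Lambda> S = 1" and h: "h \<in> borel_measurable borel"
  shows "(\<integral>x. h x \<partial>restrict_space \<Lambda> S) = (\<integral>x. h x \<partial>\<Lambda>)"
proof -
  interpret prob_space \<Lambda> using \<Lambda> by (simp add: prob_on_def)
  have sets[simp]: "sets \<Lambda> = sets borel" using \<Lambda> by (simp add: prob_on_def)
  have S\<Lambda>[measurable]: "S \<in> sets \<Lambda>" using S emeasure_notin_sets[of S \<Lambda>] by force
  have h\<Lambda>[measurable]: "h \<in> borel_measurable \<Lambda>" using h by (simp cong: measurable_cong_sets)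
  have "(\<integral>x. h x \<partial>restrict_space \<Lambda> S) = (\<integral>x. indicator S x * h x \<partial>\<Lambda>)"
    using S\<Lambda> sets.sets_into_space[OF S\<Lambda>]
    by (simp add: integral_restrict_space Int_absorb1 set_lebesgue_integral_def)
  also have "\<dots> = (\<integral>x. h x \<partial>\<Lambda>)"
  proof (rule integral_cong_AE)
    have "AE x in \<Lambda>. x \<in> S"
      using S S\<Lambda> by (intro AE_prob_1) (simp add: measure_def)
    then show "AE x in \<Lambda>. indicator S x * h x = h x" by eventually_elim simp
  qed measurable
  finally show ?thesis .
qed

text \<open>A function that is only continuous on \<open>S\<close> is approximated from below and above by Lipschitz
  functions on the whole space.\<close>

lemma conv_in_prob_restrict_space:
  fixes P :: "nat \<Rightarrow> 'w \<Rightarrow> 'a::metric_space measure" and f :: "'a \<Rightarrow> real"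
  assumes M: "prob_space M" and \<Lambda>: "prob_on borel \<Lambda>" and S: "S \<noteq> {}" "emeasure \<Lambda> S = 1"
    and P: "\<And>n. markov_kernel M (borel_on S) (P n)"
    and lim: "\<And>(g :: 'a \<Rightarrow> real) e. continuous_on UNIV g \<Longrightarrow> bounded (range g) \<Longrightarrow> e > 0 \<Longrightarrow>
      (\<lambda>n. measure M {\<omega>\<in>space M. \<bar>(\<integral>x. g x \<partial>P n \<omega>) - (\<integral>x. g x \<partial>\<Lambda>)\<bar> \<ge> e}) \<longlonglongrightarrow> 0"
    and f: "continuous_on S f" "bounded (f ` S)" and e: "e > 0"
  shows "(\<lambda>n. measure M {\<omega>\<in>space M. \<bar>(\<integral>x. f x \<partial>P n \<omega>) - (\<integral>x. f x \<partial>restrict_space \<Lambda> S)\<bar> \<ge> e}) \<longlonglongrightarrow> 0"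
proof -
  interpret prob_space M by fact
  let ?\<Lambda> = "restrict_space \<Lambda> S"
  have P': "prob_on (borel_on S) (P n \<omega>)" if "\<omega> \<in> space M" for n \<omega>
    using P that by (simp add: markov_kernel_def)
  have \<Lambda>S: "prob_on (borel_on S) ?\<Lambda>" by (rule prob_on_restrict_space[OF \<Lambda> S(2)])
  have sp: "space (borel_on S) = S" by (simp add: space_restrict_space)
  have meas: "(\<lambda>\<omega>. \<integral>x. g x \<partial>P n \<omega>) \<in> borel_measurable M" if "bdd_measurable (borel_on S) B g" for g B n
    using bdd_measurable_kernel_integral[OF P that] by (rule bdd_measurable_measurable)
  \<comment> \<open>Minorants control downward deviations: if the integral of \<open>g\<close> lies
    \<open>e\<close> below its limit, then that of \<open>h k\<close> lies at least
    \<open>e / 2\<close> below its own, once \<open>h k\<close> is close to \<open>g\<close> in mean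
    under the limit law. Upward deviations of \<open>f\<close> are downward deviations of
    \<open>- f\<close>.\<close>
  have one_sided: "(\<lambda>n. measure M {\<omega>\<in>space M. (\<integral>x. g x \<partial>P n \<omega>) \<le> (\<integral>x. g x \<partial>?\<Lambda>) - e}) \<longlonglongrightarrow> 0"
    if g: "continuous_on S g" and B: "\<And>x. x \<in> S \<Longrightarrow> \<bar>g x\<bar> \<le> B" for g :: "'a \<Rightarrow> real" and B
  proof -
    have gb: "bdd_measurable (borel_on S) B g"
      using borel_measurable_continuous_on_restrict[OF g] B by (simp add: bdd_measurable_def sp)
    obtain h :: "nat \<Rightarrow> 'a \<Rightarrow> real" where h: "\<And>k. continuous_on UNIV (h k)" "\<And>k x. \<bar>h k x\<bar> \<le> B"
      "\<And>k x. x \<in> S \<Longrightarrow> h k x \<le> g x" "\<And>x. x \<in> S \<Longrightarrow> (\<lambda>k. h k x) \<longlonglongrightarrow> g x"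
      using lipschitz_minorants[OF S(1) g B] by metis
    have hm: "h k \<in> borel_measurable borel" for k
      by (rule borel_measurable_continuous_onI[OF h(1)])
    have hb: "bdd_measurable (borel_on S) B (h k)" for k
      using measurable_restrict_space1[OF hm] h(2) by (simp add: bdd_measurable_def)
    have "(\<lambda>k. \<integral>x. h k x \<partial>?\<Lambda>) \<longlonglongrightarrow> (\<integral>x. g x \<partial>?\<Lambda>)"
      by (rule integral_prob_on_LIMSEQ[OF \<Lambda>S hb]) (simp add: sp h(4))
    then have "eventually (\<lambda>k. (\<integral>x. h k x \<partial>?\<Lambda>) > (\<integral>x. g x \<partial>?\<Lambda>) - e / 2) sequentially"
      using e by (intro order_tendstoD(1)) auto
    then obtain k where "(\<integral>x. h k x \<partial>?\<Lambda>) > (\<integral>x. g x \<partial>?\<Lambda>) - e / 2"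
      by (auto dest: eventually_happens)
    then have k: "(\<integral>x. h k x \<partial>\<Lambda>) > (\<integral>x. g x \<partial>?\<Lambda>) - e / 2"
      by (simp add: integral_restrict_space_full[OF \<Lambda> S(2) hm])
    show ?thesis
    proof (rule tendsto_sandwich[OF _ _ tendsto_const])
      show "(\<lambda>n. measure M {\<omega>\<in>space M. \<bar>(\<integral>x. h k x \<partial>P n \<omega>) - (\<integral>x. h k x \<partial>\<Lambda>)\<bar> \<ge> e / 2}) \<longlonglongrightarrow> 0"
        using h(1,2) e by (intro lim) (auto simp: bounded_iff)
      show "eventually (\<lambda>n. measure M {\<omega>\<in>space M. (\<integral>x. g x \<partial>P n \<omega>) \<le> (\<integral>x. g x \<partial>?\<Lambda>) - e} \<le>
          measure M {\<omega>\<in>space M. \<bar>(\<integral>x. h k x \<partial>P n \<omega>) - (\<integral>x. h k x \<partial>\<Lambda>)\<bar> \<ge> e / 2}) sequentially"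
      proof (intro always_eventually allI finite_measure_mono)
        fix n
        note [measurable] = meas[OF hb[of k], of n]
        show "{\<omega>\<in>space M. \<bar>(\<integral>x. h k x \<partial>P n \<omega>) - (\<integral>x. h k x \<partial>\<Lambda>)\<bar> \<ge> e / 2} \<in> sets M"
          by measurable
        show "{\<omega>\<in>space M. (\<integral>x. g x \<partial>P n \<omega>) \<le> (\<integral>x. g x \<partial>?\<Lambda>) - e} \<subseteq>
            {\<omega>\<in>space M. \<bar>(\<integral>x. h k x \<partial>P n \<omega>) - (\<integral>x. h k x \<partial>\<Lambda>)\<bar> \<ge> e / 2}"
        proof safe
          fix \<omega> assume \<omega>: "\<omega> \<in> space M" and le: "(\<integral>x. g x \<partial>P n \<omega>) \<le> (\<integral>x. g x \<partial>?\<Lambda>) - e"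
          have "(\<integral>x. h k x \<partial>P n \<omega>) \<le> (\<integral>x. g x \<partial>P n \<omega>)"
            using h(3) prob_on_space[OF P'[OF \<omega>]] sp
            by (intro integral_mono integrable_prob_on[OF P'[OF \<omega>] hb] integrable_prob_on[OF P'[OF \<omega>] gb]) simp
          with le k e show "e / 2 \<le> \<bar>(\<integral>x. h k x \<partial>P n \<omega>) - (\<integral>x. h k x \<partial>\<Lambda>)\<bar>" by linarith
        qed
      qed
    qed simp
  qed
  obtain B where B: "\<And>x. x \<in> S \<Longrightarrow> \<bar>f x\<bar> \<le> B" using f(2) by (auto simp: bounded_iff)
  have fb: "bdd_measurable (borel_on S) B f"
    using borel_measurable_continuous_on_restrict[OF f(1)] B by (simp add: bdd_measurable_def sp)
  let ?lo = "\<lambda>n. {\<omega>\<in>space M. (\<integral>x. f x \<partial>P n \<omega>) \<le> (\<integral>x. f x \<partial>?\<Lambda>) - e}"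
  let ?hi = "\<lambda>n. {\<omega>\<in>space M. (\<integral>x. - f x \<partial>P n \<omega>) \<le> (\<integral>x. - f x \<partial>?\<Lambda>) - e}"
  show ?thesis
  proof (rule tendsto_sandwich[OF _ _ tendsto_const])
    have "(\<lambda>n. measure M (?lo n)) \<longlonglongrightarrow> 0" by (rule one_sided[OF f(1) B])
    moreover have "(\<lambda>n. measure M (?hi n)) \<longlonglongrightarrow> 0"
      by (rule one_sided[of "\<lambda>x. - f x" B]) (auto intro: continuous_on_minus f(1) B)
    ultimately show "(\<lambda>n. measure M (?lo n) + measure M (?hi n)) \<longlonglongrightarrow> 0"
      using tendsto_add by fastforce
    show "eventually (\<lambda>n. measure M {\<omega>\<in>space M. \<bar>(\<integral>x. f x \<partial>P n \<omega>) - (\<integral>x. f x \<partial>?\<Lambda>)\<bar> \<ge> e}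
        \<le> measure M (?lo n) + measure M (?hi n)) sequentially"
    proof (intro always_eventually allI)
      fix n
      note [measurable] = meas[OF fb, of n]
      have "{\<omega>\<in>space M. \<bar>(\<integral>x. f x \<partial>P n \<omega>) - (\<integral>x. f x \<partial>?\<Lambda>)\<bar> \<ge> e} = ?lo n \<union> ?hi n"
        by (auto simp: abs_if)
      also have "measure M \<dots> \<le> measure M (?lo n) + measure M (?hi n)"
        by (rule measure_Un_le) (simp_all, measurable)
      finally show "measure M {\<omega>\<in>space M. \<bar>(\<integral>x. f x \<partial>P n \<omega>) - (\<integral>x. f x \<partial>?\<Lambda>)\<bar> \<ge> e}
        \<le> measure M (?lo n) + measure M (?hi n)" .
    qed
  qed simp
qed

lemma regularly_varying_eventually_pos: "regularly_varying b \<Longrightarrow> eventually (\<lambda>x. b x > 0) at_top"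
  unfolding regularly_varying_def by (auto intro: eventually_at_top_linorderI)

text \<open>By the mean value theorem the quotient is
  \<open>deriv a \<xi> * (sqrt L / b L) * ((m - L) / sqrt L)\<close> with an intermediate point
  \<open>\<xi>\<close>, and each factor has a limit.\<close>

lemma centering_increment_LIMSEQ:
  fixes L m :: "nat \<Rightarrow> real"
  assumes a: "\<And>x. x > 0 \<Longrightarrow> a differentiable (at x)" and a': "(deriv a \<longlongrightarrow> a') at_top"
    and b': "((\<lambda>x. sqrt x / b x) \<longlongrightarrow> b') at_top"
    and L: "filterlim L at_top sequentially" and m: "filterlim m at_top sequentially"
    and y: "(\<lambda>j. (m j - L j) / sqrt (L j)) \<longlonglongrightarrow> y"
  shows "(\<lambda>j. (a (m j) - a (L j)) / b (L j)) \<longlonglongrightarrow> a' * b' * y"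
proof -
  \<comment> \<open>Only the lower bound on the intermediate point is kept, as it forces
    \<open>\<xi>\<close> to infinity. The order of \<open>p\<close> and \<open>q\<close> is left
    open, since the depth may fall on either side of \<open>L\<close>.\<close>
  have mvt: "\<exists>\<xi>. min p q \<le> \<xi> \<and> a p - a q = deriv a \<xi> * (p - q)" if "p > 0" "q > 0" for p q :: real
  proof -
    have d: "DERIV a x :> deriv a x" if "x > 0" for x
      using a[OF that] by (simp add: DERIV_deriv_iff_real_differentiable)
    have *: "\<exists>\<xi>. p \<le> \<xi> \<and> a q - a p = deriv a \<xi> * (q - p)" if pos: "p > 0" and lt: "p < q" for p q :: real
    proof -
      obtain z where "p < z" "a q - a p = (q - p) * deriv a z"
        using MVT2[OF lt, of a "deriv a"] d pos by (meson less_le_trans)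
      then show ?thesis by (intro exI[of _ z]) (simp add: mult.commute)
    qed
    consider "p < q" | "p = q" | "q < p" by linarith
    then show ?thesis
    proof cases
      case 1
      with *[OF \<open>p > 0\<close> 1] show ?thesis by (auto simp: min_def algebra_simps)
    next
      case 2 then show ?thesis by auto
    next
      case 3
      with *[OF \<open>q > 0\<close> 3] show ?thesis by (auto simp: min_def)
    qed
  qed
  then obtain \<xi> where \<xi>: "\<And>p q. p > 0 \<Longrightarrow> q > 0 \<Longrightarrow> min p q \<le> \<xi> p q \<and> a p - a q = deriv a (\<xi> p q) * (p - q)"
    by metis
  have Lpos: "eventually (\<lambda>j. L j > 0) sequentially" and mpos: "eventually (\<lambda>j. m j > 0) sequentially"
    using L m by (simp_all add: filterlim_at_top_dense)
  have "filterlim (\<lambda>j. \<xi> (m j) (L j)) at_top sequentially"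
    unfolding filterlim_at_top
  proof
    fix C
    have "eventually (\<lambda>j. m j \<ge> C) sequentially" "eventually (\<lambda>j. L j \<ge> C) sequentially"
      using L m by (simp_all add: filterlim_at_top)
    then show "eventually (\<lambda>j. C \<le> \<xi> (m j) (L j)) sequentially"
      using Lpos mpos
    proof eventually_elim
      case (elim j)
      with \<xi>[of "m j" "L j"] show ?case by linarith
    qed
  qed
  from filterlim_compose[OF a' this]
  have "(\<lambda>j. deriv a (\<xi> (m j) (L j)) * (sqrt (L j) / b (L j)) * ((m j - L j) / sqrt (L j))) \<longlonglongrightarrow> a' * b' * y"
    by (intro tendsto_mult filterlim_compose[OF b' L] y)
  moreover have "eventually (\<lambda>j. deriv a (\<xi> (m j) (L j)) * (sqrt (L j) / b (L j)) * ((m j - L j) / sqrt (L j))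
      = (a (m j) - a (L j)) / b (L j)) sequentially"
    using Lpos mpos
  proof eventually_elim
    case (elim j)
    with \<xi>[of "m j" "L j"] show ?case by simp
  qed
  ultimately show ?thesis by (simp add: tendsto_cong)
qed

section \<open>Assembly of the three cases\<close>

context
  fixes S :: "(real ^ 'd) set"
    and R :: "real ^ 'd \<Rightarrow> (real ^ 'd) measure"
    and U\<^sub>0 \<Lambda> :: "(real ^ 'd) measure"
    and M :: "'w measure"
    and U :: "nat \<Rightarrow> 'w \<Rightarrow> (real ^ 'd) measure"
    and Z :: "nat \<Rightarrow> 'w \<Rightarrow> real ^ 'd"
    and v :: "real ^ 'd"
    and a b :: "real \<Rightarrow> real" and \<kappa> :: real
  assumes R: "markov_kernel (borel_on S) (borel_on S) R"
    and urn: "urn_model M (borel_on S) R U\<^sub>0 U Z"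
    and \<Lambda>: "prob_on borel \<Lambda>"
    and chain: "\<And>\<mu> (\<Omega> :: (nat \<Rightarrow> real ^ 'd) measure) X.
      prob_on (borel_on S) \<mu> \<Longrightarrow> markov_chain \<Omega> (borel_on S) R \<mu> X \<Longrightarrow>
      conv_in_distribution \<Omega> (\<lambda>n \<omega>. (X n \<omega> - a (real n) *\<^sub>R v) /\<^sub>R b (real n)) \<Lambda>"
    and b_pos: "eventually (\<lambda>x. b x > (0::real)) at_top"
    and ab: "\<And>L (m :: nat \<Rightarrow> nat) y. filterlim L at_top sequentially \<Longrightarrow> filterlim m at_top sequentially \<Longrightarrow>
      (\<lambda>j. real (m j) / L j) \<longlonglongrightarrow> 1 \<Longrightarrow> (\<lambda>j. (real (m j) - L j) / sqrt (L j)) \<longlonglongrightarrow> y \<Longrightarrow>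
      (\<lambda>j. b (real (m j)) / b (L j)) \<longlonglongrightarrow> 1 \<and>
      (\<lambda>j. (a (real (m j)) - a (L j)) / b (L j)) \<longlonglongrightarrow> \<kappa> * y"
begin

text \<open>The parameter \<open>\<kappa>\<close> lets one argument serve all cases: it is 0 without
  drift and \<open>a' * b'\<close> otherwise. Any version \<open>Pcs n\<close> has almost surely the
  same integrals as the rescaled urn law, for which the mean square limit is available.\<close>

lemma urn_cond_distr_conv_in_prob:
  fixes f :: "real ^ 'd \<Rightarrow> real"
  assumes Pcs: "\<And>n. n \<ge> 1 \<Longrightarrow> regular_cond_distr M (past M (borel_on S) Z n) borel
      (\<lambda>\<omega>. (Z n \<omega> - a (ln (real n)) *\<^sub>R v) /\<^sub>R b (ln (real n))) (Pcs n)"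
    and f: "continuous_on UNIV f" "bounded (range f)" and e: "e > 0"
  shows "(\<lambda>n. measure M {\<omega>\<in>space M. \<bar>(\<integral>x. f x \<partial>Pcs n \<omega>) -
    (\<integral>y. (\<integral>x. f (x + (\<kappa> * y) *\<^sub>R v) \<partial>\<Lambda>) \<partial>std_normal_distribution)\<bar> \<ge> e}) \<longlonglongrightarrow> 0"
proof -
  let ?N = "borel_on S"
  interpret M: prob_space M by (rule prob_space_urn[OF urn R])
  define g where "g n x = (x - a (ln (real n)) *\<^sub>R v) /\<^sub>R b (ln (real n))" for n :: nat and x
  have g: "g n \<in> ?N \<rightarrow>\<^sub>M borel" for n
    unfolding g_def[abs_def] by (rule affine_shift_measurable)
  obtain B where B: "\<And>x. \<bar>f x\<bar> \<le> B" using f(2) by (auto simp: bounded_iff)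
  have fm: "f \<in> borel_measurable borel" by (rule borel_measurable_continuous_onI[OF f(1)])
  have fb: "bdd_measurable borel B f" using fm B by (simp add: bdd_measurable_def)
  have fg: "bdd_measurable ?N B (\<lambda>x. f (g n x))" for n
    by (rule bdd_measurable_comp[OF fb g])
  define W where "W n \<omega> = (\<integral>x. f (g n x) \<partial>urn_law U n \<omega>)" for n \<omega>
  have W: "bdd_measurable M B (W n)" for n
    unfolding W_def
    by (rule bdd_measurable_subalgebra[OF subalgebra_urn[OF urn R] bdd_measurable_urn_law[OF urn R fg]])
  have V: "(\<lambda>\<omega>. \<integral>x. f x \<partial>Pcs n \<omega>) \<in> borel_measurable M" if "n \<ge> 1" for n
  proof -
    have "markov_kernel (past M ?N Z n) borel (Pcs n)"
      using Pcs[OF that] by (simp add: regular_cond_distr_def)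
    from bdd_measurable_subalgebra[OF subalgebra_urn[OF urn R] bdd_measurable_kernel_integral[OF this fb]]
    show ?thesis by (rule bdd_measurable_measurable)
  qed
  have VW: "AE \<omega> in M. (\<integral>x. f x \<partial>Pcs n \<omega>) = W n \<omega>" if "n \<ge> 1" for n
  proof -
    have "regular_cond_distr M (past M ?N Z n) borel (\<lambda>\<omega>. g n (Z n \<omega>)) (\<lambda>\<omega>. distr (urn_law U n \<omega>) borel (g n))"
      by (rule regular_cond_distr_distr[OF subalgebra_urn[OF urn R] measurable_urn_draw[OF urn R]
            urn_law_cond_distr[OF urn R] g])
    from regular_cond_distr_integral_unique[OF subalgebra_urn[OF urn R] Pcs[OF that, folded g_def] this fb]
    show ?thesis
      using AE_space
    proof eventually_elim
      case (elim \<omega>)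
      have "g n \<in> urn_law U n \<omega> \<rightarrow>\<^sub>M borel"
        using g prob_on_urn_law[OF urn R elim(2), of n] by (simp add: prob_on_def cong: measurable_cong_sets)
      from integral_distr[OF this fm] elim(1) show ?case by (simp add: W_def)
    qed
  qed
  have "(\<lambda>n. \<integral>\<omega>. (W n \<omega> - (\<integral>y. (\<integral>x. f (x + (\<kappa> * y) *\<^sub>R v) \<partial>\<Lambda>) \<partial>std_normal_distribution))\<^sup>2 \<partial>M) \<longlonglongrightarrow> 0"
    unfolding W_def
  proof (rule urn_law_L2_limit[OF urn R fg])
    fix K s assume "s \<in> space ?N"
    then have "s \<in> S" by (simp add: space_restrict_space)
    have "(\<lambda>j. urn_iter R K j (\<lambda>x. f ((x - a (ln (real (K + j))) *\<^sub>R v) /\<^sub>R b (ln (real (K + j))))) s) \<longlonglongrightarrow>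
        (\<integral>y. (\<integral>x. f (x + (\<kappa> * y) *\<^sub>R v) \<partial>\<Lambda>) \<partial>std_normal_distribution)"
      by (rule urn_iter_LIMSEQ[OF R \<Lambda> _ b_pos _ f \<open>s \<in> S\<close>]) ((rule chain ab; assumption)+)
    then show "(\<lambda>j. urn_iter R K j (\<lambda>x. f (g (K + j) x)) s) \<longlonglongrightarrow>
        (\<integral>y. (\<integral>x. f (x + (\<kappa> * y) *\<^sub>R v) \<partial>\<Lambda>) \<partial>std_normal_distribution)"
      by (simp add: g_def)
  qed
  from M.L2_imp_conv_in_prob[OF W this e]
  show ?thesis
    using V W by (intro M.conv_in_prob_AE_transfer[OF _ _ VW]) (auto intro: bdd_measurable_measurable)
qed

text \<open>For \<open>\<kappa> = 0\<close> the limit has to be stated as \<open>\<Lambda>\<close>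
  itself, because \<open>normal_along 0 v\<close> is not a probability law.\<close>

lemma urn_cond_distr_weak_limit:
  assumes Pcs: "\<And>n. n \<ge> 1 \<Longrightarrow> regular_cond_distr M (past M (borel_on S) Z n) borel
      (\<lambda>\<omega>. (Z n \<omega> - a (ln (real n)) *\<^sub>R v) /\<^sub>R b (ln (real n))) (Pcs n)"
  shows "conv_in_prob M (weak_topology UNIV) Pcs
    (if \<kappa> = 0 then \<Lambda> else convolution \<Lambda> (normal_along \<bar>\<kappa>\<bar> v))" (is "conv_in_prob M _ Pcs ?\<Xi>")
proof (rule conv_in_prob_weak_topology)
  show "prob_space M" by (rule prob_space_urn[OF urn R])
  show "prob_on (borel_on UNIV) ?\<Xi>"
    using \<Lambda> prob_on_convolution_normal[OF \<Lambda>] by (simp add: prob_on_def sets_restrict_space)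
  have kern: "markov_kernel (past M (borel_on S) Z n) borel (Pcs n)" if "n \<ge> 1" for n
    using Pcs[OF that] by (simp add: regular_cond_distr_def)
  show "prob_on (borel_on UNIV) (Pcs n \<omega>)" if "n \<ge> 1" "\<omega> \<in> space M" for n \<omega>
    using kern[OF that(1)] that(2) space_urn_past[OF urn R, of n]
    by (simp add: markov_kernel_def prob_on_def sets_restrict_space)
  fix f :: "real ^ 'd \<Rightarrow> real" assume f: "continuous_on UNIV f" "bounded (range f)"
  obtain B where B: "\<And>x. \<bar>f x\<bar> \<le> B" using f(2) by (auto simp: bounded_iff)
  have fb: "bdd_measurable borel B f"
    using borel_measurable_continuous_onI[OF f(1)] B by (simp add: bdd_measurable_def)
  show "(\<lambda>\<omega>. \<integral>x. f x \<partial>Pcs n \<omega>) \<in> borel_measurable M" if "n \<ge> 1" for n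
    using bdd_measurable_subalgebra[OF subalgebra_urn[OF urn R] bdd_measurable_kernel_integral[OF kern[OF that] fb]]
    by (rule bdd_measurable_measurable)
  interpret N: prob_space std_normal_distribution by (rule prob_space_normal_density) simp
  have "(\<integral>x. f x \<partial>?\<Xi>) = (\<integral>y. (\<integral>x. f (x + (\<kappa> * y) *\<^sub>R v) \<partial>\<Lambda>) \<partial>std_normal_distribution)"
  proof (cases "\<kappa> = 0")
    case True
    have "(\<integral>x. f x \<partial>\<Lambda>) = (\<integral>y. (\<integral>x. f x \<partial>\<Lambda>) \<partial>std_normal_distribution)"
      using N.prob_space by (simp del: integral_density)
    with True show ?thesis by simp
  next
    case False
    then show ?thesis using integral_convolution_normal[OF \<Lambda> False fb] by simp
  qed
  then show "(\<lambda>n. measure M {\<omega>\<in>space M. \<bar>(\<integral>x. f x \<partial>Pcs n \<omega>) - (\<integral>x. f x \<partial>?\<Xi>)\<bar> \<ge> e}) \<longlonglongrightarrow> 0"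
    if "e > 0" for e
    using urn_cond_distr_conv_in_prob[OF _ f that] Pcs by simp
qed

end

text \<open>As a law on the whole space, \<open>\<Lambda>\<close> may charge points outside
  \<open>S\<close>: the kernel that halves the points of the interval (0, 1) leads to the unit mass
  at 0. Convergence among the probability measures on \<open>S\<close> is therefore claimed when
  \<open>\<Lambda>\<close> has mass 1 on \<open>S\<close>. Likewise \<open>P n\<close> lives on
  \<open>S\<close> and \<open>Pcs n\<close> on the whole space, so the two are compared through the
  inclusion.\<close>

theorem theorem3p2:
  fixes S :: "(real ^ 'd) set"
    and R :: "real ^ 'd \<Rightarrow> (real ^ 'd) measure"
    and U\<^sub>0 \<Lambda> :: "(real ^ 'd) measure"
    and M :: "'w measure"
    and U P Pcs :: "nat \<Rightarrow> 'w \<Rightarrow> (real ^ 'd) measure"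
    and Z :: "nat \<Rightarrow> 'w \<Rightarrow> real ^ 'd"
    and v :: "real ^ 'd"
    and a b :: "real \<Rightarrow> real"
  assumes S: "S \<noteq> {}" "polish_topology (top_of_set S)"
    and R: "markov_kernel (borel_on S) (borel_on S) R"
    and U0: "prob_on (borel_on S) U\<^sub>0"
    and urn: "urn_model M (borel_on S) R U\<^sub>0 U Z"
    and Lam: "prob_on borel \<Lambda>"
    and b_nonneg: "\<And>x. x \<ge> 0 \<Longrightarrow> b x \<ge> 0"
    and chain: "\<And>\<mu> (\<Omega> :: (nat \<Rightarrow> real ^ 'd) measure) X.
      prob_on (borel_on S) \<mu> \<Longrightarrow> markov_chain \<Omega> (borel_on S) R \<mu> X \<Longrightarrow>
      conv_in_distribution \<Omega> (\<lambda>n \<omega>. (X n \<omega> - a (real n) *\<^sub>R v) /\<^sub>R b (real n)) \<Lambda>"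
    and P: "\<And>n. regular_cond_distr M (past M (borel_on S) Z n) (borel_on S) (Z n) (P n)"
    and Pcs: "\<And>n. n \<ge> 1 \<Longrightarrow> regular_cond_distr M (past M (borel_on S) Z n) borel
      (\<lambda>\<omega>. (Z n \<omega> - a (ln (real n)) *\<^sub>R v) /\<^sub>R b (ln (real n))) (Pcs n)"
  shows
    "((\<forall>x\<ge>0. a x = 0) \<and> (\<forall>x\<ge>0. b x = 1) \<longrightarrow>
        (\<forall>n\<ge>1. AE \<omega> in M. Pcs n \<omega> = distr (P n \<omega>) borel (\<lambda>x. x)) \<and>
        (emeasure \<Lambda> S = 1 \<longrightarrow> conv_in_prob M (weak_topology S) P (restrict_space \<Lambda> S)))
   \<and> ((\<forall>x\<ge>0. a x = 0) \<and> regularly_varying b \<longrightarrow>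
        conv_in_prob M (weak_topology UNIV) Pcs \<Lambda>)
   \<and> (\<forall>a' b'. (\<forall>x>0. a differentiable (at x)) \<and> (deriv a \<longlongrightarrow> a') at_top \<and>
        regularly_varying b \<and> ((\<lambda>x. sqrt x / b x) \<longlongrightarrow> b') at_top \<longrightarrow>
        conv_in_prob M (weak_topology UNIV) Pcs
          (if a' = 0 \<or> b' = 0 then \<Lambda>
           else convolution \<Lambda> (normal_along \<bar>a' * b'\<bar> v)))"
proof (intro conjI impI allI)
  let ?N = "borel_on S"
  interpret M: prob_space M by (rule prob_space_urn[OF urn R])
  have sub: "subalgebra M (past M ?N Z n)" for n by (rule subalgebra_urn[OF urn R])
  have no_drift: "(\<lambda>j. (a (m j) - a (L j)) / b (L j)) \<longlonglongrightarrow> 0"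
    if a: "\<forall>x\<ge>0. a x = 0" and L: "filterlim L at_top sequentially" and m: "\<And>j. m j \<ge> 0"
    for L m :: "nat \<Rightarrow> real"
  proof (rule tendsto_eventually)
    have "eventually (\<lambda>j. L j \<ge> 0) sequentially"
      using L by (simp add: filterlim_at_top)
    then show "eventually (\<lambda>j. (a (m j) - a (L j)) / b (L j) = 0) sequentially"
      by eventually_elim (use a m in simp)
  qed
  {
    assume "(\<forall>x\<ge>0. a x = 0) \<and> (\<forall>x\<ge>0. b x = 1)"
    then have a: "\<forall>x\<ge>0. a x = 0" and b: "\<forall>x\<ge>0. b x = 1" by auto
    \<comment> \<open>The hypotheses on \<open>a\<close> and \<open>b\<close> concern nonnegative
      arguments; \<open>n \<ge> 1\<close> makes \<open>ln n\<close> nonnegative.\<close>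
    have shift: "(x - a (ln (real n)) *\<^sub>R v) /\<^sub>R b (ln (real n)) = x" if "n \<ge> 1" for n and x :: "real ^ 'd"
      using a b that by simp
    have id: "(\<lambda>x. x) \<in> ?N \<rightarrow>\<^sub>M borel" by (rule measurable_restrict_space1) simp
    have P': "regular_cond_distr M (past M ?N Z n) borel (Z n) (\<lambda>\<omega>. distr (P n \<omega>) borel (\<lambda>x. x))" for n
      by (rule regular_cond_distr_distr[OF sub measurable_urn_draw[OF urn R] P id])
    show "AE \<omega> in M. Pcs n \<omega> = distr (P n \<omega>) borel (\<lambda>x. x)" if "n \<ge> 1" for n
      using Pcs[OF that] by (intro regular_cond_distr_unique[OF sub _ P']) (simp add: shift[OF that])
    assume \<Lambda>S: "emeasure \<Lambda> S = 1"
    have b_pos: "eventually (\<lambda>x. b x > 0) at_top"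
      using eventually_ge_at_top[of 0] by eventually_elim (simp add: b)
    have kern: "markov_kernel M ?N (P n)" for n
    proof -
      have "markov_kernel (past M ?N Z n) ?N (P n)" using P by (simp add: regular_cond_distr_def)
      then show ?thesis
        unfolding markov_kernel_def space_urn_past[OF urn R]
        using measurable_from_subalg[OF sub] by blast
    qed
    \<comment> \<open>The limit theorem for \<open>Pcs\<close> is applied to the image of
      \<open>P n\<close> under the inclusion, which is a version of the same conditional law. This
      covers test functions continuous on the whole space; those continuous on \<open>S\<close>
      follow by approximation.\<close>
    have weak: "(\<lambda>n. measure M {\<omega>\<in>space M. \<bar>(\<integral>x. f x \<partial>P n \<omega>) - (\<integral>x. f x \<partial>\<Lambda>)\<bar> \<ge> e}) \<longlonglongrightarrow> 0"
      if f: "continuous_on UNIV f" "bounded (range f)" and e: "e > 0" for f :: "real ^ 'd \<Rightarrow> real" and e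
    proof -
      have ab: "(\<lambda>j. b (real (m j)) / b (L j)) \<longlonglongrightarrow> 1 \<and> (\<lambda>j. (a (real (m j)) - a (L j)) / b (L j)) \<longlonglongrightarrow> 0 * y"
        if L: "filterlim L at_top sequentially" for L and m :: "nat \<Rightarrow> nat" and y
      proof
        have "eventually (\<lambda>j. L j \<ge> 0) sequentially"
          using L by (simp add: filterlim_at_top)
        then have "eventually (\<lambda>j. b (real (m j)) / b (L j) = 1) sequentially"
          by eventually_elim (simp add: b)
        then show "(\<lambda>j. b (real (m j)) / b (L j)) \<longlonglongrightarrow> 1" by (rule tendsto_eventually)
        show "(\<lambda>j. (a (real (m j)) - a (L j)) / b (L j)) \<longlonglongrightarrow> 0 * y"
          using no_drift[OF a L, of "\<lambda>j. real (m j)"] by simp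
      qed
      have rc: "regular_cond_distr M (past M ?N Z n) borel
          (\<lambda>\<omega>. (Z n \<omega> - a (ln (real n)) *\<^sub>R v) /\<^sub>R b (ln (real n))) (\<lambda>\<omega>. distr (P n \<omega>) borel (\<lambda>x. x))"
        if "n \<ge> 1" for n
        using P'[of n] by (simp add: shift[OF that])
      have fm: "f \<in> borel_measurable borel" by (rule borel_measurable_continuous_onI[OF f(1)])
      have eq: "(\<integral>x. f x \<partial>distr (P n \<omega>) borel (\<lambda>x. x)) = (\<integral>x. f x \<partial>P n \<omega>)" if "\<omega> \<in> space M" for n \<omega>
      proof (rule integral_distr[OF _ fm])
        have "sets (P n \<omega>) = sets ?N"
          using kern[of n] that by (simp add: markov_kernel_def prob_on_def)
        from measurable_cong_sets[OF this refl] id show "(\<lambda>x. x) \<in> P n \<omega> \<rightarrow>\<^sub>M borel" by blast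
      qed
      interpret N: prob_space std_normal_distribution by (rule prob_space_normal_density) simp
      have "(\<lambda>n. measure M {\<omega>\<in>space M. \<bar>(\<integral>x. f x \<partial>distr (P n \<omega>) borel (\<lambda>x. x)) -
          (\<integral>y. (\<integral>x. f (x + (0 * y) *\<^sub>R v) \<partial>\<Lambda>) \<partial>std_normal_distribution)\<bar> \<ge> e}) \<longlonglongrightarrow> 0"
        by (rule urn_cond_distr_conv_in_prob[OF R urn Lam _ b_pos _ _ f e])
          ((rule chain ab rc; assumption)+)
      moreover have "(\<integral>y. (\<integral>x. f (x + (0 * y) *\<^sub>R v) \<partial>\<Lambda>) \<partial>std_normal_distribution) = (\<integral>x. f x \<partial>\<Lambda>)"
        using N.prob_space by (simp del: integral_density)
      moreover have "{\<omega>\<in>space M. \<bar>(\<integral>x. f x \<partial>distr (P n \<omega>) borel (\<lambda>x. x)) - c\<bar> \<ge> e} =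
          {\<omega>\<in>space M. \<bar>(\<integral>x. f x \<partial>P n \<omega>) - c\<bar> \<ge> e}" for n c
        using eq by (intro Collect_cong conj_cong refl) simp
      ultimately show ?thesis by (simp only:)
    qed
    show "conv_in_prob M (weak_topology S) P (restrict_space \<Lambda> S)"
    proof (rule conv_in_prob_weak_topology[OF M.prob_space_axioms prob_on_restrict_space[OF Lam \<Lambda>S]])
      show "prob_on ?N (P n \<omega>)" if "\<omega> \<in> space M" for n \<omega>
        using kern that by (simp add: markov_kernel_def)
      fix f :: "real ^ 'd \<Rightarrow> real" assume f: "continuous_on S f" "bounded (f ` S)"
      then obtain B where "\<And>x. x \<in> S \<Longrightarrow> \<bar>f x\<bar> \<le> B" by (auto simp: bounded_iff)
      then have "bdd_measurable ?N B f"
        using borel_measurable_continuous_on_restrict[OF f(1)] by (simp add: bdd_measurable_def space_restrict_space)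
      then show "(\<lambda>\<omega>. \<integral>x. f x \<partial>P n \<omega>) \<in> borel_measurable M" for n
        by (rule bdd_measurable_measurable[OF bdd_measurable_kernel_integral[OF kern]])
      show "(\<lambda>n. measure M {\<omega>\<in>space M. \<bar>(\<integral>x. f x \<partial>P n \<omega>) - (\<integral>x. f x \<partial>restrict_space \<Lambda> S)\<bar> \<ge> e}) \<longlonglongrightarrow> 0"
        if "e > 0" for e
        by (rule conv_in_prob_restrict_space[OF M.prob_space_axioms Lam S(1) \<Lambda>S kern _ f that])
          (rule weak)
    qed
  next
    assume "(\<forall>x\<ge>0. a x = 0) \<and> regularly_varying b"
    then have a: "\<forall>x\<ge>0. a x = 0" and b: "regularly_varying b" by auto
    have ab: "(\<lambda>j. b (real (m j)) / b (L j)) \<longlonglongrightarrow> 1 \<and> (\<lambda>j. (a (real (m j)) - a (L j)) / b (L j)) \<longlonglongrightarrow> 0 * y"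
      if "filterlim L at_top sequentially" "(\<lambda>j. real (m j) / L j) \<longlonglongrightarrow> 1" for L and m :: "nat \<Rightarrow> nat" and y
      using regularly_varying_ratio_LIMSEQ[OF b that] no_drift[OF a that(1), of "\<lambda>j. real (m j)"] by simp
    have "conv_in_prob M (weak_topology UNIV) Pcs
        (if 0 = (0::real) then \<Lambda> else convolution \<Lambda> (normal_along \<bar>0\<bar> v))"
      by (rule urn_cond_distr_weak_limit[OF R urn Lam _ regularly_varying_eventually_pos[OF b]])
        ((rule chain ab Pcs; assumption)+)
    then show "conv_in_prob M (weak_topology UNIV) Pcs \<Lambda>" by simp
  next
    fix a' b'
    assume "(\<forall>x>0. a differentiable (at x)) \<and> (deriv a \<longlongrightarrow> a') at_top \<and>
        regularly_varying b \<and> ((\<lambda>x. sqrt x / b x) \<longlongrightarrow> b') at_top"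
    then have a: "\<And>x. x > 0 \<Longrightarrow> a differentiable (at x)" and a': "(deriv a \<longlongrightarrow> a') at_top"
      and b: "regularly_varying b" and b': "((\<lambda>x. sqrt x / b x) \<longlongrightarrow> b') at_top" by auto
    \<comment> \<open>Regular variation handles the scale and the derivative of \<open>a\<close> the
      centring, which gives \<open>\<kappa> = a' * b'\<close>.\<close>
    have ab: "(\<lambda>j. b (real (m j)) / b (L j)) \<longlonglongrightarrow> 1 \<and>
        (\<lambda>j. (a (real (m j)) - a (L j)) / b (L j)) \<longlonglongrightarrow> a' * b' * y"
      if "filterlim L at_top sequentially" "filterlim m at_top sequentially"
        "(\<lambda>j. real (m j) / L j) \<longlonglongrightarrow> 1" "(\<lambda>j. (real (m j) - L j) / sqrt (L j)) \<longlonglongrightarrow> y"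
      for L and m :: "nat \<Rightarrow> nat" and y
      using regularly_varying_ratio_LIMSEQ[OF b that(1,3)]
        centering_increment_LIMSEQ[OF a a' b' that(1) filterlim_compose[OF filterlim_real_sequentially that(2)] that(4)]
      by blast
    have "conv_in_prob M (weak_topology UNIV) Pcs
        (if a' * b' = 0 then \<Lambda> else convolution \<Lambda> (normal_along \<bar>a' * b'\<bar> v))"
      by (rule urn_cond_distr_weak_limit[OF R urn Lam _ regularly_varying_eventually_pos[OF b]])
        ((rule chain ab Pcs; assumption)+)
    then show "conv_in_prob M (weak_topology UNIV) Pcs
          (if a' = 0 \<or> b' = 0 then \<Lambda> else convolution \<Lambda> (normal_along \<bar>a' * b'\<bar> v))"
      by (simp only: mult_eq_0_iff)
  }
qed

end
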